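(* Let $3\le n<\omega$, $k\le n-3$, $\lambda=\aleph_k$, and let $M_0,M_1,M_2,M_3\in\mathbf{K}^n_\lambda$ with $M_0\le_{\mathbf{K}^n}M_\ell\le_{\mathbf{K}^n}M_3$ for $\ell=1,2$. If $\mathfrak{s}^{k,n}$ is weakly successful, then $\mathrm{NF}_{\mathfrak{s}^{k,n}}(M_0,M_1,M_2,M_3)$ holds if and only if $M_1\cap M_2=M_0$.
   Context: Hart–Shelah class $\mathbf{K}^n$ ($n\ge2$): models $M$ with sorts $I(M)$ (index set), $K(M)=[I(M)]^n$ with membership, $H\cong\mathbb{Z}_2$, $G(M)=\bigoplus_{u\in K}\mathbb{Z}_2$ with evaluation and support functions, $G^*(M)$ with projection onto $K$ and a regular $G$-action on each stalk, $H^*(M)$ with projection onto $K$ and a regular $\mathbb{Z}_2$-action on each stalk, and $Q\subseteq(G^* )^n\times H^*$ symmetric in the first $n$ arguments, holding only on compatible stalk indices (all $n$-subsets of one $(n+1)$-subset of $I$), such that moving $x_\ell$ by $\gamma_\ell\in G$ and $y\in H^*_v$ by $m\in\mathbb{Z}_2$ preserves the truth value of $Q$ iff $\gamma_1(v)+\dots+\gamma_n(v)+m\equiv0\pmod2$. It is $\mathbb{L}_{\omega_1,\omega}$-axiomatizable and ordered by $\mathbb{L}_{\omega_1,\omega}$-elementary substructure $\le_{\mathbf{K}^n}$; $\mathbf{K}^n_\lambda$ = models of cardinality $\lambda$; $\mathbf{K}^n$ is categorical in $\aleph_k$ for $k\le n-2$. $\mathfrak{s}^{k,n}$ ($n\ge3$,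 $k\le n-3$): the good $\aleph_k$-frame on $\mathbf{K}^n_{\aleph_k}$ whose basic types over $M$ are $\mathrm{gtp}(a/M;N)$ with $a\in I(N)\setminus I(M)$, and where for $M_0\le M_1\le M_2$, $\mathrm{gtp}(a/M_1;M_2)$ does not fork over $M_0$ iff $a\in I(M_2)\setminus I(M_1)$. Uniqueness triple (for a good $\lambda$-frame): $(a,M,N)$ with $M\le N$ in $\mathbf{K}_\lambda$, $a\in N\setminus M$, $\mathrm{gtp}(a/M;N)$ basic, such that for every $M_1\ge M$ in $\mathbf{K}_\lambda$ there is, up to equivalence over $M$, a unique amalgam $(f_1,f_2,N_1)$ ($N_1\in\mathbf{K}_\lambda$, $f_1:N\to N_1$, $f_2:M_1\to N_1$ fixing $M$) with $\mathrm{gtp}(f_1(a)/f_2[M_1];N_1)$ not forking over $M$; amalgams $(f^x_1,f^x_2,N^x)$ are equivalent over $M$ if there are $N_*\in\mathbf{K}_\lambda$, $f^x:N^x\to N_*$ with $f^af^a_\ell=f^bf^b_\ell$. Weakly successful: every basic type is $\mathrm{gtp}(a/M;N)$ for some uniqueness triple. $\mathrm{NF}=\mathrm{NF}_{\mathfrak{s}}$ for a weakly successful $\mathfrak{s}$ with $\mathbf{K}$ categorical in $\lambda$: $\mathrm{NF}^*(N_0,N_1,N_2,N_3)$ holds iff there are $\alpha^*<\lambda^+$, increasing continuous $\langle N_{1,i}:i\le\alpha^*\rangle$, $\langle N_{2,i}:i\le\alpha^*\rangle$ in $\mathbf{K}_\lambda$ and $\langle d_i:i<\alpha^*\rangle$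 with $N_0\le N_\ell\le N_3$ ($\ell<4$), $N_{1,0}=N_0$, $N_{1,\alpha^*}=N_1$, $N_{2,0}=N_2$, $N_{2,\alpha^*}=N_3$, $N_{1,i}\le N_{2,i}$, $d_i\in N_{1,i+1}\setminus N_{1,i}$, $(d_i,N_{1,i},N_{1,i+1})$ a uniqueness triple, and $\mathrm{gtp}(d_i/N_{2,i};N_{2,i+1})$ not forking over $N_{1,i}$. $\mathrm{NF}(M_0,M_1,M_2,M_3)$ holds iff there are $N_0=M_0$ and $N_\ell\ge M_\ell$ ($\ell=1,2,3$) in $\mathbf{K}_\lambda$ with $\mathrm{NF}^*(N_0,N_1,N_2,N_3)$. *)

theory Defs
  imports Main "HOL-Combinatorics.Permutations"
begin

primrec card_aleph :: "nat \<Rightarrow> 'a set \<Rightarrow> bool" where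
  "card_aleph 0 A = ((card_of A, natLeq) \<in> ordIso)"
| "card_aleph (Suc k) A = (\<exists>B. card_aleph k B \<and> (card_of A, cardSuc (card_of B)) \<in> ordIso)"

definition card_le_aleph :: "nat \<Rightarrow> 'a set \<Rightarrow> bool" where
  "card_le_aleph k A = (\<exists>B::'a set. card_aleph k B \<and> (card_of A, card_of B) \<in> ordLeq)"

section \<open>Vocabulary of K^n (relational, one-sorted encoding; sorts are unary predicates)\<close>

datatype sym = SI | SK | SH | SG | SGs | SHs
  | Mem | HAdd | GAdd | Ev | Supp | PrG | ActG | PrH | ActH | Qr

fun arity :: "nat \<Rightarrow> sym \<Rightarrow> nat" where
  "arity n SI = 1" | "arity n SK = 1" | "arity n SH = 1" | "arity n SG = 1"
| "arity n SGs = 1" | "arity n SHs = 1"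
| "arity n Mem = 2" | "arity n HAdd = 3" | "arity n GAdd = 3" | "arity n Ev = 3"
| "arity n Supp = 2" | "arity n PrG = 2" | "arity n ActG = 3" | "arity n PrH = 2"
| "arity n ActH = 3" | "arity n Qr = Suc n"

record 'u str =
  dom :: "'u set"
  rels :: "sym \<Rightarrow> 'u list set"

definition wf_str :: "nat \<Rightarrow> 'u str \<Rightarrow> bool" where
  "wf_str n M = (\<forall>r. \<forall>xs\<in>rels M r. set xs \<subseteq> dom M \<and> length xs = arity n r)"

definition img :: "('u \<Rightarrow> 'u) \<Rightarrow> 'u str \<Rightarrow> 'u str" where
  "img f M = \<lparr>dom = f ` dom M, rels = (\<lambda>r. map f ` rels M r)\<rparr>"

definition Union_str :: "'u str set \<Rightarrow> 'u str" where
  "Union_str S = \<lparr>dom = (\<Union>M\<in>S. dom M), rels = (\<lambda>r. \<Union>M\<in>S. rels M r)\<rparr>"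

datatype fm = FEq nat nat | FRel sym "nat list" | FNeg fm
  | FConj "nat \<Rightarrow> fm"
  | FEx nat fm

primrec fv :: "fm \<Rightarrow> nat set" where
  "fv (FEq x y) = {x, y}"
| "fv (FRel r xs) = set xs"
| "fv (FNeg \<phi>) = fv \<phi>"
| "fv (FConj f) = (\<Union>i. fv (f i))"
| "fv (FEx x \<phi>) = fv \<phi> - {x}"

text \<open>L_{omega_1,omega}: every subformula has only finitely many free variables.\<close>
primrec wff :: "fm \<Rightarrow> bool" where
  "wff (FEq x y) = True"
| "wff (FRel r xs) = True"
| "wff (FNeg \<phi>) = wff \<phi>"
| "wff (FConj f) = ((\<forall>i. wff (f i)) \<and> finite (\<Union>i. fv (f i)))"
| "wff (FEx x \<phi>) = wff \<phi>"

primrec sat :: "'u str \<Rightarrow> (nat \<Rightarrow> 'u) \<Rightarrow> fm \<Rightarrow> bool" where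
  "sat M e (FEq x y) = (e x = e y)"
| "sat M e (FRel r xs) = (map e xs \<in> rels M r)"
| "sat M e (FNeg \<phi>) = (\<not> sat M e \<phi>)"
| "sat M e (FConj f) = (\<forall>i. sat M e (f i))"
| "sat M e (FEx x \<phi>) = (\<exists>a\<in>dom M. sat M (e(x := a)) \<phi>)"

definition elem_sub :: "'u str \<Rightarrow> 'u str \<Rightarrow> bool" where
  "elem_sub M N = (dom M \<subseteq> dom N \<and>
     (\<forall>\<phi> e. wff \<phi> \<longrightarrow> (\<forall>x. e x \<in> dom M) \<longrightarrow> (sat M e \<phi> \<longleftrightarrow> sat N e \<phi>)))"

definition srt :: "'u str \<Rightarrow> sym \<Rightarrow> 'u set" where
  "srt M s = {x. [x] \<in> rels M s}"

definition sorts :: "sym set" where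
  "sorts = {SI, SK, SH, SG, SGs, SHs}"

definition memb :: "'u str \<Rightarrow> 'u \<Rightarrow> 'u set" where
  "memb M u = {a. [a, u] \<in> rels M Mem}"

definition hzero :: "'u str \<Rightarrow> 'u" where
  "hzero M = (THE h. [h, h, h] \<in> rels M HAdd)"
definition hadd :: "'u str \<Rightarrow> 'u \<Rightarrow> 'u \<Rightarrow> 'u" where
  "hadd M a b = (THE c. [a, b, c] \<in> rels M HAdd)"
definition ev :: "'u str \<Rightarrow> 'u \<Rightarrow> 'u \<Rightarrow> 'u" where
  "ev M g u = (THE h. [g, u, h] \<in> rels M Ev)"
definition prg :: "'u str \<Rightarrow> 'u \<Rightarrow> 'u" where
  "prg M x = (THE u. [x, u] \<in> rels M PrG)"
definition actg :: "'u str \<Rightarrow> 'u \<Rightarrow> 'u \<Rightarrow> 'u" where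
  "actg M g x = (THE y. [g, x, y] \<in> rels M ActG)"
definition prh :: "'u str \<Rightarrow> 'u \<Rightarrow> 'u" where
  "prh M x = (THE u. [x, u] \<in> rels M PrH)"
definition acth :: "'u str \<Rightarrow> 'u \<Rightarrow> 'u \<Rightarrow> 'u" where
  "acth M h x = (THE y. [h, x, y] \<in> rels M ActH)"

text \<open>stalk index of the l-th argument of a Q-tuple (first n in G*, last in H*)\<close>
definition qidx :: "nat \<Rightarrow> 'u str \<Rightarrow> 'u list \<Rightarrow> nat \<Rightarrow> 'u" where
  "qidx n M xs l = (if l < n then prg M (xs ! l) else prh M (xs ! n))"

text \<open>compatible: the n+1 stalk indices are exactly the n-subsets of one (n+1)-subset of I\<close>
definition compatible :: "nat \<Rightarrow> 'u str \<Rightarrow> 'u list \<Rightarrow> bool" where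
  "compatible n M xs = (\<exists>w. w \<subseteq> srt M SI \<and> finite w \<and> card w = Suc n \<and>
      (\<forall>l\<le>n. memb M (qidx n M xs l) \<subseteq> w) \<and>
      distinct (map (qidx n M xs) [0..<Suc n]))"

definition Kn :: "nat \<Rightarrow> 'u str \<Rightarrow> bool" where
  "Kn n M = (
    let I = srt M SI; K = srt M SK; H = srt M SH; G = srt M SG;
        Gs = srt M SGs; Hs = srt M SHs; z = hzero M in
    wf_str n M
    \<comment> \<open>many-sorted: universe is the disjoint union of the sorts\<close>
    \<and> dom M = (\<Union>s\<in>sorts. srt M s)
    \<and> (\<forall>s\<in>sorts. \<forall>s'\<in>sorts. s \<noteq> s' \<longrightarrow> srt M s \<inter> srt M s' = {})
    \<comment> \<open>K = [I]^n with membership\<close>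
    \<and> (\<forall>xs\<in>rels M Mem. xs ! 0 \<in> I \<and> xs ! 1 \<in> K)
    \<and> (\<forall>u\<in>K. finite (memb M u) \<and> card (memb M u) = n)
    \<and> inj_on (memb M) K
    \<and> (\<forall>w. w \<subseteq> I \<and> finite w \<and> card w = n \<longrightarrow> (\<exists>u\<in>K. memb M u = w))
    \<comment> \<open>H is Z_2\<close>
    \<and> (\<exists>h0 h1. h0 \<noteq> h1 \<and> H = {h0, h1} \<and>
         rels M HAdd = {[h0,h0,h0], [h0,h1,h1], [h1,h0,h1], [h1,h1,h0]})
    \<comment> \<open>G is the direct sum of copies of Z_2 indexed by K, with evaluation and support\<close>
    \<and> (\<forall>xs\<in>rels M Ev. xs ! 0 \<in> G \<and> xs ! 1 \<in> K \<and> xs ! 2 \<in> H)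
    \<and> (\<forall>g\<in>G. \<forall>u\<in>K. \<exists>!h. [g, u, h] \<in> rels M Ev)
    \<and> (\<forall>g\<in>G. finite {u\<in>K. ev M g u \<noteq> z})
    \<and> (\<forall>g\<in>G. \<forall>g'\<in>G. (\<forall>u\<in>K. ev M g u = ev M g' u) \<longrightarrow> g = g')
    \<and> (\<forall>f. (\<forall>u\<in>K. f u \<in> H) \<and> finite {u\<in>K. f u \<noteq> z} \<longrightarrow> (\<exists>g\<in>G. \<forall>u\<in>K. ev M g u = f u))
    \<and> rels M GAdd = {[a, b, c] | a b c. a \<in> G \<and> b \<in> G \<and> c \<in> G \<and>
                       (\<forall>u\<in>K. ev M c u = hadd M (ev M a u) (ev M b u))}
    \<and> rels M Supp = {[g, u] | g u. g \<in> G \<and> u \<in> K \<and> ev M g u \<noteq> z}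
    \<comment> \<open>G* with projection onto K and a regular G-action on each stalk\<close>
    \<and> (\<forall>xs\<in>rels M PrG. xs ! 0 \<in> Gs \<and> xs ! 1 \<in> K)
    \<and> (\<forall>x\<in>Gs. \<exists>!u. [x, u] \<in> rels M PrG)
    \<and> (\<forall>u\<in>K. \<exists>x\<in>Gs. prg M x = u)
    \<and> (\<forall>xs\<in>rels M ActG. xs ! 0 \<in> G \<and> xs ! 1 \<in> Gs \<and> xs ! 2 \<in> Gs)
    \<and> (\<forall>g\<in>G. \<forall>x\<in>Gs. \<exists>!y. [g, x, y] \<in> rels M ActG)
    \<and> (\<forall>g\<in>G. \<forall>x\<in>Gs. prg M (actg M g x) = prg M x)
    \<and> (\<forall>g\<in>G. \<forall>x\<in>Gs. (\<forall>u\<in>K. ev M g u = z) \<longrightarrow> actg M g x = x)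
    \<and> (\<forall>xs\<in>rels M GAdd. \<forall>x\<in>Gs. actg M (xs ! 2) x = actg M (xs ! 0) (actg M (xs ! 1) x))
    \<and> (\<forall>x\<in>Gs. \<forall>y\<in>Gs. prg M x = prg M y \<longrightarrow> (\<exists>!g. g \<in> G \<and> actg M g x = y))
    \<comment> \<open>H* with projection onto K and a regular Z_2-action on each stalk\<close>
    \<and> (\<forall>xs\<in>rels M PrH. xs ! 0 \<in> Hs \<and> xs ! 1 \<in> K)
    \<and> (\<forall>x\<in>Hs. \<exists>!u. [x, u] \<in> rels M PrH)
    \<and> (\<forall>u\<in>K. \<exists>x\<in>Hs. prh M x = u)
    \<and> (\<forall>xs\<in>rels M ActH. xs ! 0 \<in> H \<and> xs ! 1 \<in> Hs \<and> xs ! 2 \<in> Hs)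
    \<and> (\<forall>h\<in>H. \<forall>x\<in>Hs. \<exists>!y. [h, x, y] \<in> rels M ActH)
    \<and> (\<forall>h\<in>H. \<forall>x\<in>Hs. prh M (acth M h x) = prh M x)
    \<and> (\<forall>x\<in>Hs. acth M z x = x)
    \<and> (\<forall>a\<in>H. \<forall>b\<in>H. \<forall>x\<in>Hs. acth M (hadd M a b) x = acth M a (acth M b x))
    \<and> (\<forall>x\<in>Hs. \<forall>y\<in>Hs. prh M x = prh M y \<longrightarrow> (\<exists>!h. h \<in> H \<and> acth M h x = y))
    \<comment> \<open>Q: on (G*)^n x H*, symmetric in the first n arguments, only on compatible tuples\<close>
    \<and> (\<forall>xs\<in>rels M Qr. (\<forall>l<n. xs ! l \<in> Gs) \<and> xs ! n \<in> Hs \<and> compatible n M xs)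
    \<and> (\<forall>xs\<in>rels M Qr. \<forall>p. p permutes {..<n} \<longrightarrow>
          map (\<lambda>l. if l < n then xs ! p l else xs ! l) [0..<Suc n] \<in> rels M Qr)
    \<comment> \<open>the defining invariance of Q\<close>
    \<and> (\<forall>xs. length xs = Suc n \<and> (\<forall>l<n. xs ! l \<in> Gs) \<and> xs ! n \<in> Hs \<and> compatible n M xs \<longrightarrow>
         (\<forall>gs m. (\<forall>l<n. gs l \<in> G) \<and> m \<in> H \<longrightarrow>
            (let v = prh M (xs ! n);
                 ys = map (\<lambda>l. if l < n then actg M (gs l) (xs ! l) else acth M m (xs ! n)) [0..<Suc n];
                 s = foldr (\<lambda>l acc. hadd M (ev M (gs l) v) acc) [0..<n] m
             in ((ys \<in> rels M Qr \<longleftrightarrow> xs \<in> rels M Qr) \<longleftrightarrow> s = z)))))"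

definition Kl :: "nat \<Rightarrow> nat \<Rightarrow> 'u str \<Rightarrow> bool" where
  "Kl n k M = (Kn n M \<and> card_aleph k (dom M))"

definition leK :: "nat \<Rightarrow> 'u str \<Rightarrow> 'u str \<Rightarrow> bool" where
  "leK n M N = (Kn n M \<and> Kn n N \<and> elem_sub M N)"

definition kemb :: "nat \<Rightarrow> ('u \<Rightarrow> 'u) \<Rightarrow> 'u str \<Rightarrow> 'u str \<Rightarrow> bool" where
  "kemb n f M N = (Kn n M \<and> inj_on f (dom M) \<and> leK n (img f M) N)"

definition gtrip :: "nat \<Rightarrow> nat \<Rightarrow> 'u \<times> 'u str \<times> 'u str \<Rightarrow> bool" where
  "gtrip n k t = (case t of (a, M, N) \<Rightarrow> Kl n k M \<and> Kl n k N \<and> leK n M N \<and> a \<in> dom N)"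

definition gtp_at :: "nat \<Rightarrow> nat \<Rightarrow> 'u \<times> 'u str \<times> 'u str \<Rightarrow> 'u \<times> 'u str \<times> 'u str \<Rightarrow> bool" where
  "gtp_at n k t t' = (gtrip n k t \<and> gtrip n k t' \<and>
     (case t of (a, M, N) \<Rightarrow> case t' of (b, M', N') \<Rightarrow>
       M = M' \<and> (\<exists>N'' f g. Kl n k N'' \<and> kemb n f N N'' \<and> kemb n g N' N'' \<and>
          (\<forall>x\<in>dom M. f x = x \<and> g x = x) \<and> f a = g b)))"

definition gtp_eq :: "nat \<Rightarrow> nat \<Rightarrow> 'u \<times> 'u str \<times> 'u str \<Rightarrow> 'u \<times> 'u str \<times> 'u str \<Rightarrow> bool" where
  "gtp_eq n k = tranclp (gtp_at n k)"

definition basic :: "nat \<Rightarrow> nat \<Rightarrow> 'u \<Rightarrow> 'u str \<Rightarrow> 'u str \<Rightarrow> bool" where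
  "basic n k a M N = (Kl n k M \<and> Kl n k N \<and> leK n M N \<and> a \<in> srt N SI - srt M SI)"

definition nonfork :: "nat \<Rightarrow> nat \<Rightarrow> 'u str \<Rightarrow> 'u str \<Rightarrow> 'u \<Rightarrow> 'u str \<Rightarrow> bool" where
  "nonfork n k M0 M1 a M2 = (Kl n k M0 \<and> Kl n k M1 \<and> Kl n k M2 \<and> leK n M0 M1 \<and> leK n M1 M2
      \<and> a \<in> srt M2 SI - srt M1 SI)"

definition amalgam :: "nat \<Rightarrow> nat \<Rightarrow> 'u \<Rightarrow> 'u str \<Rightarrow> 'u str \<Rightarrow> 'u str
     \<Rightarrow> ('u \<Rightarrow> 'u) \<Rightarrow> ('u \<Rightarrow> 'u) \<Rightarrow> 'u str \<Rightarrow> bool" where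
  "amalgam n k a M N M1 f1 f2 N1 = (Kl n k N1 \<and> kemb n f1 N N1 \<and> kemb n f2 M1 N1 \<and>
      (\<forall>x\<in>dom M. f1 x = x \<and> f2 x = x) \<and> nonfork n k M (img f2 M1) (f1 a) N1)"

definition amalgam_equiv :: "nat \<Rightarrow> nat \<Rightarrow> 'u str \<Rightarrow> 'u str
     \<Rightarrow> ('u \<Rightarrow> 'u) \<Rightarrow> ('u \<Rightarrow> 'u) \<Rightarrow> 'u str \<Rightarrow> ('u \<Rightarrow> 'u) \<Rightarrow> ('u \<Rightarrow> 'u) \<Rightarrow> 'u str \<Rightarrow> bool" where
  "amalgam_equiv n k N M1 f1 f2 Na g1 g2 Nb = (\<exists>Ns ha hb. Kl n k Ns \<and> kemb n ha Na Ns \<and> kemb n hb Nb Ns \<and>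
      (\<forall>x\<in>dom N. ha (f1 x) = hb (g1 x)) \<and> (\<forall>x\<in>dom M1. ha (f2 x) = hb (g2 x)))"

definition uq_triple :: "nat \<Rightarrow> nat \<Rightarrow> 'u \<Rightarrow> 'u str \<Rightarrow> 'u str \<Rightarrow> bool" where
  "uq_triple n k a M N = (Kl n k M \<and> Kl n k N \<and> leK n M N \<and> a \<in> dom N - dom M \<and> basic n k a M N \<and>
     (\<forall>M1. Kl n k M1 \<and> leK n M M1 \<longrightarrow>
        (\<exists>f1 f2 N1. amalgam n k a M N M1 f1 f2 N1) \<and>
        (\<forall>f1 f2 Na g1 g2 Nb. amalgam n k a M N M1 f1 f2 Na \<longrightarrow> amalgam n k a M N M1 g1 g2 Nb \<longrightarrow>
            amalgam_equiv n k N M1 f1 f2 Na g1 g2 Nb)))"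

definition weakly_successful :: "nat \<Rightarrow> nat \<Rightarrow> 'u itself \<Rightarrow> bool" where
  "weakly_successful n k _ = (\<forall>(b::'u) M N. basic n k b M N \<longrightarrow>
      (\<exists>a N'. uq_triple n k a M N' \<and> gtp_eq n k (a, M, N') (b, M, N)))"

text \<open>An ordinal alpha* < lambda^+ together with the indices i <= alpha* is represented by a
  well-order W (on elements of 'u) with a greatest element top (= alpha*) and |Field W| <= lambda.\<close>
definition isucc :: "'u rel \<Rightarrow> 'u \<Rightarrow> 'u \<Rightarrow> bool" where
  "isucc W i j = ((i, j) \<in> W \<and> i \<noteq> j \<and> \<not> (\<exists>m. (i, m) \<in> W \<and> (m, j) \<in> W \<and> m \<noteq> i \<and> m \<noteq> j))"

definition NFstar :: "nat \<Rightarrow> nat \<Rightarrow> 'u str \<Rightarrow> 'u str \<Rightarrow> 'u str \<Rightarrow> 'u str \<Rightarrow> bool" where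
  "NFstar n k N0 N1 N2 N3 = (
     Kl n k N0 \<and> Kl n k N1 \<and> Kl n k N2 \<and> Kl n k N3 \<and>
     leK n N0 N1 \<and> leK n N0 N2 \<and> leK n N0 N3 \<and> leK n N1 N3 \<and> leK n N2 N3 \<and>
     (\<exists>(W::'u rel) bot top C1 C2 d.
        Well_order W \<and> card_le_aleph k (Field W) \<and>
        bot \<in> Field W \<and> top \<in> Field W \<and> (\<forall>i\<in>Field W. (bot, i) \<in> W \<and> (i, top) \<in> W) \<and>
        (\<forall>i\<in>Field W. Kl n k (C1 i) \<and> Kl n k (C2 i) \<and> leK n (C1 i) (C2 i)) \<and>
        (\<forall>i j. (i, j) \<in> W \<longrightarrow> leK n (C1 i) (C1 j) \<and> leK n (C2 i) (C2 j)) \<and>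
        (\<forall>j\<in>Field W. j \<noteq> bot \<and> \<not> (\<exists>i. isucc W i j) \<longrightarrow>
            C1 j = Union_str {C1 i | i. (i, j) \<in> W \<and> i \<noteq> j} \<and>
            C2 j = Union_str {C2 i | i. (i, j) \<in> W \<and> i \<noteq> j}) \<and>
        C1 bot = N0 \<and> C1 top = N1 \<and> C2 bot = N2 \<and> C2 top = N3 \<and>
        (\<forall>i j. isucc W i j \<longrightarrow>
            d i \<in> dom (C1 j) - dom (C1 i) \<and> uq_triple n k (d i) (C1 i) (C1 j) \<and>
            nonfork n k (C1 i) (C2 i) (d i) (C2 j))))"

definition NF :: "nat \<Rightarrow> nat \<Rightarrow> 'u str \<Rightarrow> 'u str \<Rightarrow> 'u str \<Rightarrow> 'u str \<Rightarrow> bool" where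
  "NF n k M0 M1 M2 M3 = (\<exists>N1 N2 N3. Kl n k N1 \<and> Kl n k N2 \<and> Kl n k N3 \<and>
      leK n M1 N1 \<and> leK n M2 N2 \<and> leK n M3 N3 \<and> NFstar n k M0 N1 N2 N3)"

end

theory Submission
  imports Defs
begin

text \<open>
  Choosing a base point in every stalk of a model identifies it with a concrete structure on finite
  subsets of its index set; the only remaining freedom is a function \<open>c\<close> recording the truth value
  of \<open>Q\<close> on the base points. Moving the base points changes \<open>c\<close> by a coboundary. Over a finite index
  set every two functions \<open>c\<close> differ by a coboundary, because \<open>n \<ge> 2\<close> leaves for each equation an
  unknown that occurs in no other one. This gives a back-and-forth system, so that
  \<open>\<le>\<close> between models is the same as being a substructure that is closed under supports.
  Coordinates of two substructures that agree on the overlap extend to a common superstructure, whence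
  disjoint amalgamation over any model.

  If \<open>(a, M, N)\<close> is a uniqueness triple, comparing an amalgam with the disjoint one shows that all
  amalgams are disjoint; so non-forking amalgamation forces \<open>M\<^sub>1 \<inter> M\<^sub>2 = M\<^sub>0\<close>, by induction along the
  resolution. Conversely, weak success yields a uniqueness triple \<open>(a', M, N')\<close> realising the type of
  any new index \<open>a\<close>, and the extension of \<open>M\<close> by the single index \<open>a\<close> embeds into \<open>N'\<close> over \<open>M\<close>;
  hence one-index extensions are themselves uniqueness triples. If \<open>M\<^sub>1 \<inter> M\<^sub>2 = M\<^sub>0\<close>, common coordinates of
  \<open>M\<^sub>0, M\<^sub>1, M\<^sub>2, M\<^sub>3\<close> exist, and adding the indices of \<open>M\<^sub>3\<close> outside \<open>M\<^sub>2\<close> one by one to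
  \<open>M\<^sub>0\<close> and to \<open>M\<^sub>2\<close> gives the required resolutions.
\<close>

text \<open>Elements of \<open>G\<close> have finite support, so moving one base point in
  \<open>Gs\<close> affects only finitely many equations, and the argument that equalises two
  functions \<open>c\<close> over a finite set breaks down over an infinite one. This shapes the
  proof: functions \<open>c\<close> of unrelated models are made equal over finite label sets only,
  which is enough for elementarity because a formula has finitely many free variables and an element
  involves finitely many indices. Elsewhere coordinates are mostly extended, and an
  \<open>(n+1)\<close>-set of indices that lies on neither side of an amalgamation problem carries
  no constraint. The one comparison of base points over infinite index sets is that of a one-index
  extension with a realisation of its type; there both models lie in a third one, so the base points
  of each stalk differ by an element of its \<open>G\<close>, again of finite support.

  All models are carried by one fixed type. Amalgams must therefore be renamed into the complement
  of the part that is to stay fixed, and that complement must be shown to be large enough.\<close>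

section \<open>Models in coordinates\<close>

text \<open>\<open>CG g\<close> is the element of \<open>G\<close> with support \<open>g\<close>; \<open>CGs u g\<close> and \<open>CHs u m\<close> are the results of moving the
  base points of the stalks over \<open>u\<close> by \<open>g\<close> and by \<open>m\<close>.\<close>
datatype 'i cel = CI 'i | CK "'i set" | CH bool | CG "'i set set"
  | CGs "'i set" "'i set set" | CHs "'i set" bool

definition nsub :: "nat \<Rightarrow> 'i set \<Rightarrow> 'i set set" where
  "nsub n J = {u. u \<subseteq> J \<and> finite u \<and> card u = n}"

primrec cin :: "nat \<Rightarrow> 'i set \<Rightarrow> 'i cel \<Rightarrow> bool" where
  "cin n J (CI i) = (i \<in> J)"
| "cin n J (CK u) = (u \<in> nsub n J)"
| "cin n J (CH b) = True"
| "cin n J (CG g) = (finite g \<and> g \<subseteq> nsub n J)"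
| "cin n J (CGs u g) = (u \<in> nsub n J \<and> finite g \<and> g \<subseteq> nsub n J)"
| "cin n J (CHs u b) = (u \<in> nsub n J)"

definition cdom :: "nat \<Rightarrow> 'i set \<Rightarrow> 'i cel set" where
  "cdom n J = {x. cin n J x}"

lemma cdom_iff [simp]: "x \<in> cdom n J \<longleftrightarrow> cin n J x"
  by (simp add: cdom_def)

text \<open>The sum in Z_2 of \<open>m\<close> and the truth values \<open>P l\<close>; a move
  preserves \<open>Q\<close> exactly when this sum, taken for the move at the last stalk,
  vanishes.\<close>

definition par :: "nat \<Rightarrow> (nat \<Rightarrow> bool) \<Rightarrow> bool \<Rightarrow> bool" where
  "par n P m = (odd (card {l. l < n \<and> P l}) \<noteq> m)"

text \<open>In the clause for \<open>Qr\<close>, \<open>w\<close> is the \<open>(n+1)\<close>-set carrying the stalk indices, and \<open>c v w\<close> is the parity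
  required at \<open>v\<close>. The index set does not occur, so that enlarging it yields an extension.\<close>
definition crel :: "nat \<Rightarrow> ('i set \<Rightarrow> 'i set \<Rightarrow> bool) \<Rightarrow> sym \<Rightarrow> 'i cel list \<Rightarrow> bool" where
  "crel n c r xs = (case r of
     SI \<Rightarrow> \<exists>i. xs = [CI i]
   | SK \<Rightarrow> \<exists>u. xs = [CK u]
   | SH \<Rightarrow> \<exists>b. xs = [CH b]
   | SG \<Rightarrow> \<exists>g. xs = [CG g]
   | SGs \<Rightarrow> \<exists>u g. xs = [CGs u g]
   | SHs \<Rightarrow> \<exists>u m. xs = [CHs u m]
   | Mem \<Rightarrow> \<exists>i u. xs = [CI i, CK u] \<and> i \<in> u
   | HAdd \<Rightarrow> \<exists>a b. xs = [CH a, CH b, CH (a \<noteq> b)]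
   | GAdd \<Rightarrow> \<exists>g h. xs = [CG g, CG h, CG (sym_diff g h)]
   | Ev \<Rightarrow> \<exists>g u. xs = [CG g, CK u, CH (u \<in> g)]
   | Supp \<Rightarrow> \<exists>g u. xs = [CG g, CK u] \<and> u \<in> g
   | PrG \<Rightarrow> \<exists>u g. xs = [CGs u g, CK u]
   | ActG \<Rightarrow> \<exists>h u g. xs = [CG h, CGs u g, CGs u (sym_diff h g)]
   | PrH \<Rightarrow> \<exists>u m. xs = [CHs u m, CK u]
   | ActH \<Rightarrow> \<exists>h u m. xs = [CH h, CHs u m, CHs u (h \<noteq> m)]
   | Qr \<Rightarrow> \<exists>us gs v m w. xs = map (\<lambda>l. if l < n then CGs (us l) (gs l) else CHs v m) [0..<Suc n]
        \<and> finite w \<and> card w = Suc n \<and> v \<in> nsub n w \<and> bij_betw us {..<n} (nsub n w - {v})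
        \<and> c v w = par n (\<lambda>l. v \<in> gs l) m)"

definition cstr :: "nat \<Rightarrow> 'i set \<Rightarrow> ('i set \<Rightarrow> 'i set \<Rightarrow> bool) \<Rightarrow> 'i cel str" where
  "cstr n J c = \<lparr>dom = cdom n J, rels = (\<lambda>r. {xs. crel n c r xs \<and> set xs \<subseteq> cdom n J})\<rparr>"

text \<open>\<open>img\<close> covers only maps of a type to itself, whereas coordinate maps go from
  \<open>'i cel\<close> into the type that carries the model.\<close>

definition mimg :: "('a \<Rightarrow> 'b) \<Rightarrow> 'a str \<Rightarrow> 'b str" where
  "mimg f M = \<lparr>dom = f ` dom M, rels = (\<lambda>r. map f ` rels M r)\<rparr>"

lemma img_eq_mimg: "img f M = mimg f M"
  by (simp add: img_def mimg_def)

lemma mimg_mimg: "mimg f (mimg g M) = mimg (f \<circ> g) M"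
  by (simp add: mimg_def image_image comp_def)

lemma dom_cstr [simp]: "dom (cstr n J c) = cdom n J"
  and rels_cstr: "rels (cstr n J c) r = {xs. crel n c r xs \<and> set xs \<subseteq> cdom n J}"
  by (simp_all add: cstr_def)

lemma dom_mimg [simp]: "dom (mimg f M) = f ` dom M"
  and rels_mimg: "rels (mimg f M) r = map f ` rels M r"
  by (simp_all add: mimg_def)

section \<open>Sets of size n and parities\<close>

lemma card_nsub_Suc:
  assumes "finite w" "card w = Suc n"
  shows "card (nsub n w) = Suc n"
  using n_subsets[OF assms(1), of n] assms finite_subset[OF _ assms(1)]
  by (simp add: nsub_def cong: conj_cong)

lemma finite_nsub: "finite w \<Longrightarrow> finite (nsub n w)"
  by (rule finite_subset[of _ "Pow w"]) (auto simp: nsub_def)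

lemma nsub_mono: "J \<subseteq> L \<Longrightarrow> nsub n J \<subseteq> nsub n L"
  by (auto simp: nsub_def)

lemma nsub_Int: "nsub n (J \<inter> L) = nsub n J \<inter> nsub n L"
  by (auto simp: nsub_def)

lemma cin_mono: "J \<subseteq> L \<Longrightarrow> cin n J x \<Longrightarrow> cin n L x"
  using nsub_mono[of J L n] by (cases x) auto

lemma cdom_mono: "J \<subseteq> L \<Longrightarrow> cdom n J \<subseteq> cdom n L"
  using cin_mono by auto

lemma cdom_Int: "cdom n (J \<inter> L) = cdom n J \<inter> cdom n L"
proof -
  have "cin n (J \<inter> L) x = (cin n J x \<and> cin n L x)" for x
    by (cases x) (auto simp: nsub_Int)
  then show ?thesis by auto
qed

lemma par_perm:
  assumes "p permutes {..<n}"
  shows "par n (\<lambda>l. P (p l)) m = par n P m"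
proof -
  have "bij_betw p {l. l < n \<and> P (p l)} {l. l < n \<and> P l}"
    unfolding bij_betw_def
  proof
    show "inj_on p {l. l < n \<and> P (p l)}"
      using permutes_inj[OF assms] by (simp add: inj_on_def inj_def)
    show "p ` {l. l < n \<and> P (p l)} = {l. l < n \<and> P l}"
    proof (safe)
      fix l assume "l < n" "P (p l)"
      then show "p l < n" using permutes_in_image[OF assms, of l] by simp
    next
      fix l assume *: "l < n" "P l"
      have "inv p l < n" using permutes_in_image[OF permutes_inv[OF assms], of l] * by simp
      moreover have "p (inv p l) = l" using permutes_inverses[OF assms] by simp
      ultimately show "l \<in> p ` {l. l < n \<and> P (p l)}" using * by (metis (mono_tags) image_eqI mem_Collect_eq)
    qed
  qed
  then show ?thesis by (simp add: par_def bij_betw_same_card)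
qed

lemma odd_card_sd:
  assumes "finite A" "finite B"
  shows "odd (card (sym_diff A B)) = (odd (card A) \<noteq> odd (card B))"
proof -
  have "card (sym_diff A B) = card (A - B) + card (B - A)"
    using assms by (intro card_Un_disjoint) auto
  moreover have "card A = card (A - B) + card (A \<inter> B)"
    using assms card_Un_disjoint[of "A-B" "A \<inter> B"] by (simp add: Un_Diff_Int disjoint_iff)
  moreover have "card B = card (B - A) + card (A \<inter> B)"
    using assms card_Un_disjoint[of "B-A" "B \<inter> A"]
    by (metis Diff_disjoint Int_Diff Int_commute Un_Diff_Int finite_Diff finite_Int inf_bot_right)
  ultimately show ?thesis by presburger
qed

lemma par_add: "par n (\<lambda>l. P l \<noteq> R l) (m \<noteq> m') = (par n P m \<noteq> par n R m')"
proof -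
  have "{l. l < n \<and> P l \<noteq> R l} = sym_diff {l. l < n \<and> P l} {l. l < n \<and> R l}" by auto
  then show ?thesis using odd_card_sd[of "{l. l < n \<and> P l}" "{l. l < n \<and> R l}"]
    by (auto simp: par_def)
qed

lemma par_bij:
  assumes "bij_betw us {..<n} S"
  shows "par n (\<lambda>l. P (us l)) m = (odd (card {u\<in>S. P u}) \<noteq> m)"
proof -
  have "bij_betw us {l. l < n \<and> P (us l)} {u\<in>S. P u}"
    using assms by (auto simp: bij_betw_def inj_on_def image_iff)
  then show ?thesis by (simp add: par_def bij_betw_same_card)
qed

lemma par_foldr: "foldr (\<lambda>l acc. P l \<noteq> acc) [0..<n] m = par n P m"
proof (induction n arbitrary: m)
  case 0 then show ?case by (simp add: par_def)
next
  case (Suc n)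
  have "{l. l < Suc n \<and> P l} = {l. l < n \<and> P l} \<union> (if P n then {n} else {})"
    by (auto simp: less_Suc_eq)
  then show ?case using Suc by (auto simp: par_def)
qed

lemma crel_simps:
  "crel n c SI xs \<longleftrightarrow> (\<exists>i. xs = [CI i])"
  "crel n c SK xs \<longleftrightarrow> (\<exists>u. xs = [CK u])"
  "crel n c SH xs \<longleftrightarrow> (\<exists>b. xs = [CH b])"
  "crel n c SG xs \<longleftrightarrow> (\<exists>g. xs = [CG g])"
  "crel n c SGs xs \<longleftrightarrow> (\<exists>u g. xs = [CGs u g])"
  "crel n c SHs xs \<longleftrightarrow> (\<exists>u m. xs = [CHs u m])"
  "crel n c Mem xs \<longleftrightarrow> (\<exists>i u. xs = [CI i, CK u] \<and> i \<in> u)"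
  "crel n c HAdd xs \<longleftrightarrow> (\<exists>a b. xs = [CH a, CH b, CH (a \<noteq> b)])"
  "crel n c GAdd xs \<longleftrightarrow> (\<exists>g h. xs = [CG g, CG h, CG (sym_diff g h)])"
  "crel n c Ev xs \<longleftrightarrow> (\<exists>g u. xs = [CG g, CK u, CH (u \<in> g)])"
  "crel n c Supp xs \<longleftrightarrow> (\<exists>g u. xs = [CG g, CK u] \<and> u \<in> g)"
  "crel n c PrG xs \<longleftrightarrow> (\<exists>u g. xs = [CGs u g, CK u])"
  "crel n c ActG xs \<longleftrightarrow> (\<exists>h u g. xs = [CG h, CGs u g, CGs u (sym_diff h g)])"
  "crel n c PrH xs \<longleftrightarrow> (\<exists>u m. xs = [CHs u m, CK u])"
  "crel n c ActH xs \<longleftrightarrow> (\<exists>h u m. xs = [CH h, CHs u m, CHs u (h \<noteq> m)])"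
  "crel n c Qr xs \<longleftrightarrow> (\<exists>us gs v m w. xs = map (\<lambda>l. if l < n then CGs (us l) (gs l) else CHs v m) [0..<Suc n]
        \<and> finite w \<and> card w = Suc n \<and> v \<in> nsub n w \<and> bij_betw us {..<n} (nsub n w - {v})
        \<and> c v w = par n (\<lambda>l. v \<in> gs l) m)"
  by (simp_all only: crel_def sym.case)

lemma Union_nsub:
  assumes "0 < n" "finite w" "card w = Suc n"
  shows "\<Union>(nsub n w) = w"
proof
  show "\<Union>(nsub n w) \<subseteq> w" by (auto simp: nsub_def)
  show "w \<subseteq> \<Union>(nsub n w)"
  proof
    fix x assume "x \<in> w"
    moreover have "w \<noteq> {x}" using assms by auto
    ultimately obtain y where "y \<in> w" "y \<noteq> x" by auto
    then have "w - {y} \<in> nsub n w" "x \<in> w - {y}" using assms \<open>x \<in> w\<close> by (auto simp: nsub_def)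
    then show "x \<in> \<Union>(nsub n w)" by blast
  qed
qed

text \<open>This removes the ambiguity of the existential \<open>w\<close> in the clause for
  \<open>Qr\<close>: the carrier is determined by the stalk indices. For \<open>n = 0\<close> it
  would not be, since the only \<open>0\<close>-subset is empty.\<close>

lemma enum_eq:
  assumes "0 < n" "finite w" "card w = Suc n" "v \<in> nsub n w" "bij_betw us {..<n} (nsub n w - {v})"
  shows "w = \<Union>(insert v (us ` {..<n}))"
proof -
  have "insert v (us ` {..<n}) = nsub n w" using assms(4,5) by (auto simp: bij_betw_def)
  then show ?thesis using Union_nsub[OF assms(1-3)] by simp
qed

section \<open>Argument tuples of Q and their carriers\<close>

definition qlist :: "nat \<Rightarrow> (nat \<Rightarrow> 'i set) \<Rightarrow> (nat \<Rightarrow> 'i set set) \<Rightarrow> 'i set \<Rightarrow> bool \<Rightarrow> 'i cel list" where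
  "qlist n us gs v m = map (\<lambda>l. if l < n then CGs (us l) (gs l) else CHs v m) [0..<Suc n]"

text \<open>Compatibility with an explicit carrier \<open>w\<close>: \<open>us\<close> lists the
  stalks of the first \<open>n\<close> arguments and \<open>v\<close> is the stalk of the
  last.\<close>

definition enum :: "nat \<Rightarrow> 'i set \<Rightarrow> 'i set \<Rightarrow> (nat \<Rightarrow> 'i set) \<Rightarrow> bool" where
  "enum n w v us = (finite w \<and> card w = Suc n \<and> v \<in> nsub n w \<and> bij_betw us {..<n} (nsub n w - {v}))"

lemma length_qlist [simp]: "length (qlist n us gs v m) = Suc n"
  by (simp add: qlist_def del: upt_Suc)

lemma qlist_nth: "l < Suc n \<Longrightarrow> qlist n us gs v m ! l = (if l < n then CGs (us l) (gs l) else CHs v m)"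
  unfolding qlist_def by (subst nth_map) (simp_all del: upt_Suc)

lemma qlist_eq_iff:
  "qlist n us gs v m = qlist n us' gs' v' m' \<longleftrightarrow>
     (\<forall>l<n. us l = us' l \<and> gs l = gs' l) \<and> v = v' \<and> m = m'"
  by (auto simp: list_eq_iff_nth_eq qlist_nth less_Suc_eq)

lemma enum_unique:
  "0 < n \<Longrightarrow> enum n w v us \<Longrightarrow> enum n w' v us' \<Longrightarrow> (\<forall>l<n. us l = us' l) \<Longrightarrow> w = w'"
  using enum_eq[of n w v us] enum_eq[of n w' v us'] by (simp add: enum_def)

lemma par_cong: "(\<And>l. l < n \<Longrightarrow> P l = R l) \<Longrightarrow> par n P m = par n R m"
  unfolding par_def by (metis (mono_tags, lifting) Collect_cong)

lemma enum_cong: "(\<And>l. l < n \<Longrightarrow> us l = us' l) \<Longrightarrow> enum n w v us = enum n w v us'"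
  using bij_betw_cong[of "{..<n}" us us'] by (simp add: enum_def)

lemma crel_Qr: "crel n c Qr xs \<longleftrightarrow>
   (\<exists>us gs v m w. xs = qlist n us gs v m \<and> enum n w v us \<and> c v w = par n (\<lambda>l. v \<in> gs l) m)"
  by (simp add: crel_simps(16) qlist_def enum_def conj_assoc)

lemma crel_Qr_qlist:
  assumes "0 < n" "enum n w v us"
  shows "crel n c Qr (qlist n us gs v m) \<longleftrightarrow> c v w = par n (\<lambda>l. v \<in> gs l) m"
proof
  assume "crel n c Qr (qlist n us gs v m)"
  then obtain us' gs' w' where *: "\<forall>l<n. us l = us' l \<and> gs l = gs' l" "enum n w' v us'"
      "c v w' = par n (\<lambda>l. v \<in> gs' l) m"
    unfolding crel_Qr qlist_eq_iff by blast
  then have "w' = w" using enum_unique[OF assms(1) *(2) assms(2)] by simp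
  moreover have "par n (\<lambda>l. v \<in> gs' l) m = par n (\<lambda>l. v \<in> gs l) m"
    using *(1) by (intro par_cong) auto
  ultimately show "c v w = par n (\<lambda>l. v \<in> gs l) m" using * by simp
qed (use assms crel_Qr in blast)

lemma set_qlist: "set (qlist n us gs v m) \<subseteq> S \<longleftrightarrow> (\<forall>l<n. CGs (us l) (gs l) \<in> S) \<and> CHs v m \<in> S"
  unfolding qlist_def by (auto split: if_splits)

lemma enumI:
  assumes "finite w" "card w = Suc n" "v \<in> nsub n w" "\<And>l. l < n \<Longrightarrow> us l \<in> nsub n w"
    "inj_on us {..<n}" "\<And>l. l < n \<Longrightarrow> us l \<noteq> v"
  shows "enum n w v us"
proof -
  have "us ` {..<n} \<subseteq> nsub n w - {v}" using assms by auto
  moreover have "card (us ` {..<n}) = n" using assms(5) by (simp add: card_image)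
  moreover have "card (nsub n w - {v}) = n" using assms card_nsub_Suc[of w n] by simp
  moreover have "finite (nsub n w - {v})" using finite_nsub[OF assms(1)] by simp
  ultimately have "us ` {..<n} = nsub n w - {v}" by (simp add: card_subset_eq)
  then show ?thesis using assms by (simp add: enum_def bij_betw_def)
qed

lemma enum_exists:
  assumes "finite w" "card w = Suc n" "v \<in> nsub n w"
  shows "\<exists>us. enum n w v us"
proof -
  have "card (nsub n w - {v}) = n" "finite (nsub n w - {v})"
    using assms card_nsub_Suc[of w n] finite_nsub[of w n] by auto
  then show ?thesis using assms ex_bij_betw_nat_finite[of "nsub n w - {v}"]
    by (auto simp: enum_def atLeast0LessThan)
qed

text \<open>Stated for a partial labelling of the indices of \<open>N\<close>, so that it serves
  concrete structures and arbitrary models alike. The carrier in \<open>compatible\<close> is some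
  set of indices of \<open>N\<close> that may leave the image of \<open>J\<close>; its trace on
  \<open>J\<close> contains \<open>n + 1\<close> distinct \<open>n\<close>-sets, which forces the
  trace to have \<open>n + 1\<close> points.\<close>

lemma compatible_enum:
  assumes npos: "0 < n" and inj: "inj_on \<sigma> J" "inj_on kk (nsub n J)" and I: "\<sigma> ` J \<subseteq> srt N SI"
    and u: "\<And>l. l < n \<Longrightarrow> us l \<in> nsub n J" "v \<in> nsub n J"
    and memb: "\<And>u. u \<in> nsub n J \<Longrightarrow> memb N (kk u) = \<sigma> ` u"
    and qidx: "\<And>l. l \<le> n \<Longrightarrow> qidx n N xs l = kk (if l < n then us l else v)"
  shows "compatible n N xs \<longleftrightarrow> (\<exists>w. w \<subseteq> J \<and> enum n w v us)"
proof -
  define vs where "vs l = (if l < n then us l else v)" for l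
  have vs: "vs l \<in> nsub n J" if "l \<le> n" for l using that u by (auto simp: vs_def)
  have q: "qidx n N xs l = kk (vs l)" if "l \<le> n" for l using qidx[OF that] by (simp add: vs_def)
  have m: "memb N (qidx n N xs l) = \<sigma> ` vs l" if "l \<le> n" for l
    using that by (simp add: q memb vs)
  have sig_card: "finite (\<sigma> ` u) = finite u \<and> card (\<sigma> ` u) = card u" if "u \<subseteq> J" for u
    using inj_on_subset[OF inj(1) that] by (simp add: card_image finite_image_iff)
  have d: "distinct (map (qidx n N xs) [0..<Suc n]) \<longleftrightarrow> inj_on vs {..n}"
  proof -
    have "distinct (map (qidx n N xs) [0..<Suc n]) \<longleftrightarrow> inj_on (\<lambda>l. kk (vs l)) {..n}"
      by (simp add: distinct_map q atLeast0LessThan lessThan_Suc_atMost inj_on_def del: upt_Suc)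
    also have "\<dots> \<longleftrightarrow> inj_on vs {..n}" using vs inj(2) by (auto simp: inj_on_def)
    finally show ?thesis .
  qed
  show ?thesis
  proof
    assume "compatible n N xs"
    then obtain w where w: "w \<subseteq> srt N SI" "finite w" "card w = Suc n"
       "\<And>l. l \<le> n \<Longrightarrow> \<sigma> ` vs l \<subseteq> w" "inj_on vs {..n}"
      unfolding compatible_def d by (auto simp: m)
    define w' where "w' = {i\<in>J. \<sigma> i \<in> w}"
    have w'J: "w' \<subseteq> J" by (auto simp: w'_def)
    have "\<sigma> ` w' \<subseteq> w" by (auto simp: w'_def)
    then have f: "finite w'" "card w' \<le> Suc n"
      using sig_card[OF w'J] w(2,3) finite_subset card_mono by metis+
    have vw: "vs l \<in> nsub n w'" if "l \<le> n" for l
      using vs[OF that] w(4)[OF that] by (auto simp: nsub_def w'_def)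
    have "card (vs ` {..n}) \<le> card (nsub n w')"
      using vw f(1) by (intro card_mono finite_nsub) auto
    then have "Suc n \<le> card (nsub n w')" using w(5) by (simp add: card_image)
    then have "Suc n \<le> card w' choose n"
      using n_subsets[OF f(1), of n] finite_subset[OF _ f(1)] by (simp add: nsub_def cong: conj_cong)
    \<comment> \<open>A set with at most \<open>n\<close> points has at most one
      \<open>n\<close>-subset, which is fewer than \<open>n + 1\<close> because \<open>n\<close> is
      positive.\<close>
    then have "card w' \<noteq> n" "\<not> card w' < n" using npos by (auto simp: binomial_eq_0)
    then have cw: "card w' = Suc n" using f by simp
    have "enum n w' v us"
    proof (rule enumI)
      show "finite w'" "card w' = Suc n" by fact+
      show "v \<in> nsub n w'" using vw[of n] by (simp add: vs_def)
      show "us l \<in> nsub n w'" if "l < n" for l using vw[of l] that by (simp add: vs_def)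
      show "inj_on us {..<n}" using w(5) by (auto simp: inj_on_def vs_def split: if_splits)
      show "us l \<noteq> v" if "l < n" for l
        using inj_onD[OF w(5), of l n] that by (auto simp: vs_def)
    qed
    then show "\<exists>w. w \<subseteq> J \<and> enum n w v us" using w'J by blast
  next
    assume "\<exists>w. w \<subseteq> J \<and> enum n w v us"
    then obtain w where w: "w \<subseteq> J" "enum n w v us" by blast
    have wn: "vs l \<in> nsub n w" if "l \<le> n" for l
      using w(2) that by (auto simp: enum_def vs_def bij_betw_def)
    have "inj_on vs {..n}"
    proof (rule inj_onI)
      fix a b assume ab: "a \<in> {..n}" "b \<in> {..n}" "vs a = vs b"
      have "us a \<noteq> v" if "a < n" for a using w(2) that by (auto simp: enum_def bij_betw_def)
      moreover have "inj_on us {..<n}" using w(2) by (auto simp: enum_def bij_betw_def)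
      ultimately show "a = b" using ab unfolding vs_def
        by (metis atMost_iff inj_on_def lessThan_iff order_le_less)
    qed
    moreover have "\<sigma> ` w \<subseteq> srt N SI" "finite (\<sigma> ` w)" "card (\<sigma> ` w) = Suc n"
      using w I sig_card[of w] by (auto simp: enum_def)
    moreover have "memb N (qidx n N xs l) \<subseteq> \<sigma> ` w" if "l \<le> n" for l
      using m[OF that] wn[OF that] by (auto simp: nsub_def)
    ultimately show "compatible n N xs" unfolding compatible_def d by blast
  qed
qed

section \<open>Injective images of concrete structures satisfy the axioms\<close>

locale coord =
  fixes n :: nat and f :: "'i cel \<Rightarrow> 'u" and J :: "'i set" and c :: "'i set \<Rightarrow> 'i set \<Rightarrow> bool"
  assumes npos: "0 < n" and inj: "inj_on f (cdom n J)"
begin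

abbreviation M :: "'u str" where "M \<equiv> mimg f (cstr n J c)"

lemma f_eq: "cin n J x \<Longrightarrow> cin n J y \<Longrightarrow> f x = f y \<longleftrightarrow> x = y"
  using inj by (auto simp: inj_on_def)

lemma rel_iff: "set xs \<subseteq> cdom n J \<Longrightarrow> map f xs \<in> rels M r \<longleftrightarrow> crel n c r xs"
proof
  assume s: "set xs \<subseteq> cdom n J" and "map f xs \<in> rels M r"
  then obtain ys where "map f xs = map f ys" "crel n c r ys" "set ys \<subseteq> cdom n J"
    by (auto simp: rels_mimg rels_cstr)
  moreover from this have "xs = ys" using inj s by (meson inj_on_map_eq_map inj_on_subset Un_least)
  ultimately show "crel n c r xs" by simp
qed (auto simp: rels_mimg rels_cstr)

lemma rel1: "cin n J x \<Longrightarrow> [f x] \<in> rels M r \<longleftrightarrow> crel n c r [x]"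
  using rel_iff[of "[x]" r] by simp
lemma rel2: "cin n J x \<Longrightarrow> cin n J y \<Longrightarrow> [f x, f y] \<in> rels M r \<longleftrightarrow> crel n c r [x, y]"
  using rel_iff[of "[x, y]" r] by simp
lemma rel3: "cin n J x \<Longrightarrow> cin n J y \<Longrightarrow> cin n J z \<Longrightarrow> [f x, f y, f z] \<in> rels M r \<longleftrightarrow> crel n c r [x, y, z]"
  using rel_iff[of "[x, y, z]" r] by simp

lemma relE:
  assumes "ys \<in> rels M r"
  obtains xs where "ys = map f xs" "crel n c r xs" "set xs \<subseteq> cdom n J"
  using assms by (auto simp: rels_mimg rels_cstr)

lemma wf_M: "wf_str n M"
proof -
  have "length xs = arity n r" if "crel n c r xs" for xs r
    using that by (cases r) (auto simp: crel_simps simp del: upt_Suc)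
  moreover have "set (map f xs) \<subseteq> dom M" if "set xs \<subseteq> cdom n J" for xs
    using image_mono[OF that, of f] by simp
  ultimately show ?thesis unfolding wf_str_def by (metis length_map relE)
qed

lemma rel_in: "[x] \<in> rels M r \<Longrightarrow> \<exists>x'. cin n J x' \<and> x = f x' \<and> crel n c r [x']"
  by (auto elim!: relE)

lemma srt_M:
  "srt M SI = {f (CI i) | i. i \<in> J}"
  "srt M SK = {f (CK u) | u. u \<in> nsub n J}"
  "srt M SH = {f (CH b) | b. True}"
  "srt M SG = {f (CG g) | g. finite g \<and> g \<subseteq> nsub n J}"
  "srt M SGs = {f (CGs u g) | u g. u \<in> nsub n J \<and> finite g \<and> g \<subseteq> nsub n J}"
  "srt M SHs = {f (CHs u m) | u m. u \<in> nsub n J}"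
  unfolding srt_def by (auto simp: rel1 crel_simps dest!: rel_in) blast+

lemma memb_M: "u \<in> nsub n J \<Longrightarrow> memb M (f (CK u)) = (\<lambda>i. f (CI i)) ` u"
proof -
  assume u: "u \<in> nsub n J"
  then have uJ: "u \<subseteq> J" by (simp add: nsub_def)
  show ?thesis
  proof (intro set_eqI iffI)
    fix x assume "x \<in> memb M (f (CK u))"
    then have "[x, f (CK u)] \<in> rels M Mem" by (simp add: memb_def)
    then obtain xs where xs: "[x, f (CK u)] = map f xs" "crel n c Mem xs" "set xs \<subseteq> cdom n J" by (rule relE)
    then show "x \<in> (\<lambda>i. f (CI i)) ` u" using u by (auto simp: crel_simps f_eq)
  qed (use u uJ in \<open>auto simp: memb_def rel2 crel_simps\<close>)
qed

lemma Ev_iff: "finite g \<Longrightarrow> g \<subseteq> nsub n J \<Longrightarrow> u \<in> nsub n J \<Longrightarrow> [f (CG g), f (CK u), y] \<in> rels M Ev \<longleftrightarrow> y = f (CH (u \<in> g))"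
  by (auto simp: rel3 crel_simps f_eq elim!: relE)

lemma HAdd_iff: "[f (CH a), f (CH b), y] \<in> rels M HAdd \<longleftrightarrow> y = f (CH (a \<noteq> b))"
  by (auto simp: rel3 crel_simps f_eq elim!: relE)

lemma PrG_iff: "u \<in> nsub n J \<Longrightarrow> finite g \<Longrightarrow> g \<subseteq> nsub n J \<Longrightarrow> [f (CGs u g), y] \<in> rels M PrG \<longleftrightarrow> y = f (CK u)"
  by (auto simp: rel2 crel_simps f_eq elim!: relE)

lemma PrH_iff: "u \<in> nsub n J \<Longrightarrow> [f (CHs u m), y] \<in> rels M PrH \<longleftrightarrow> y = f (CK u)"
  by (auto simp: rel2 crel_simps f_eq elim!: relE)

lemma ActG_iff: "finite h \<Longrightarrow> h \<subseteq> nsub n J \<Longrightarrow> u \<in> nsub n J \<Longrightarrow> finite g \<Longrightarrow> g \<subseteq> nsub n J \<Longrightarrow>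
    [f (CG h), f (CGs u g), y] \<in> rels M ActG \<longleftrightarrow> y = f (CGs u (sym_diff h g))"
proof -
  assume *: "finite h" "h \<subseteq> nsub n J" "u \<in> nsub n J" "finite g" "g \<subseteq> nsub n J"
  then have "sym_diff h g \<subseteq> nsub n J" by auto
  then show ?thesis using * by (auto simp: rel3 crel_simps f_eq elim!: relE)
qed

lemma ActH_iff: "u \<in> nsub n J \<Longrightarrow> [f (CH h), f (CHs u m), y] \<in> rels M ActH \<longleftrightarrow> y = f (CHs u (h \<noteq> m))"
  by (auto simp: rel3 crel_simps f_eq elim!: relE)

lemma hzero_M: "hzero M = f (CH False)"
proof -
  have "h = f (CH False)" if "[h, h, h] \<in> rels M HAdd" for h
    using that by (auto simp: crel_simps f_eq elim!: relE)
  moreover have "[f (CH False), f (CH False), f (CH False)] \<in> rels M HAdd"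
    by (simp add: HAdd_iff)
  ultimately show ?thesis unfolding hzero_def by blast
qed

lemma ops_M:
  "hadd M (f (CH a)) (f (CH b)) = f (CH (a \<noteq> b))"
  "finite g \<Longrightarrow> g \<subseteq> nsub n J \<Longrightarrow> u \<in> nsub n J \<Longrightarrow> ev M (f (CG g)) (f (CK u)) = f (CH (u \<in> g))"
  "u \<in> nsub n J \<Longrightarrow> finite g \<Longrightarrow> g \<subseteq> nsub n J \<Longrightarrow> prg M (f (CGs u g)) = f (CK u)"
  "u \<in> nsub n J \<Longrightarrow> prh M (f (CHs u m)) = f (CK u)"
  "finite h \<Longrightarrow> h \<subseteq> nsub n J \<Longrightarrow> u \<in> nsub n J \<Longrightarrow> finite g \<Longrightarrow> g \<subseteq> nsub n J \<Longrightarrow>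
    actg M (f (CG h)) (f (CGs u g)) = f (CGs u (sym_diff h g))"
  "u \<in> nsub n J \<Longrightarrow> acth M (f (CH b)) (f (CHs u m)) = f (CHs u (b \<noteq> m))"
  unfolding hadd_def ev_def prg_def prh_def actg_def acth_def
  by (simp_all only: HAdd_iff Ev_iff PrG_iff PrH_iff ActG_iff ActH_iff the_eq_trivial the_sym_eq_trivial)

lemma compat_M:
  assumes "\<And>l. l < n \<Longrightarrow> us l \<in> nsub n J \<and> finite (gs l) \<and> gs l \<subseteq> nsub n J" "v \<in> nsub n J"
  shows "compatible n M (map f (qlist n us gs v m)) \<longleftrightarrow> (\<exists>w. w \<subseteq> J \<and> enum n w v us)"
proof (rule compatible_enum[OF npos])
  show "inj_on (\<lambda>i. f (CI i)) J" "inj_on (\<lambda>u. f (CK u)) (nsub n J)" by (auto simp: inj_on_def f_eq)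
  show "qidx n M (map f (qlist n us gs v m)) l = f (CK (if l < n then us l else v))" if "l \<le> n" for l
    using that assms by (auto simp: qidx_def qlist_nth ops_M less_Suc_eq)
qed (use assms memb_M srt_M(1) in auto)

lemma Qr_iff:
  assumes "\<And>l. l < n \<Longrightarrow> us l \<in> nsub n J \<and> finite (gs l) \<and> gs l \<subseteq> nsub n J" "v \<in> nsub n J" "enum n w v us"
  shows "map f (qlist n us gs v m) \<in> rels M Qr \<longleftrightarrow> c v w = par n (\<lambda>l. v \<in> gs l) m"
  using assms npos by (subst rel_iff) (auto simp: set_qlist crel_Qr_qlist)

end

context coord begin

lemma H_eq: "f (CH a) = f (CH b) \<longleftrightarrow> a = b"
  by (simp add: f_eq)

lemma ball_srt:
  "(\<forall>x\<in>srt M SK. P x) \<longleftrightarrow> (\<forall>u\<in>nsub n J. P (f (CK u)))"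
  "(\<forall>x\<in>srt M SH. P x) \<longleftrightarrow> (\<forall>b. P (f (CH b)))"
  "(\<forall>x\<in>srt M SG. P x) \<longleftrightarrow> (\<forall>g. finite g \<and> g \<subseteq> nsub n J \<longrightarrow> P (f (CG g)))"
  "(\<forall>x\<in>srt M SGs. P x) \<longleftrightarrow> (\<forall>u\<in>nsub n J. \<forall>g. finite g \<and> g \<subseteq> nsub n J \<longrightarrow> P (f (CGs u g)))"
  "(\<forall>x\<in>srt M SHs. P x) \<longleftrightarrow> (\<forall>u\<in>nsub n J. \<forall>m. P (f (CHs u m)))"
  by (auto simp: srt_M)

lemma bex_srt:
  "(\<exists>x\<in>srt M SK. P x) \<longleftrightarrow> (\<exists>u\<in>nsub n J. P (f (CK u)))"
  "(\<exists>x\<in>srt M SG. P x) \<longleftrightarrow> (\<exists>g. finite g \<and> g \<subseteq> nsub n J \<and> P (f (CG g)))"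
  "(\<exists>x\<in>srt M SGs. P x) \<longleftrightarrow> (\<exists>u\<in>nsub n J. \<exists>g. finite g \<and> g \<subseteq> nsub n J \<and> P (f (CGs u g)))"
  "(\<exists>x\<in>srt M SHs. P x) \<longleftrightarrow> (\<exists>u\<in>nsub n J. \<exists>m. P (f (CHs u m)))"
  by (auto simp: srt_M)

lemma mem_srt:
  "i \<in> J \<Longrightarrow> f (CI i) \<in> srt M SI"
  "u \<in> nsub n J \<Longrightarrow> f (CK u) \<in> srt M SK"
  "f (CH b) \<in> srt M SH"
  "finite g \<Longrightarrow> g \<subseteq> nsub n J \<Longrightarrow> f (CG g) \<in> srt M SG"
  "u \<in> nsub n J \<Longrightarrow> finite g \<Longrightarrow> g \<subseteq> nsub n J \<Longrightarrow> f (CGs u g) \<in> srt M SGs"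
  "u \<in> nsub n J \<Longrightarrow> f (CHs u m) \<in> srt M SHs"
  by (auto simp: srt_M)

lemma sd_sub: "g \<subseteq> S \<Longrightarrow> h \<subseteq> S \<Longrightarrow> sym_diff g h \<subseteq> S" by auto
lemma sd_fin: "finite g \<Longrightarrow> finite h \<Longrightarrow> finite (sym_diff g h)" by auto

lemma relM_ty:
  "xs \<in> rels M Mem \<Longrightarrow> xs ! 0 \<in> srt M SI \<and> xs ! 1 \<in> srt M SK"
  "xs \<in> rels M Ev \<Longrightarrow> xs ! 0 \<in> srt M SG \<and> xs ! 1 \<in> srt M SK \<and> xs ! 2 \<in> srt M SH"
  "xs \<in> rels M PrG \<Longrightarrow> xs ! 0 \<in> srt M SGs \<and> xs ! 1 \<in> srt M SK"
  "xs \<in> rels M ActG \<Longrightarrow> xs ! 0 \<in> srt M SG \<and> xs ! 1 \<in> srt M SGs \<and> xs ! 2 \<in> srt M SGs"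
  "xs \<in> rels M PrH \<Longrightarrow> xs ! 0 \<in> srt M SHs \<and> xs ! 1 \<in> srt M SK"
  "xs \<in> rels M ActH \<Longrightarrow> xs ! 0 \<in> srt M SH \<and> xs ! 1 \<in> srt M SHs \<and> xs ! 2 \<in> srt M SHs"
  by (auto simp: crel_simps elim!: relE intro!: mem_srt sd_sub sd_fin) blast+

text \<open>\<open>crel\<close> does not mention the index set; the carrier nevertheless lies in
  \<open>J\<close> because it is the union of the stalk indices of the arguments.\<close>

lemma Qr_M_E:
  assumes "xs \<in> rels M Qr"
  obtains us gs v m w where "xs = map f (qlist n us gs v m)" "enum n w v us" "w \<subseteq> J"
    "\<And>l. l < n \<Longrightarrow> us l \<in> nsub n J \<and> finite (gs l) \<and> gs l \<subseteq> nsub n J" "v \<in> nsub n J"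
    "c v w = par n (\<lambda>l. v \<in> gs l) m"
proof -
  obtain us gs v m w where *: "xs = map f (qlist n us gs v m)" "set (qlist n us gs v m) \<subseteq> cdom n J"
      "enum n w v us" "c v w = par n (\<lambda>l. v \<in> gs l) m"
    using assms by (auto simp: crel_Qr elim!: relE)
  then have **: "\<And>l. l < n \<Longrightarrow> us l \<in> nsub n J \<and> finite (gs l) \<and> gs l \<subseteq> nsub n J" "v \<in> nsub n J"
    by (auto simp: set_qlist)
  have "w = \<Union>(insert v (us ` {..<n}))" using *(3) npos enum_eq[of n w v us] unfolding enum_def by blast
  then have "w \<subseteq> J" using ** by (auto simp: nsub_def)
  then show ?thesis using that * ** by blast
qed

lemma qtuple_E:
  assumes "length xs = Suc n" "\<forall>l<n. xs ! l \<in> srt M SGs" "xs ! n \<in> srt M SHs"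
  obtains us gs v m where "xs = map f (qlist n us gs v m)"
    "\<And>l. l < n \<Longrightarrow> us l \<in> nsub n J \<and> finite (gs l) \<and> gs l \<subseteq> nsub n J" "v \<in> nsub n J"
proof -
  have "\<forall>l. \<exists>u g. l < n \<longrightarrow> xs ! l = f (CGs u g) \<and> u \<in> nsub n J \<and> finite g \<and> g \<subseteq> nsub n J"
    using assms(2) by (auto simp: srt_M)
  then obtain us gs where ug: "\<And>l. l < n \<Longrightarrow> xs ! l = f (CGs (us l) (gs l)) \<and> us l \<in> nsub n J \<and> finite (gs l) \<and> gs l \<subseteq> nsub n J"
    by metis
  obtain v m where vm: "xs ! n = f (CHs v m)" "v \<in> nsub n J" using assms(3) by (auto simp: srt_M)
  have "xs = map f (qlist n us gs v m)"
    using assms(1) ug vm by (auto simp: list_eq_iff_nth_eq qlist_nth less_Suc_eq)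
  then show ?thesis using that ug vm by blast
qed

lemma foldr_M:
  assumes "\<And>l. l \<in> set ls \<Longrightarrow> finite (hs l) \<and> hs l \<subseteq> nsub n J" "v \<in> nsub n J"
  shows "foldr (\<lambda>l acc. hadd M (ev M (f (CG (hs l))) (f (CK v))) acc) ls (f (CH m))
    = f (CH (foldr (\<lambda>l acc. (v \<in> hs l) \<noteq> acc) ls m))"
  using assms by (induction ls) (auto simp: ops_M)

lemma Q_perm:
  assumes xs: "xs \<in> rels M Qr" and p: "p permutes {..<n}"
  shows "map (\<lambda>l. if l < n then xs ! p l else xs ! l) [0..<Suc n] \<in> rels M Qr"
proof -
  obtain us gs v m w where *: "xs = map f (qlist n us gs v m)" "enum n w v us"
    "\<And>l. l < n \<Longrightarrow> us l \<in> nsub n J \<and> finite (gs l) \<and> gs l \<subseteq> nsub n J" "v \<in> nsub n J"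
    "c v w = par n (\<lambda>l. v \<in> gs l) m" by (rule Qr_M_E[OF xs]) blast
  have pl: "p l < n" if "l < n" for l using permutes_in_image[OF p, of l] that by simp
  have "map (\<lambda>l. if l < n then xs ! p l else xs ! l) [0..<Suc n] = map f (qlist n (us \<circ> p) (gs \<circ> p) v m)"
    using pl unfolding list_eq_iff_nth_eq by (auto simp: * qlist_nth less_Suc_eq nth_append)
  moreover have e: "enum n w v (us \<circ> p)"
    using *(2) permutes_imp_bij[OF p] by (auto simp: enum_def intro: bij_betw_trans)
  ultimately show ?thesis
    using * pl Qr_iff[OF _ _ e, of "gs \<circ> p" m] par_perm[OF p, of "\<lambda>l. v \<in> gs l" m] by simp
qed

text \<open>Moving the arguments adds the parity of the move to the parity of the tuple
  (\<open>par_add\<close>), while the required value \<open>c v w\<close> depends on the stalks only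
  and stays put.\<close>

lemma Q_move:
  assumes xs: "length xs = Suc n" "\<forall>l<n. xs ! l \<in> srt M SGs" "xs ! n \<in> srt M SHs" "compatible n M xs"
    and gs: "\<forall>l<n. gs l \<in> srt M SG" "m \<in> srt M SH"
  shows "((map (\<lambda>l. if l < n then actg M (gs l) (xs ! l) else acth M m (xs ! n)) [0..<Suc n] \<in> rels M Qr
     \<longleftrightarrow> xs \<in> rels M Qr) \<longleftrightarrow>
     foldr (\<lambda>l acc. hadd M (ev M (gs l) (prh M (xs ! n))) acc) [0..<n] m = f (CH False))"
proof -
  obtain us ks v b where *: "xs = map f (qlist n us ks v b)"
    "\<And>l. l < n \<Longrightarrow> us l \<in> nsub n J \<and> finite (ks l) \<and> ks l \<subseteq> nsub n J" "v \<in> nsub n J"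
    using qtuple_E[OF xs(1-3)] by metis
  obtain w where w: "enum n w v us" using xs(4) compat_M[OF *(2,3)] * by auto
  have "\<forall>l. \<exists>g. l < n \<longrightarrow> gs l = f (CG g) \<and> finite g \<and> g \<subseteq> nsub n J"
    using gs(1) by (auto simp: srt_M)
  then obtain hs where hs: "\<And>l. l < n \<Longrightarrow> gs l = f (CG (hs l)) \<and> finite (hs l) \<and> hs l \<subseteq> nsub n J" by metis
  obtain a where a: "m = f (CH a)" using gs(2) by (auto simp: srt_M)
  have x: "xs ! l = f (CGs (us l) (ks l))" if "l < n" for l using that by (simp add: * qlist_nth)
  have y: "xs ! n = f (CHs v b)" by (simp add: * qlist_nth)
  have 1: "map (\<lambda>l. if l < n then actg M (gs l) (xs ! l) else acth M m (xs ! n)) [0..<Suc n]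
     = map f (qlist n us (\<lambda>l. sym_diff (hs l) (ks l)) v (a \<noteq> b))"
    unfolding list_eq_iff_nth_eq using *(2,3)
    by (auto simp: x y hs a ops_M qlist_nth less_Suc_eq nth_append)
  have 2: "map f (qlist n us (\<lambda>l. sym_diff (hs l) (ks l)) v (a \<noteq> b)) \<in> rels M Qr
     \<longleftrightarrow> c v w = par n (\<lambda>l. v \<in> sym_diff (hs l) (ks l)) (a \<noteq> b)"
    using *(2,3) hs by (intro Qr_iff w) (auto intro!: sd_sub sd_fin)
  have 3: "xs \<in> rels M Qr \<longleftrightarrow> c v w = par n (\<lambda>l. v \<in> ks l) b"
    unfolding *(1) using *(2,3) by (intro Qr_iff w) auto
  have 4: "par n (\<lambda>l. v \<in> sym_diff (hs l) (ks l)) (a \<noteq> b) = (par n (\<lambda>l. v \<in> hs l) a \<noteq> par n (\<lambda>l. v \<in> ks l) b)"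
    unfolding par_add[symmetric] by (rule par_cong) auto
  have 5: "foldr (\<lambda>l acc. hadd M (ev M (gs l) (prh M (xs ! n))) acc) [0..<n] m = f (CH (par n (\<lambda>l. v \<in> hs l) a))"
  proof -
    have "foldr (\<lambda>l acc. hadd M (ev M (gs l) (prh M (xs ! n))) acc) [0..<n] m
       = foldr (\<lambda>l acc. hadd M (ev M (f (CG (hs l))) (f (CK v))) acc) [0..<n] (f (CH a))"
      using hs a by (intro foldr_cong) (auto simp: y ops_M *(3))
    then show ?thesis using foldr_M[of "[0..<n]" hs v a] hs *(3) unfolding par_foldr by simp
  qed
  show ?thesis unfolding 1 2 3 4 5 H_eq by auto
qed

lemma GAdd_M: "rels M GAdd = {[a, b, d] | a b d. a \<in> srt M SG \<and> b \<in> srt M SG \<and> d \<in> srt M SG \<and>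
    (\<forall>u\<in>srt M SK. ev M d u = hadd M (ev M a u) (ev M b u))}"
proof (intro set_eqI iffI)
  fix xs assume "xs \<in> rels M GAdd"
  then obtain g h where *: "xs = [f (CG g), f (CG h), f (CG (sym_diff g h))]"
    "finite g" "g \<subseteq> nsub n J" "finite h" "h \<subseteq> nsub n J" "finite (sym_diff g h)" "sym_diff g h \<subseteq> nsub n J"
    by (auto simp: crel_simps elim!: relE)
  have "f (CG g) \<in> srt M SG" "f (CG h) \<in> srt M SG" "f (CG (sym_diff g h)) \<in> srt M SG"
    using * by (simp_all only: mem_srt)
  moreover have "\<forall>u\<in>srt M SK. ev M (f (CG (sym_diff g h))) u = hadd M (ev M (f (CG g)) u) (ev M (f (CG h)) u)"
    using * by (auto simp: ball_srt ops_M f_eq)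
  ultimately show "xs \<in> {[a, b, d] | a b d. a \<in> srt M SG \<and> b \<in> srt M SG \<and> d \<in> srt M SG \<and>
    (\<forall>u\<in>srt M SK. ev M d u = hadd M (ev M a u) (ev M b u))}" unfolding * by blast
next
  fix xs assume "xs \<in> {[a, b, d] | a b d. a \<in> srt M SG \<and> b \<in> srt M SG \<and> d \<in> srt M SG \<and>
    (\<forall>u\<in>srt M SK. ev M d u = hadd M (ev M a u) (ev M b u))}"
  then obtain g h k where *: "xs = [f (CG g), f (CG h), f (CG k)]"
    "finite g" "g \<subseteq> nsub n J" "finite h" "h \<subseteq> nsub n J" "finite k" "k \<subseteq> nsub n J"
    "\<forall>u\<in>srt M SK. ev M (f (CG k)) u = hadd M (ev M (f (CG g)) u) (ev M (f (CG h)) u)"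
    by (auto simp: srt_M(4))
  then have "\<forall>u\<in>nsub n J. (u \<in> k) = ((u \<in> g) \<noteq> (u \<in> h))" by (auto simp: ball_srt ops_M H_eq)
  then have "k = sym_diff g h" using * by blast
  then show "xs \<in> rels M GAdd" using * by (simp add: rel3 crel_simps)
qed

lemma Kn_M: "Kn n M"
  unfolding Kn_def Let_def hzero_M
proof (intro conjI)
  show "wf_str n M" by (rule wf_M)
  show "dom M = (\<Union>s\<in>sorts. srt M s)"
  proof (intro set_eqI iffI)
    fix x assume "x \<in> dom M"
    then obtain y where "x = f y" "cin n J y" by auto
    then show "x \<in> (\<Union>s\<in>sorts. srt M s)" by (cases y) (auto simp: sorts_def mem_srt)
  next
    fix x assume "x \<in> (\<Union>s\<in>sorts. srt M s)"
    then obtain s where "[x] \<in> rels M s" by (auto simp: srt_def)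
    then show "x \<in> dom M" using wf_M unfolding wf_str_def by fastforce
  qed
  show "\<forall>s\<in>sorts. \<forall>s'\<in>sorts. s \<noteq> s' \<longrightarrow> srt M s \<inter> srt M s' = {}"
    unfolding sorts_def by (auto simp: srt_M f_eq)
  show "\<forall>xs\<in>rels M Mem. xs ! 0 \<in> srt M SI \<and> xs ! 1 \<in> srt M SK" using relM_ty(1) by blast
  have injI: "inj_on (\<lambda>i. f (CI i)) J" by (auto simp: inj_on_def f_eq)
  show "\<forall>u\<in>srt M SK. finite (memb M u) \<and> card (memb M u) = n"
  proof -
    have "finite ((\<lambda>i. f (CI i)) ` u) \<and> card ((\<lambda>i. f (CI i)) ` u) = n" if "u \<in> nsub n J" for u
      using that injI inj_on_subset[of "\<lambda>i. f (CI i)" J u] by (auto simp: nsub_def card_image)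
    then show ?thesis by (simp add: ball_srt memb_M)
  qed
  show "inj_on (memb M) (srt M SK)"
  proof (rule inj_onI)
    fix x y assume "x \<in> srt M SK" "y \<in> srt M SK" "memb M x = memb M y"
    then obtain u v where "x = f (CK u)" "y = f (CK v)" "u \<in> nsub n J" "v \<in> nsub n J"
      "(\<lambda>i. f (CI i)) ` u = (\<lambda>i. f (CI i)) ` v" by (auto simp: srt_M memb_M)
    then show "x = y" using inj_on_image_eq_iff[OF injI, of u v] by (simp add: nsub_def)
  qed
  show "\<forall>w. w \<subseteq> srt M SI \<and> finite w \<and> card w = n \<longrightarrow> (\<exists>u\<in>srt M SK. memb M u = w)"
  proof (intro allI impI, elim conjE)
    fix w assume w: "w \<subseteq> srt M SI" "finite w" "card w = n"
    then have "w \<subseteq> (\<lambda>i. f (CI i)) ` J" by (auto simp: srt_M)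
    then obtain u where u: "u \<subseteq> J" "w = (\<lambda>i. f (CI i)) ` u" by (auto simp: subset_image_iff)
    then have iu: "inj_on (\<lambda>i. f (CI i)) u" using injI inj_on_subset by blast
    then have "u \<in> nsub n J" using w u by (auto simp: nsub_def card_image finite_image_iff)
    then show "\<exists>u\<in>srt M SK. memb M u = w" using u by (auto simp: bex_srt memb_M)
  qed
  show "\<exists>h0 h1. h0 \<noteq> h1 \<and> srt M SH = {h0, h1} \<and>
         rels M HAdd = {[h0,h0,h0], [h0,h1,h1], [h1,h0,h1], [h1,h1,h0]}"
  proof (intro exI conjI)
    show "f (CH False) \<noteq> f (CH True)" by (simp add: f_eq)
    show "srt M SH = {f (CH False), f (CH True)}" unfolding srt_M by (auto intro: exI[of _ True] exI[of _ False]) (metis (full_types))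
    have "rels M HAdd = {[f (CH a), f (CH b), f (CH (a \<noteq> b))] | a b. True}"
      by (auto simp: rel3 crel_simps elim!: relE) blast
    also have "\<dots> = (\<lambda>(a, b). [f (CH a), f (CH b), f (CH (a \<noteq> b))]) ` (UNIV \<times> UNIV)" by auto
    also have "\<dots> = {[f (CH False), f (CH False), f (CH False)], [f (CH False), f (CH True), f (CH True)],
        [f (CH True), f (CH False), f (CH True)], [f (CH True), f (CH True), f (CH False)]}"
      by (auto simp: UNIV_bool)
    finally show "rels M HAdd = {[f (CH False), f (CH False), f (CH False)], [f (CH False), f (CH True), f (CH True)],
        [f (CH True), f (CH False), f (CH True)], [f (CH True), f (CH True), f (CH False)]}" .
  qed
  show "\<forall>xs\<in>rels M Ev. xs ! 0 \<in> srt M SG \<and> xs ! 1 \<in> srt M SK \<and> xs ! 2 \<in> srt M SH" using relM_ty(2) by blast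
  show "\<forall>g\<in>srt M SG. \<forall>u\<in>srt M SK. \<exists>!h. [g, u, h] \<in> rels M Ev" by (simp add: ball_srt Ev_iff)
  show "\<forall>g\<in>srt M SG. finite {u \<in> srt M SK. ev M g u \<noteq> f (CH False)}"
  proof -
    have "{u \<in> srt M SK. ev M (f (CG g)) u \<noteq> f (CH False)} \<subseteq> (\<lambda>u. f (CK u)) ` g"
      if "finite g" "g \<subseteq> nsub n J" for g using that by (auto simp: srt_M ops_M H_eq)
    then have "finite {u \<in> srt M SK. ev M (f (CG g)) u \<noteq> f (CH False)}"
      if "finite g" "g \<subseteq> nsub n J" for g using that finite_subset finite_imageI by meson
    then show ?thesis unfolding ball_srt by simp
  qed
  show "\<forall>g\<in>srt M SG. \<forall>g'\<in>srt M SG. (\<forall>u\<in>srt M SK. ev M g u = ev M g' u) \<longrightarrow> g = g'"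
    unfolding ball_srt by (auto simp: ops_M H_eq f_eq)
  show "\<forall>fa. (\<forall>u\<in>srt M SK. fa u \<in> srt M SH) \<and> finite {u \<in> srt M SK. fa u \<noteq> f (CH False)} \<longrightarrow>
     (\<exists>g\<in>srt M SG. \<forall>u\<in>srt M SK. ev M g u = fa u)"
  proof (intro allI impI, elim conjE)
    fix F assume F: "\<forall>u\<in>srt M SK. F u \<in> srt M SH" "finite {u \<in> srt M SK. F u \<noteq> f (CH False)}"
    define g where "g = {u \<in> nsub n J. F (f (CK u)) \<noteq> f (CH False)}"
    have "(\<lambda>u. f (CK u)) ` g \<subseteq> {u \<in> srt M SK. F u \<noteq> f (CH False)}" by (auto simp: g_def srt_M)
    moreover have "inj_on (\<lambda>u. f (CK u)) g" by (auto simp: inj_on_def g_def f_eq)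
    ultimately have "finite g" using F(2) finite_subset finite_imageD by blast
    moreover have "g \<subseteq> nsub n J" by (auto simp: g_def)
    moreover have "f (CH (u \<in> g)) = F (f (CK u))" if u: "u \<in> nsub n J" for u
    proof -
      obtain b where "F (f (CK u)) = f (CH b)" using bspec[OF F(1) mem_srt(2)[OF u]] by (auto simp: srt_M(3))
      then show ?thesis using u by (auto simp: g_def H_eq)
    qed
    ultimately show "\<exists>g\<in>srt M SG. \<forall>u\<in>srt M SK. ev M g u = F u"
      unfolding bex_srt ball_srt by (intro exI[of _ g]) (simp add: ops_M)
  qed
  show "rels M GAdd = {[a, b, d] | a b d. a \<in> srt M SG \<and> b \<in> srt M SG \<and> d \<in> srt M SG \<and>
    (\<forall>u\<in>srt M SK. ev M d u = hadd M (ev M a u) (ev M b u))}" by (rule GAdd_M)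
  show "rels M Supp = {[g, u] |g u. g \<in> srt M SG \<and> u \<in> srt M SK \<and> ev M g u \<noteq> f (CH False)}"
  proof (intro set_eqI iffI)
    fix xs assume "xs \<in> rels M Supp"
    then obtain g u where *: "xs = [f (CG g), f (CK u)]" "finite g" "g \<subseteq> nsub n J" "u \<in> nsub n J" "u \<in> g"
      by (auto simp: crel_simps elim!: relE)
    then show "xs \<in> {[g, u] |g u. g \<in> srt M SG \<and> u \<in> srt M SK \<and> ev M g u \<noteq> f (CH False)}"
      by (auto simp: ops_M H_eq mem_srt)
  next
    fix xs assume "xs \<in> {[g, u] |g u. g \<in> srt M SG \<and> u \<in> srt M SK \<and> ev M g u \<noteq> f (CH False)}"
    then obtain g u where *: "xs = [f (CG g), f (CK u)]" "finite g" "g \<subseteq> nsub n J" "u \<in> nsub n J" "u \<in> g"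
      by (auto simp: ops_M H_eq srt_M)
    then show "xs \<in> rels M Supp" by (simp add: rel2 crel_simps)
  qed
  show "\<forall>xs\<in>rels M PrG. xs ! 0 \<in> srt M SGs \<and> xs ! 1 \<in> srt M SK" using relM_ty(3) by blast
  show "\<forall>x\<in>srt M SGs. \<exists>!u. [x, u] \<in> rels M PrG" by (simp add: ball_srt PrG_iff)
  show "\<forall>u\<in>srt M SK. \<exists>x\<in>srt M SGs. prg M x = u"
    unfolding ball_srt bex_srt
    by (auto simp: ops_M) (metis empty_subsetI finite.emptyI ops_M(3))
  show "\<forall>xs\<in>rels M ActG. xs ! 0 \<in> srt M SG \<and> xs ! 1 \<in> srt M SGs \<and> xs ! 2 \<in> srt M SGs" using relM_ty(4) by blast
  show "\<forall>g\<in>srt M SG. \<forall>x\<in>srt M SGs. \<exists>!y. [g, x, y] \<in> rels M ActG" by (simp add: ball_srt ActG_iff)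
  show "\<forall>g\<in>srt M SG. \<forall>x\<in>srt M SGs. prg M (actg M g x) = prg M x"
  proof -
    have "prg M (actg M (f (CG g)) (f (CGs u h))) = prg M (f (CGs u h))"
      if "finite g" "g \<subseteq> nsub n J" "u \<in> nsub n J" "finite h" "h \<subseteq> nsub n J" for g u h
      using that sd_sub[of g "nsub n J" h] by (simp add: ops_M)
    then show ?thesis unfolding ball_srt by blast
  qed
  show "\<forall>g\<in>srt M SG. \<forall>x\<in>srt M SGs. (\<forall>u\<in>srt M SK. ev M g u = f (CH False)) \<longrightarrow> actg M g x = x"
  proof -
    have "actg M (f (CG g)) (f (CGs u h)) = f (CGs u h)"
      if "finite g" "g \<subseteq> nsub n J" "u \<in> nsub n J" "finite h" "h \<subseteq> nsub n J"
       "\<forall>u\<in>nsub n J. ev M (f (CG g)) (f (CK u)) = f (CH False)" for g u h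
    proof -
      have "g = {}" using that by (auto simp: ops_M H_eq)
      then show ?thesis using that by (simp add: ops_M)
    qed
    then show ?thesis unfolding ball_srt by blast
  qed
  show "\<forall>xs\<in>rels M GAdd. \<forall>x\<in>srt M SGs. actg M (xs ! 2) x = actg M (xs ! 0) (actg M (xs ! 1) x)"
  proof
    fix xs assume "xs \<in> rels M GAdd"
    then obtain g h where *: "xs = [f (CG g), f (CG h), f (CG (sym_diff g h))]"
      "finite g" "g \<subseteq> nsub n J" "finite h" "h \<subseteq> nsub n J"
      by (auto simp: crel_simps elim!: relE)
    have a: "sym_diff (sym_diff g h) k = sym_diff g (sym_diff h k)" for k by auto
    have "actg M (xs ! 2) (f (CGs u k)) = actg M (xs ! 0) (actg M (xs ! 1) (f (CGs u k)))"
      if "u \<in> nsub n J" "finite k" "k \<subseteq> nsub n J" for u k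
      using * that sd_sub[of g "nsub n J" h] sd_sub[of h "nsub n J" k] a[of k] by (simp add: ops_M)
    then show "\<forall>x\<in>srt M SGs. actg M (xs ! 2) x = actg M (xs ! 0) (actg M (xs ! 1) x)"
      unfolding ball_srt by blast
  qed
  show "\<forall>x\<in>srt M SGs. \<forall>y\<in>srt M SGs. prg M x = prg M y \<longrightarrow> (\<exists>!g. g \<in> srt M SG \<and> actg M g x = y)"
  proof -
    have reg: "\<exists>!g. g \<in> srt M SG \<and> actg M g (f (CGs u h)) = f (CGs v k)"
      if *: "u \<in> nsub n J" "finite h" "h \<subseteq> nsub n J" "v \<in> nsub n J" "finite k" "k \<subseteq> nsub n J"
       "prg M (f (CGs u h)) = prg M (f (CGs v k))" for u h v k
    proof
      have uv: "u = v" using * by (simp add: ops_M f_eq)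
      have e: "sym_diff (sym_diff h k) h = k" by auto
      have s: "sym_diff h k \<subseteq> nsub n J" using * by auto
      show "f (CG (sym_diff h k)) \<in> srt M SG \<and> actg M (f (CG (sym_diff h k))) (f (CGs u h)) = f (CGs v k)"
        using * uv s by (simp add: mem_srt ops_M e)
      fix g assume g: "g \<in> srt M SG \<and> actg M g (f (CGs u h)) = f (CGs v k)"
      then obtain g' where g': "g = f (CG g')" "finite g'" "g' \<subseteq> nsub n J" by (auto simp: srt_M)
      have s2: "sym_diff g' h \<subseteq> nsub n J" using * g' by auto
      have "sym_diff g' h = k" using g g' * s2 by (simp add: ops_M f_eq)
      then have "g' = sym_diff h k" by auto
      then show "g = f (CG (sym_diff h k))" using g' by simp
    qed
    show ?thesis unfolding ball_srt by (intro ballI allI impI, (elim conjE)?, rule reg; assumption)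
  qed
  show "\<forall>xs\<in>rels M PrH. xs ! 0 \<in> srt M SHs \<and> xs ! 1 \<in> srt M SK" using relM_ty(5) by blast
  show "\<forall>x\<in>srt M SHs. \<exists>!u. [x, u] \<in> rels M PrH" by (simp add: ball_srt PrH_iff)
  show "\<forall>u\<in>srt M SK. \<exists>x\<in>srt M SHs. prh M x = u"
    unfolding ball_srt bex_srt using ops_M(4) by blast
  show "\<forall>xs\<in>rels M ActH. xs ! 0 \<in> srt M SH \<and> xs ! 1 \<in> srt M SHs \<and> xs ! 2 \<in> srt M SHs" using relM_ty(6) by blast
  show "\<forall>h\<in>srt M SH. \<forall>x\<in>srt M SHs. \<exists>!y. [h, x, y] \<in> rels M ActH" by (simp add: ball_srt ActH_iff)
  show "\<forall>h\<in>srt M SH. \<forall>x\<in>srt M SHs. prh M (acth M h x) = prh M x"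
    unfolding ball_srt by (simp add: ops_M)
  show "\<forall>x\<in>srt M SHs. acth M (f (CH False)) x = x" unfolding ball_srt by (simp add: ops_M)
  show "\<forall>a\<in>srt M SH. \<forall>b\<in>srt M SH. \<forall>x\<in>srt M SHs. acth M (hadd M a b) x = acth M a (acth M b x)"
  proof -
    have "((a \<noteq> b) \<noteq> m) = (a \<noteq> (b \<noteq> m))" for a b m by auto
    then have "acth M (f (CH (a \<noteq> b))) (f (CHs u m)) = acth M (f (CH a)) (acth M (f (CH b)) (f (CHs u m)))"
      if "u \<in> nsub n J" for a b u m using that by (simp only: ops_M)
    then show ?thesis unfolding ball_srt ops_M(1) by blast
  qed
  show "\<forall>x\<in>srt M SHs. \<forall>y\<in>srt M SHs. prh M x = prh M y \<longrightarrow> (\<exists>!h. h \<in> srt M SH \<and> acth M h x = y)"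
  proof -
    have reg: "\<exists>!h. h \<in> srt M SH \<and> acth M h (f (CHs u a)) = f (CHs v b)"
      if *: "u \<in> nsub n J" "v \<in> nsub n J" "prh M (f (CHs u a)) = prh M (f (CHs v b))" for u a v b
    proof
      have uv: "u = v" using * by (simp add: ops_M f_eq)
      show "f (CH (a \<noteq> b)) \<in> srt M SH \<and> acth M (f (CH (a \<noteq> b))) (f (CHs u a)) = f (CHs v b)"
        using * uv by (auto simp add: mem_srt ops_M f_eq)
      fix h assume h: "h \<in> srt M SH \<and> acth M h (f (CHs u a)) = f (CHs v b)"
      then obtain h' where h': "h = f (CH h')" by (auto simp: srt_M)
      have "(h' \<noteq> a) = b" using h h' * uv by (simp add: ops_M f_eq)
      then have "h' = (a \<noteq> b)" by auto
      then show "h = f (CH (a \<noteq> b))" using h' by simp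
    qed
    show ?thesis unfolding ball_srt by (intro ballI allI impI, (elim conjE)?, rule reg; assumption)
  qed
  show "\<forall>xs\<in>rels M Qr. (\<forall>l<n. xs ! l \<in> srt M SGs) \<and> xs ! n \<in> srt M SHs \<and> compatible n M xs"
  proof
    fix xs assume "xs \<in> rels M Qr"
    then obtain us gs v m w where *: "xs = map f (qlist n us gs v m)" "enum n w v us" "w \<subseteq> J"
    "\<And>l. l < n \<Longrightarrow> us l \<in> nsub n J \<and> finite (gs l) \<and> gs l \<subseteq> nsub n J" "v \<in> nsub n J"
      using Qr_M_E by metis
    have "compatible n M xs" unfolding *(1) using * by (subst compat_M) auto
    then show "(\<forall>l<n. xs ! l \<in> srt M SGs) \<and> xs ! n \<in> srt M SHs \<and> compatible n M xs"
      using * by (auto simp: qlist_nth mem_srt)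
  qed
  show "\<forall>xs\<in>rels M Qr. \<forall>p. p permutes {..<n} \<longrightarrow>
          map (\<lambda>l. if l < n then xs ! p l else xs ! l) [0..<Suc n] \<in> rels M Qr"
    using Q_perm by blast
  show "\<forall>xs. length xs = Suc n \<and> (\<forall>l<n. xs ! l \<in> srt M SGs) \<and> xs ! n \<in> srt M SHs \<and> compatible n M xs \<longrightarrow>
         (\<forall>gs m. (\<forall>l<n. gs l \<in> srt M SG) \<and> m \<in> srt M SH \<longrightarrow>
             ((map (\<lambda>l. if l < n then actg M (gs l) (xs ! l) else acth M m (xs ! n)) [0..<Suc n] \<in> rels M Qr
               \<longleftrightarrow> xs \<in> rels M Qr) \<longleftrightarrow>
              foldr (\<lambda>l acc. hadd M (ev M (gs l) (prh M (xs ! n))) acc) [0..<n] m = f (CH False)))"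
    using Q_move by blast
qed

end

section \<open>Coordinates of an arbitrary model\<close>

locale kmodel =
  fixes n :: nat and N :: "'u str"
  assumes npos: "0 < n" and Kn: "Kn n N"
begin

abbreviation "I \<equiv> srt N SI"
abbreviation "K \<equiv> srt N SK"
abbreviation "H \<equiv> srt N SH"
abbreviation "G \<equiv> srt N SG"
abbreviation "Gs \<equiv> srt N SGs"
abbreviation "Hs \<equiv> srt N SHs"
abbreviation "z \<equiv> hzero N"

lemmas Kn_unf = Kn[unfolded Kn_def Let_def]

lemma KD:
  "wf_str n N"
  "dom N = (\<Union>s\<in>sorts. srt N s)"
  "\<forall>s\<in>sorts. \<forall>s'\<in>sorts. s \<noteq> s' \<longrightarrow> srt N s \<inter> srt N s' = {}"
  "\<forall>xs\<in>rels N Mem. xs ! 0 \<in> I \<and> xs ! 1 \<in> K"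
  "\<forall>u\<in>K. finite (memb N u) \<and> card (memb N u) = n"
  "inj_on (memb N) K"
  "\<forall>w. w \<subseteq> I \<and> finite w \<and> card w = n \<longrightarrow> (\<exists>u\<in>K. memb N u = w)"
  "\<forall>xs\<in>rels N Ev. xs ! 0 \<in> G \<and> xs ! 1 \<in> K \<and> xs ! 2 \<in> H"
  "\<forall>g\<in>G. \<forall>u\<in>K. \<exists>!h. [g, u, h] \<in> rels N Ev"
  "\<forall>g\<in>G. finite {u\<in>K. ev N g u \<noteq> z}"
  "\<forall>g\<in>G. \<forall>g'\<in>G. (\<forall>u\<in>K. ev N g u = ev N g' u) \<longrightarrow> g = g'"
  "\<forall>f. (\<forall>u\<in>K. f u \<in> H) \<and> finite {u\<in>K. f u \<noteq> z} \<longrightarrow> (\<exists>g\<in>G. \<forall>u\<in>K. ev N g u = f u)"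
  "rels N GAdd = {[a, b, c] | a b c. a \<in> G \<and> b \<in> G \<and> c \<in> G \<and>
                       (\<forall>u\<in>K. ev N c u = hadd N (ev N a u) (ev N b u))}"
  "rels N Supp = {[g, u] | g u. g \<in> G \<and> u \<in> K \<and> ev N g u \<noteq> z}"
  by ((insert Kn_unf, elim conjE, assumption)+)

lemma KD_H: "\<exists>h0 h1. h0 \<noteq> h1 \<and> H = {h0, h1} \<and>
         rels N HAdd = {[h0,h0,h0], [h0,h1,h1], [h1,h0,h1], [h1,h1,h0]}"
  by (insert Kn_unf, elim conjE, assumption)

lemma KD2:
  "\<forall>xs\<in>rels N PrG. xs ! 0 \<in> Gs \<and> xs ! 1 \<in> K"
  "\<forall>x\<in>Gs. \<exists>!u. [x, u] \<in> rels N PrG"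
  "\<forall>u\<in>K. \<exists>x\<in>Gs. prg N x = u"
  "\<forall>xs\<in>rels N ActG. xs ! 0 \<in> G \<and> xs ! 1 \<in> Gs \<and> xs ! 2 \<in> Gs"
  "\<forall>g\<in>G. \<forall>x\<in>Gs. \<exists>!y. [g, x, y] \<in> rels N ActG"
  "\<forall>g\<in>G. \<forall>x\<in>Gs. prg N (actg N g x) = prg N x"
  "\<forall>g\<in>G. \<forall>x\<in>Gs. (\<forall>u\<in>K. ev N g u = z) \<longrightarrow> actg N g x = x"
  "\<forall>xs\<in>rels N GAdd. \<forall>x\<in>Gs. actg N (xs ! 2) x = actg N (xs ! 0) (actg N (xs ! 1) x)"
  "\<forall>x\<in>Gs. \<forall>y\<in>Gs. prg N x = prg N y \<longrightarrow> (\<exists>!g. g \<in> G \<and> actg N g x = y)"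
  "\<forall>xs\<in>rels N PrH. xs ! 0 \<in> Hs \<and> xs ! 1 \<in> K"
  "\<forall>x\<in>Hs. \<exists>!u. [x, u] \<in> rels N PrH"
  "\<forall>u\<in>K. \<exists>x\<in>Hs. prh N x = u"
  "\<forall>xs\<in>rels N ActH. xs ! 0 \<in> H \<and> xs ! 1 \<in> Hs \<and> xs ! 2 \<in> Hs"
  "\<forall>h\<in>H. \<forall>x\<in>Hs. \<exists>!y. [h, x, y] \<in> rels N ActH"
  "\<forall>h\<in>H. \<forall>x\<in>Hs. prh N (acth N h x) = prh N x"
  "\<forall>x\<in>Hs. acth N z x = x"
  "\<forall>a\<in>H. \<forall>b\<in>H. \<forall>x\<in>Hs. acth N (hadd N a b) x = acth N a (acth N b x)"
  "\<forall>x\<in>Hs. \<forall>y\<in>Hs. prh N x = prh N y \<longrightarrow> (\<exists>!h. h \<in> H \<and> acth N h x = y)"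
  "\<forall>xs\<in>rels N Qr. (\<forall>l<n. xs ! l \<in> Gs) \<and> xs ! n \<in> Hs \<and> compatible n N xs"
  "\<forall>xs\<in>rels N Qr. \<forall>p. p permutes {..<n} \<longrightarrow>
          map (\<lambda>l. if l < n then xs ! p l else xs ! l) [0..<Suc n] \<in> rels N Qr"
  "\<forall>xs. length xs = Suc n \<and> (\<forall>l<n. xs ! l \<in> Gs) \<and> xs ! n \<in> Hs \<and> compatible n N xs \<longrightarrow>
         (\<forall>gs m. (\<forall>l<n. gs l \<in> G) \<and> m \<in> H \<longrightarrow>
             ((map (\<lambda>l. if l < n then actg N (gs l) (xs ! l) else acth N m (xs ! n)) [0..<Suc n] \<in> rels N Qr
               \<longleftrightarrow> xs \<in> rels N Qr) \<longleftrightarrow>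
              foldr (\<lambda>l acc. hadd N (ev N (gs l) (prh N (xs ! n))) acc) [0..<n] m = z))"
  by ((insert Kn_unf, elim conjE, assumption)+)

definition hh :: "bool \<Rightarrow> 'u" where
  "hh b = (if b then (SOME h. h \<in> H \<and> h \<noteq> z) else z)"

lemma hh: "hh False = z" "hh a = hh b \<longleftrightarrow> a = b" "H = range hh"
  "[hh a, hh b, y] \<in> rels N HAdd \<longleftrightarrow> y = hh (a \<noteq> b)"
  "xs \<in> rels N HAdd \<Longrightarrow> \<exists>a b. xs = [hh a, hh b, hh (a \<noteq> b)]"
proof -
  obtain h0 h1 where h: "h0 \<noteq> h1" "H = {h0, h1}"
    "rels N HAdd = {[h0,h0,h0], [h0,h1,h1], [h1,h0,h1], [h1,h1,h0]}" using KD_H by blast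
  have z: "z = h0" unfolding hzero_def h(3) using h(1) by auto
  have "(SOME h. h \<in> H \<and> h \<noteq> z) = h1" using h z by (intro some_equality) auto
  then have hh: "hh b = (if b then h1 else h0)" for b by (simp add: hh_def z)
  show "hh False = z" "hh a = hh b \<longleftrightarrow> a = b" "H = range hh"
    using h by (auto simp: hh z)
  show "[hh a, hh b, y] \<in> rels N HAdd \<longleftrightarrow> y = hh (a \<noteq> b)" using h by (auto simp: hh)
  show "\<exists>a b. xs = [hh a, hh b, hh (a \<noteq> b)]" if "xs \<in> rels N HAdd"
    using that h by (auto simp: hh)
qed

lemma hadd_hh: "hadd N (hh a) (hh b) = hh (a \<noteq> b)"
  by (simp add: hadd_def hh(4))

lemma hh_H: "hh b \<in> H" using hh(3) by auto

lemma ev_H: "g \<in> G \<Longrightarrow> u \<in> K \<Longrightarrow> [g, u, y] \<in> rels N Ev \<longleftrightarrow> y = ev N g u"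
  using KD(9) unfolding ev_def by (metis (no_types, lifting) the_equality)

lemma ev_in: "g \<in> G \<Longrightarrow> u \<in> K \<Longrightarrow> ev N g u \<in> H"
  using ev_H[of g u "ev N g u"] KD(8) by fastforce

text \<open>The element of the direct sum with support \<open>S\<close>. It exists for finite
  \<open>S\<close> inside \<open>K\<close>, and extensionality of \<open>G\<close> makes it
  unique.\<close>

definition el :: "'u set \<Rightarrow> 'u" where
  "el S = (SOME g. g \<in> G \<and> (\<forall>u\<in>K. ev N g u = hh (u \<in> S)))"

lemma el:
  assumes "finite S" "S \<subseteq> K"
  shows "el S \<in> G" "u \<in> K \<Longrightarrow> ev N (el S) u = hh (u \<in> S)"
proof -
  have "{u\<in>K. hh (u \<in> S) \<noteq> z} \<subseteq> S"
    by (rule subsetI, rule ccontr) (use hh(1) in simp)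
  then have "finite {u\<in>K. hh (u \<in> S) \<noteq> z}" using assms finite_subset by blast
  then have "\<exists>g\<in>G. \<forall>u\<in>K. ev N g u = hh (u \<in> S)"
    using KD(12)[rule_format, of "\<lambda>u. hh (u \<in> S)"] hh_H by blast
  then have "\<exists>g. g \<in> G \<and> (\<forall>u\<in>K. ev N g u = hh (u \<in> S))" by blast
  from someI_ex[OF this] show "el S \<in> G" "u \<in> K \<Longrightarrow> ev N (el S) u = hh (u \<in> S)"
    unfolding el_def by blast+
qed

lemma el_surj: "g \<in> G \<Longrightarrow> \<exists>S. finite S \<and> S \<subseteq> K \<and> g = el S"
proof -
  assume g: "g \<in> G"
  define S where "S = {u\<in>K. ev N g u \<noteq> z}"
  have S: "finite S" "S \<subseteq> K" using KD(10) g by (auto simp: S_def)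
  have "ev N g u = ev N (el S) u" if u: "u \<in> K" for u
  proof -
    obtain b where "ev N g u = hh b" using ev_in[OF g u] hh(3) by auto
    then show ?thesis using el(2)[OF S u] u hh(1) hh(2)[of b False] by (cases b) (auto simp: S_def)
  qed
  then have "g = el S" using KD(11) g el(1)[OF S] by blast
  then show ?thesis using S by blast
qed

lemma el_inj: "finite S \<Longrightarrow> S \<subseteq> K \<Longrightarrow> finite T \<Longrightarrow> T \<subseteq> K \<Longrightarrow> el S = el T \<longleftrightarrow> S = T"
proof -
  assume *: "finite S" "S \<subseteq> K" "finite T" "T \<subseteq> K"
  have "S = T" if "el S = el T"
  proof -
    have "(u \<in> S) = (u \<in> T)" if "u \<in> K" for u
      using el(2)[OF *(1,2) that] el(2)[OF *(3,4) that] \<open>el S = el T\<close> hh(2) by metis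
    then show ?thesis using * by blast
  qed
  then show ?thesis by blast
qed

lemma GAdd_el: "finite S \<Longrightarrow> S \<subseteq> K \<Longrightarrow> finite T \<Longrightarrow> T \<subseteq> K \<Longrightarrow> finite U \<Longrightarrow> U \<subseteq> K \<Longrightarrow>
   [el S, el T, el U] \<in> rels N GAdd \<longleftrightarrow> U = sym_diff S T"
proof -
  assume *: "finite S" "S \<subseteq> K" "finite T" "T \<subseteq> K" "finite U" "U \<subseteq> K"
  have "[el S, el T, el U] \<in> rels N GAdd \<longleftrightarrow> (\<forall>u\<in>K. (u \<in> U) = ((u \<in> S) \<noteq> (u \<in> T)))"
    unfolding KD(13) using * by (simp add: el hadd_hh hh(2))
  also have "\<dots> \<longleftrightarrow> U = sym_diff S T" using * by blast
  finally show ?thesis .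
qed

lemma Supp_el: "finite S \<Longrightarrow> S \<subseteq> K \<Longrightarrow> [el S, u] \<in> rels N Supp \<longleftrightarrow> u \<in> S"
  unfolding KD(14) hh(1)[symmetric] by (cases "u \<in> K") (auto simp: el hh(2))

lemma Ev_el: "finite S \<Longrightarrow> S \<subseteq> K \<Longrightarrow> u \<in> K \<Longrightarrow> [el S, u, y] \<in> rels N Ev \<longleftrightarrow> y = hh (u \<in> S)"
  by (simp add: ev_H el)

lemma ActG_iff: "g \<in> G \<Longrightarrow> x \<in> Gs \<Longrightarrow> [g, x, y] \<in> rels N ActG \<longleftrightarrow> y = actg N g x"
  using KD2(5) unfolding actg_def by (metis (no_types, lifting) the_equality)

lemma ActH_iff: "h \<in> H \<Longrightarrow> x \<in> Hs \<Longrightarrow> [h, x, y] \<in> rels N ActH \<longleftrightarrow> y = acth N h x"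
  using KD2(14) unfolding acth_def by (metis (no_types, lifting) the_equality)

lemma PrG_iff: "x \<in> Gs \<Longrightarrow> [x, y] \<in> rels N PrG \<longleftrightarrow> y = prg N x"
  using KD2(2) unfolding prg_def by (metis (no_types, lifting) the_equality)

lemma PrH_iff: "x \<in> Hs \<Longrightarrow> [x, y] \<in> rels N PrH \<longleftrightarrow> y = prh N x"
  using KD2(11) unfolding prh_def by (metis (no_types, lifting) the_equality)

lemma prg_K: "x \<in> Gs \<Longrightarrow> prg N x \<in> K"
  using PrG_iff[of x "prg N x"] KD2(1) by fastforce

lemma prh_K: "x \<in> Hs \<Longrightarrow> prh N x \<in> K"
  using PrH_iff[of x "prh N x"] KD2(10) by fastforce

lemma actg_Gs: "g \<in> G \<Longrightarrow> x \<in> Gs \<Longrightarrow> actg N g x \<in> Gs"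
  using ActG_iff[of g x "actg N g x"] KD2(4) by fastforce

lemma acth_Hs: "h \<in> H \<Longrightarrow> x \<in> Hs \<Longrightarrow> acth N h x \<in> Hs"
  using ActH_iff[of h x "acth N h x"] KD2(13) by fastforce

lemma actg_empty: "x \<in> Gs \<Longrightarrow> actg N (el {}) x = x"
  using KD2(7)[rule_format, of "el {}" x] el[of "{}"] hh(1) by auto

lemma actg_actg: "finite S \<Longrightarrow> S \<subseteq> K \<Longrightarrow> finite T \<Longrightarrow> T \<subseteq> K \<Longrightarrow> x \<in> Gs \<Longrightarrow>
   actg N (el S) (actg N (el T) x) = actg N (el (sym_diff S T)) x"
proof -
  assume *: "finite S" "S \<subseteq> K" "finite T" "T \<subseteq> K" "x \<in> Gs"
  have "sym_diff S T \<subseteq> K" using * by auto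
  then have "[el S, el T, el (sym_diff S T)] \<in> rels N GAdd" using * by (simp add: GAdd_el)
  from KD2(8)[rule_format, OF this *(5)] show ?thesis by simp
qed

lemma actg_inj: "finite S \<Longrightarrow> S \<subseteq> K \<Longrightarrow> finite T \<Longrightarrow> T \<subseteq> K \<Longrightarrow> x \<in> Gs \<Longrightarrow>
   actg N (el S) x = actg N (el T) x \<longleftrightarrow> S = T"
proof -
  assume *: "finite S" "S \<subseteq> K" "finite T" "T \<subseteq> K" "x \<in> Gs"
  note S = el(1)[OF *(1,2)] and T = el(1)[OF *(3,4)]
  have "el S = el T" if "actg N (el S) x = actg N (el T) x"
  proof -
    have "\<exists>!g. g \<in> G \<and> actg N g x = actg N (el S) x"
      using KD2(9) *(5) actg_Gs[OF S *(5)] KD2(6) S by metis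
    then show ?thesis using S T that by metis
  qed
  then show ?thesis using el_inj * by blast
qed

lemma actg_surj: "x \<in> Gs \<Longrightarrow> y \<in> Gs \<Longrightarrow> prg N x = prg N y \<Longrightarrow> \<exists>S. finite S \<and> S \<subseteq> K \<and> y = actg N (el S) x"
  using KD2(9) el_surj by metis

lemma acth_acth: "x \<in> Hs \<Longrightarrow> acth N (hh a) (acth N (hh b) x) = acth N (hh (a \<noteq> b)) x"
  using KD2(17) hh_H hadd_hh by metis

lemma acth_False: "x \<in> Hs \<Longrightarrow> acth N (hh False) x = x"
  using KD2(16) hh(1) by simp

lemma acth_inj: "x \<in> Hs \<Longrightarrow> acth N (hh a) x = acth N (hh b) x \<longleftrightarrow> a = b"
proof -
  assume x: "x \<in> Hs"
  have "hh a = hh b" if "acth N (hh a) x = acth N (hh b) x"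
  proof -
    have "\<exists>!h. h \<in> H \<and> acth N h x = acth N (hh a) x"
      using KD2(18) x acth_Hs[OF hh_H x] KD2(15) hh_H by metis
    then show ?thesis using hh_H that by metis
  qed
  then show ?thesis using hh(2) by blast
qed

lemma acth_surj: "x \<in> Hs \<Longrightarrow> y \<in> Hs \<Longrightarrow> prh N x = prh N y \<Longrightarrow> \<exists>b. y = acth N (hh b) x"
  using KD2(18) hh(3) by (metis rangeE)

lemma foldr_hadd:
  assumes "\<And>l. l \<in> set ls \<Longrightarrow> finite (S l) \<and> S l \<subseteq> K" "v \<in> K"
  shows "foldr (\<lambda>l acc. hadd N (ev N (el (S l)) v) acc) ls (hh m) = hh (foldr (\<lambda>l acc. (v \<in> S l) \<noteq> acc) ls m)"
  using assms by (induction ls) (auto simp: el hadd_hh)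

end

text \<open>Closure under supports is the part of \<open>\<le>\<close> that is not quantifier-free: a substructure alone may
  contain an element of \<open>G\<close> whose support leaves it.\<close>
definition csub :: "nat \<Rightarrow> 'u str \<Rightarrow> 'u str \<Rightarrow> bool" where
  "csub n M N = (Kn n M \<and> Kn n N \<and> dom M \<subseteq> dom N \<and>
     (\<forall>r. rels M r = {xs \<in> rels N r. set xs \<subseteq> dom M}) \<and>
     (\<forall>g u. [g, u] \<in> rels N Supp \<longrightarrow> g \<in> dom M \<longrightarrow> u \<in> dom M))"

fun csort :: "'i cel \<Rightarrow> sym" where
  "csort (CI i) = SI" | "csort (CK u) = SK" | "csort (CH b) = SH" | "csort (CG g) = SG"
| "csort (CGs u g) = SGs" | "csort (CHs u m) = SHs"

lemma csort_iff:
  "csort x = SI \<longleftrightarrow> (\<exists>i. x = CI i)" "csort x = SK \<longleftrightarrow> (\<exists>u. x = CK u)" "csort x = SH \<longleftrightarrow> (\<exists>b. x = CH b)"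
  "csort x = SG \<longleftrightarrow> (\<exists>g. x = CG g)" "csort x = SGs \<longleftrightarrow> (\<exists>u g. x = CGs u g)" "csort x = SHs \<longleftrightarrow> (\<exists>u m. x = CHs u m)"
  by (cases x; simp)+

text \<open>Together with the symmetry of \<open>Q\<close> this makes the truth value of
  \<open>Q\<close> on base points independent of the order in which the stalks are listed.\<close>

lemma enum_perm:
  assumes "enum n w v us" "enum n w v us'"
  shows "\<exists>p. p permutes {..<n} \<and> (\<forall>l<n. us' l = us (p l))"
proof -
  define p where "p l = (if l < n then inv_into {..<n} us (us' l) else l)" for l
  have b: "bij_betw us {..<n} (nsub n w - {v})" "bij_betw us' {..<n} (nsub n w - {v})"
    using assms by (simp_all add: enum_def)
  have "bij_betw (inv_into {..<n} us \<circ> us') {..<n} {..<n}"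
    using bij_betw_trans[OF b(2) bij_betw_inv_into[OF b(1)]] .
  moreover have "(inv_into {..<n} us \<circ> us') l = p l" if "l \<in> {..<n}" for l using that by (simp add: p_def)
  ultimately have "bij_betw p {..<n} {..<n}" using bij_betw_cong by blast
  then have 1: "p permutes {..<n}" by (rule bij_imp_permutes) (simp add: p_def)
  have 2: "us' l = us (p l)" if l: "l < n" for l
  proof -
    have "us' l \<in> us' ` {..<n}" using l by simp
    then have "us' l \<in> us ` {..<n}"
      unfolding bij_betw_imp_surj_on[OF b(1)] bij_betw_imp_surj_on[OF b(2)] .
    from f_inv_into_f[OF this] show ?thesis using l by (simp add: p_def)
  qed
  show ?thesis using 1 2 by blast
qed

lemma map_qlist: "map f (qlist n us gs v m) =
    map (\<lambda>l. if l < n then f (CGs (us l) (gs l)) else f (CHs v m)) [0..<Suc n]"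
  by (simp add: qlist_def comp_def if_distrib)

section \<open>Coordinates from a choice of base points\<close>

text \<open>\<open>sx\<close> and \<open>sy\<close> choose the base points.\<close>
locale kcoord = kmodel n N for n and N :: "'u str" +
  fixes J :: "'i set" and \<sigma> :: "'i \<Rightarrow> 'u" and sx sy :: "'i set \<Rightarrow> 'u"
  assumes inj_sig: "inj_on \<sigma> J" and sig_I: "\<And>i. i \<in> J \<Longrightarrow> \<sigma> i \<in> srt N SI"
    and sx: "\<And>u. u \<in> nsub n J \<Longrightarrow> sx u \<in> srt N SGs \<and> memb N (prg N (sx u)) = \<sigma> ` u"
    and sy: "\<And>u. u \<in> nsub n J \<Longrightarrow> sy u \<in> srt N SHs \<and> memb N (prh N (sy u)) = \<sigma> ` u"
begin

definition "kk u = (SOME k. k \<in> K \<and> memb N k = \<sigma> ` u)"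

lemma sig_card: "u \<subseteq> J \<Longrightarrow> finite (\<sigma> ` u) = finite u \<and> card (\<sigma> ` u) = card u"
  using inj_sig inj_on_subset[of \<sigma> J u] by (simp add: card_image finite_image_iff)

lemma kk: "u \<in> nsub n J \<Longrightarrow> kk u \<in> K" "u \<in> nsub n J \<Longrightarrow> memb N (kk u) = \<sigma> ` u"
proof -
  assume u: "u \<in> nsub n J"
  then have "\<sigma> ` u \<subseteq> I" "finite (\<sigma> ` u)" "card (\<sigma> ` u) = n" using sig_I sig_card[of u] by (auto simp: nsub_def)
  then have "\<exists>k. k \<in> K \<and> memb N k = \<sigma> ` u" using KD(7) by blast
  from someI_ex[OF this] show "kk u \<in> K" "memb N (kk u) = \<sigma> ` u" unfolding kk_def by blast+
qed

lemma kk_eq: "u \<in> nsub n J \<Longrightarrow> k \<in> K \<Longrightarrow> memb N k = \<sigma> ` u \<Longrightarrow> k = kk u"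
  using KD(6) kk by (metis inj_onD)

lemma sig_img_eq: "u \<subseteq> J \<Longrightarrow> v \<subseteq> J \<Longrightarrow> \<sigma> ` u = \<sigma> ` v \<longleftrightarrow> u = v"
  by (rule inj_on_image_eq_iff[OF inj_sig])

lemma kk_inj: "u \<in> nsub n J \<Longrightarrow> v \<in> nsub n J \<Longrightarrow> kk u = kk v \<longleftrightarrow> u = v"
  using kk(2)[of u] kk(2)[of v] sig_img_eq[of u v] by (auto simp: nsub_def)

lemma prg_sx: "u \<in> nsub n J \<Longrightarrow> prg N (sx u) = kk u"
  using sx prg_K kk_eq by metis

lemma prh_sy: "u \<in> nsub n J \<Longrightarrow> prh N (sy u) = kk u"
  using sy prh_K kk_eq by metis

lemma kkg: "finite g \<Longrightarrow> g \<subseteq> nsub n J \<Longrightarrow> finite (kk ` g) \<and> kk ` g \<subseteq> K"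
  using kk(1) by auto

lemma kkg_mem: "g \<subseteq> nsub n J \<Longrightarrow> u \<in> nsub n J \<Longrightarrow> kk u \<in> kk ` g \<longleftrightarrow> u \<in> g"
  using kk_inj by (auto simp: image_iff)

lemma inj_kk: "inj_on kk (nsub n J)" using kk_inj by (auto simp: inj_on_def)

lemma kkg_eq: "g \<subseteq> nsub n J \<Longrightarrow> h \<subseteq> nsub n J \<Longrightarrow> kk ` g = kk ` h \<longleftrightarrow> g = h"
  by (rule inj_on_image_eq_iff[OF inj_kk])

lemma kkg_sd: "g \<subseteq> nsub n J \<Longrightarrow> h \<subseteq> nsub n J \<Longrightarrow> sym_diff (kk ` g) (kk ` h) = kk ` sym_diff g h"
  using inj_on_image_set_diff[OF inj_kk, of g h] inj_on_image_set_diff[OF inj_kk, of h g]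
  by (simp add: image_Un le_infI1 Diff_eq)

primrec ff :: "'i cel \<Rightarrow> 'u" where
  "ff (CI i) = \<sigma> i"
| "ff (CK u) = kk u"
| "ff (CH b) = hh b"
| "ff (CG g) = el (kk ` g)"
| "ff (CGs u g) = actg N (el (kk ` g)) (sx u)"
| "ff (CHs u m) = acth N (hh m) (sy u)"

lemma ff_srt: "cin n J x \<Longrightarrow> ff x \<in> srt N (csort x)"
  by (cases x) (auto simp: sig_I kk hh_H el kkg actg_Gs acth_Hs sx sy)

lemma csort_sorts: "csort x \<in> sorts" by (cases x) (auto simp: sorts_def)

lemma ff_srt_iff: "cin n J x \<Longrightarrow> s \<in> sorts \<Longrightarrow> ff x \<in> srt N s \<longleftrightarrow> s = csort x"
  using ff_srt[of x] KD(3) csort_sorts[of x] by blast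

lemma ff_dom: "cin n J x \<Longrightarrow> ff x \<in> dom N"
  using ff_srt[of x] csort_sorts[of x] KD(2) by blast

lemma prg_ff: "u \<in> nsub n J \<Longrightarrow> finite g \<Longrightarrow> g \<subseteq> nsub n J \<Longrightarrow> prg N (ff (CGs u g)) = kk u"
  using KD2(6) sx prg_sx el(1) kkg by simp

lemma prh_ff: "u \<in> nsub n J \<Longrightarrow> prh N (ff (CHs u m)) = kk u"
  using KD2(15) sy prh_sy hh_H by simp

text \<open>The sorts separate the constructors. Within \<open>Gs\<close> and \<open>Hs\<close> the
  projection recovers the stalk, and regularity of the action recovers the group element.\<close>

lemma ff_inj: "inj_on ff (cdom n J)"
proof (rule inj_onI)
  fix x y assume xy: "x \<in> cdom n J" "y \<in> cdom n J" "ff x = ff y"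
  have s: "csort x = csort y" using ff_srt_iff[of x "csort y"] ff_srt[of y] xy csort_sorts[of y] by simp
  show "x = y"
  proof (cases x)
    case (CI i) then show ?thesis using xy s inj_sig by (cases y) (auto simp: inj_on_def)
  next
    case (CK u) then show ?thesis using xy s by (cases y) (auto simp: kk_inj)
  next
    case (CH u) then show ?thesis using xy s by (cases y) (auto simp: hh)
  next
    case (CG u) then show ?thesis using xy s by (cases y) (auto simp: el_inj kkg kkg_eq)
  next
    case (CGs u g)
    then obtain v h where y: "y = CGs v h" using s by (cases y) auto
    have "kk u = kk v" using xy CGs y prg_ff[of u g] prg_ff[of v h] by auto
    then have "u = v" using xy CGs y by (auto simp: kk_inj)
    then show ?thesis using xy CGs y by (auto simp: actg_inj kkg sx kkg_eq)
  next
    case (CHs u g)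
    then obtain v h where y: "y = CHs v h" using s by (cases y) auto
    have "kk u = kk v" using xy CHs y prh_ff[of u g] prh_ff[of v h] by auto
    then have "u = v" using xy CHs y by (auto simp: kk_inj)
    then show ?thesis using xy CHs y by (auto simp: acth_inj sy)
  qed
qed

lemma ff_surj:
  assumes "\<sigma> ` J = I" shows "ff ` cdom n J = dom N"
proof (intro set_eqI iffI)
  fix y assume "y \<in> ff ` cdom n J" then show "y \<in> dom N" using ff_dom by auto
next
  have Ks: "\<exists>u\<in>nsub n J. k = kk u" if "k \<in> K" for k
  proof -
    have m: "memb N k \<subseteq> I" using KD(4) by (fastforce simp: memb_def)
    then obtain u where u: "u \<subseteq> J" "memb N k = \<sigma> ` u" using assms subset_image_iff by metis
    moreover have "finite (\<sigma> ` u) \<and> card (\<sigma> ` u) = n" using KD(5) that u(2) by metis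
    ultimately have "u \<in> nsub n J" using sig_card[of u] by (simp add: nsub_def)
    then show ?thesis using kk_eq that u by blast
  qed
  have Ss: "\<exists>g. finite g \<and> g \<subseteq> nsub n J \<and> S = kk ` g" if "finite S" "S \<subseteq> K" for S
    using finite_subset_image[OF that(1), of kk "nsub n J"] Ks that(2) by blast
  fix y assume "y \<in> dom N"
  then obtain s where s: "s \<in> sorts" "y \<in> srt N s" using KD(2) by blast
  have ex: "y \<in> ff ` cdom n J" if "cin n J x" "y = ff x" for x using that by auto
  consider "y \<in> I" | "y \<in> K" | "y \<in> H" | "y \<in> G" | "y \<in> Gs" | "y \<in> Hs" using s by (auto simp: sorts_def)
  then show "y \<in> ff ` cdom n J"
  proof cases
    case 1 then obtain i where "i \<in> J" "y = \<sigma> i" using assms by auto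
    then show ?thesis by (intro ex[of "CI i"]) auto
  next
    case 2 then obtain u where "u \<in> nsub n J" "y = kk u" using Ks by blast
    then show ?thesis by (intro ex[of "CK u"]) auto
  next
    case 3 then obtain b where "y = hh b" using hh(3) by auto
    then show ?thesis by (intro ex[of "CH b"]) auto
  next
    case 4 then obtain g where "finite g" "g \<subseteq> nsub n J" "y = el (kk ` g)" using el_surj Ss by metis
    then show ?thesis by (intro ex[of "CG g"]) auto
  next
    case 5
    obtain u where u: "u \<in> nsub n J" "prg N y = kk u" using Ks prg_K[OF 5] by blast
    obtain S where "finite S" "S \<subseteq> K" "y = actg N (el S) (sx u)" using actg_surj[of "sx u" y] sx prg_sx u 5 by metis
    then obtain g where "finite g" "g \<subseteq> nsub n J" "y = actg N (el (kk ` g)) (sx u)" using Ss by metis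
    then show ?thesis using u by (intro ex[of "CGs u g"]) auto
  next
    case 6
    obtain u where u: "u \<in> nsub n J" "prh N y = kk u" using Ks prh_K[OF 6] by blast
    obtain b where "y = acth N (hh b) (sy u)" using acth_surj[of "sy u" y] sy prh_sy u 6 by metis
    then show ?thesis using u by (intro ex[of "CHs u b"]) auto
  qed
qed

lemma compat_iff:
  assumes "\<And>l. l < n \<Longrightarrow> us l \<in> nsub n J \<and> finite (gs l) \<and> gs l \<subseteq> nsub n J" "v \<in> nsub n J"
  shows "compatible n N (map ff (qlist n us gs v m)) \<longleftrightarrow> (\<exists>w. w \<subseteq> J \<and> enum n w v us)"
proof (rule compatible_enum[OF npos inj_sig inj_kk])
  show "qidx n N (map ff (qlist n us gs v m)) l = kk (if l < n then us l else v)" if "l \<le> n" for l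
    using that assms by (auto simp: qidx_def qlist_nth prg_ff prh_ff less_Suc_eq simp del: ff.simps)
qed (use assms sig_I kk(2) in auto)

text \<open>A tuple of base points has parity 0, so \<open>Q\<close> has to hold there exactly when
  \<open>cc\<close> is false. By \<open>Qr_symm\<close> one enumeration \<open>us\<close> is as good
  as any other.\<close>

definition cc :: "'i set \<Rightarrow> 'i set \<Rightarrow> bool" where
  "cc v w = (\<exists>us. enum n w v us \<and> map ff (qlist n us (\<lambda>_. {}) v False) \<notin> rels N Qr)"

lemma Qr_symm:
  assumes "enum n w v us" "enum n w v us'" "map ff (qlist n us (\<lambda>_. {}) v False) \<in> rels N Qr"
  shows "map ff (qlist n us' (\<lambda>_. {}) v False) \<in> rels N Qr"
proof -
  obtain p where p: "p permutes {..<n}" "\<And>l. l < n \<Longrightarrow> us' l = us (p l)" using enum_perm[OF assms(1,2)] by blast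
  have pl: "p l < n" if "l < n" for l using permutes_in_image[OF p(1), of l] that by simp
  let ?xs = "map ff (qlist n us (\<lambda>_. {}) v False)"
  have "map (\<lambda>l. if l < n then ?xs ! p l else ?xs ! l) [0..<Suc n] = map ff (qlist n us' (\<lambda>_. {}) v False)"
    using pl p(2) unfolding list_eq_iff_nth_eq by (auto simp: qlist_nth less_Suc_eq nth_append)
  then show ?thesis using KD2(20)[rule_format, OF assms(3) p(1)] by (simp only:)
qed

lemma Qr_base:
  assumes "enum n w v us" shows "map ff (qlist n us (\<lambda>_. {}) v False) \<in> rels N Qr \<longleftrightarrow> \<not> cc v w"
  using assms Qr_symm unfolding cc_def by blast

text \<open>Every tuple over a carrier is obtained from the base points by a move, so the invariance
  axiom determines \<open>Q\<close> from its value on the base points.\<close>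

lemma Qr_ff:
  assumes ok: "\<And>l. l < n \<Longrightarrow> us l \<in> nsub n J \<and> finite (gs l) \<and> gs l \<subseteq> nsub n J" "v \<in> nsub n J"
    and e: "enum n w v us" "w \<subseteq> J"
  shows "map ff (qlist n us gs v m) \<in> rels N Qr \<longleftrightarrow> cc v w = par n (\<lambda>l. v \<in> gs l) m"
proof -
  let ?xs = "map ff (qlist n us (\<lambda>_. {}) v False)"
  have c: "compatible n N ?xs" using compat_iff[of us "\<lambda>_. {}" v False] ok e by auto
  have x1: "?xs ! l = sx (us l)" if "l < n" for l
    using that ok actg_empty[of "sx (us l)"] sx by (simp add: qlist_nth)
  have x2: "?xs ! n = sy v" using ok acth_False[of "sy v"] sy by (simp add: qlist_nth)
  have "map (\<lambda>l. if l < n then actg N (el (kk ` gs l)) (?xs ! l) else acth N (hh m) (?xs ! n)) [0..<Suc n]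
     = map ff (qlist n us gs v m)"
    unfolding map_qlist[of ff n us gs v m] by (rule map_cong[OF refl]) (auto simp: x1 x2 simp del: nth_map)
  moreover have "foldr (\<lambda>l acc. hadd N (ev N (el (kk ` gs l)) (prh N (?xs ! n))) acc) [0..<n] (hh m)
     = hh (par n (\<lambda>l. v \<in> gs l) m)"
  proof -
    have "foldr (\<lambda>l acc. hadd N (ev N (el (kk ` gs l)) (kk v)) acc) [0..<n] (hh m)
      = hh (foldr (\<lambda>l acc. (kk v \<in> kk ` gs l) \<noteq> acc) [0..<n] m)"
      using ok kkg kk by (intro foldr_hadd) auto
    also have "foldr (\<lambda>l acc. (kk v \<in> kk ` gs l) \<noteq> acc) [0..<n] m = par n (\<lambda>l. kk v \<in> kk ` gs l) m"
      by (rule par_foldr)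
    also have "\<dots> = par n (\<lambda>l. v \<in> gs l) m" using ok by (intro par_cong) (simp add: kkg_mem)
    finally show ?thesis using x2 ok by (simp add: prh_sy)
  qed
  moreover have "length ?xs = Suc n \<and> (\<forall>l<n. ?xs ! l \<in> Gs) \<and> ?xs ! n \<in> Hs \<and> compatible n N ?xs"
    using c x1 x2 sx sy ok by simp
  moreover have "(\<forall>l<n. el (kk ` gs l) \<in> G) \<and> hh m \<in> H" using ok el(1) kkg hh_H by simp
  ultimately have "(map ff (qlist n us gs v m) \<in> rels N Qr \<longleftrightarrow> ?xs \<in> rels N Qr) \<longleftrightarrow> hh (par n (\<lambda>l. v \<in> gs l) m) = z"
    using KD2(21)[THEN spec, of ?xs, THEN mp, THEN spec, of "\<lambda>l. el (kk ` gs l)", THEN spec, of "hh m", THEN mp]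
    by (simp only: simp_thms; blast)
  then show ?thesis using Qr_base[OF e(1)] hh(1) hh(2)[of _ False] by metis
qed

end

section \<open>The relations of a model in coordinates\<close>

context kcoord begin

lemma len: "xs \<in> rels N r \<Longrightarrow> length xs = arity n r" "xs \<in> rels N r \<Longrightarrow> set xs \<subseteq> dom N"
  using KD(1) by (auto simp: wf_str_def)

lemma rel_ff1: "cin n J x \<Longrightarrow> s \<in> sorts \<Longrightarrow> [ff x] \<in> rels N s \<longleftrightarrow> csort x = s"
  using ff_srt_iff[of x s] by (auto simp: srt_def)

lemma ff_srtD: "cin n J x \<Longrightarrow> ff x \<in> srt N s \<Longrightarrow> s \<in> sorts \<Longrightarrow> csort x = s"
  using ff_srt_iff by simp

lemma sorts_mem: "SI \<in> sorts" "SK \<in> sorts" "SH \<in> sorts" "SG \<in> sorts" "SGs \<in> sorts" "SHs \<in> sorts"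
  by (simp_all add: sorts_def)

lemma rel_ty:
  "[a, b] \<in> rels N Mem \<Longrightarrow> a \<in> I \<and> b \<in> K"
  "[a, b, c] \<in> rels N HAdd \<Longrightarrow> a \<in> H \<and> b \<in> H \<and> c \<in> H"
  "[a, b, c] \<in> rels N GAdd \<Longrightarrow> a \<in> G \<and> b \<in> G \<and> c \<in> G"
  "[a, b, c] \<in> rels N Ev \<Longrightarrow> a \<in> G \<and> b \<in> K \<and> c \<in> H"
  "[a, b] \<in> rels N Supp \<Longrightarrow> a \<in> G \<and> b \<in> K"
  "[a, b] \<in> rels N PrG \<Longrightarrow> a \<in> Gs \<and> b \<in> K"
  "[a, b, c] \<in> rels N ActG \<Longrightarrow> a \<in> G \<and> b \<in> Gs \<and> c \<in> Gs"
  "[a, b] \<in> rels N PrH \<Longrightarrow> a \<in> Hs \<and> b \<in> K"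
  "[a, b, c] \<in> rels N ActH \<Longrightarrow> a \<in> H \<and> b \<in> Hs \<and> c \<in> Hs"
proof -
  show "[a, b] \<in> rels N Mem \<Longrightarrow> a \<in> I \<and> b \<in> K" using KD(4) by fastforce
  show "[a, b, c] \<in> rels N HAdd \<Longrightarrow> a \<in> H \<and> b \<in> H \<and> c \<in> H" using hh(5) hh_H by fastforce
  show "[a, b, c] \<in> rels N GAdd \<Longrightarrow> a \<in> G \<and> b \<in> G \<and> c \<in> G" unfolding KD(13) by blast
  show "[a, b, c] \<in> rels N Ev \<Longrightarrow> a \<in> G \<and> b \<in> K \<and> c \<in> H" using KD(8) by fastforce
  show "[a, b] \<in> rels N Supp \<Longrightarrow> a \<in> G \<and> b \<in> K" unfolding KD(14) by blast
  show "[a, b] \<in> rels N PrG \<Longrightarrow> a \<in> Gs \<and> b \<in> K" using KD2(1) by fastforce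
  show "[a, b, c] \<in> rels N ActG \<Longrightarrow> a \<in> G \<and> b \<in> Gs \<and> c \<in> Gs" using KD2(4) by fastforce
  show "[a, b] \<in> rels N PrH \<Longrightarrow> a \<in> Hs \<and> b \<in> K" using KD2(10) by fastforce
  show "[a, b, c] \<in> rels N ActH \<Longrightarrow> a \<in> H \<and> b \<in> Hs \<and> c \<in> Hs" using KD2(13) by fastforce
qed

lemma rel_sort:
  "cin n J x \<Longrightarrow> cin n J y \<Longrightarrow> [ff x, ff y] \<in> rels N Mem \<Longrightarrow> csort x = SI \<and> csort y = SK"
  "cin n J x \<Longrightarrow> cin n J y \<Longrightarrow> cin n J t \<Longrightarrow> [ff x, ff y, ff t] \<in> rels N HAdd \<Longrightarrow> csort x = SH \<and> csort y = SH \<and> csort t = SH"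
  "cin n J x \<Longrightarrow> cin n J y \<Longrightarrow> cin n J t \<Longrightarrow> [ff x, ff y, ff t] \<in> rels N GAdd \<Longrightarrow> csort x = SG \<and> csort y = SG \<and> csort t = SG"
  "cin n J x \<Longrightarrow> cin n J y \<Longrightarrow> cin n J t \<Longrightarrow> [ff x, ff y, ff t] \<in> rels N Ev \<Longrightarrow> csort x = SG \<and> csort y = SK \<and> csort t = SH"
  "cin n J x \<Longrightarrow> cin n J y \<Longrightarrow> [ff x, ff y] \<in> rels N Supp \<Longrightarrow> csort x = SG \<and> csort y = SK"
  "cin n J x \<Longrightarrow> cin n J y \<Longrightarrow> [ff x, ff y] \<in> rels N PrG \<Longrightarrow> csort x = SGs \<and> csort y = SK"
  "cin n J x \<Longrightarrow> cin n J y \<Longrightarrow> cin n J t \<Longrightarrow> [ff x, ff y, ff t] \<in> rels N ActG \<Longrightarrow> csort x = SG \<and> csort y = SGs \<and> csort t = SGs"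
  "cin n J x \<Longrightarrow> cin n J y \<Longrightarrow> [ff x, ff y] \<in> rels N PrH \<Longrightarrow> csort x = SHs \<and> csort y = SK"
  "cin n J x \<Longrightarrow> cin n J y \<Longrightarrow> cin n J t \<Longrightarrow> [ff x, ff y, ff t] \<in> rels N ActH \<Longrightarrow> csort x = SH \<and> csort y = SHs \<and> csort t = SHs"
  using rel_ty ff_srtD sorts_mem by meson+

lemma rel_ff2:
  assumes "cin n J x" "cin n J y" "r \<in> {Mem, Supp, PrG, PrH}"
  shows "[ff x, ff y] \<in> rels N r \<longleftrightarrow> crel n cc r [x, y]"
proof -
  \<comment> \<open>Either side of the equivalence forces the sorts of the arguments, so only
    matching constructors remain to be compared.\<close>
  have ts: "\<exists>s t. s \<in> sorts \<and> t \<in> sorts \<and> csort x = s \<and> csort y = t \<and>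
     (r, s, t) \<in> {(Mem, SI, SK), (Supp, SG, SK), (PrG, SGs, SK), (PrH, SHs, SK)}"
    if "[ff x, ff y] \<in> rels N r \<or> crel n cc r [x, y]"
    using that
  proof
    assume "[ff x, ff y] \<in> rels N r"
    then show ?thesis using assms(3) rel_sort(1,5,6,8)[OF assms(1,2)] by (auto simp: sorts_def)
  next
    assume "crel n cc r [x, y]"
    then show ?thesis using assms(3) by (auto simp: crel_simps sorts_def)
  qed
  show ?thesis
  proof (cases "[ff x, ff y] \<in> rels N r \<or> crel n cc r [x, y]")
    case True
    from ts[OF True] consider
        (1) "r = Mem" "csort x = SI" "csort y = SK" | (2) "r = Supp" "csort x = SG" "csort y = SK"
      | (3) "r = PrG" "csort x = SGs" "csort y = SK" | (4) "r = PrH" "csort x = SHs" "csort y = SK" by auto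
    then show ?thesis
    proof cases
      case 1
      then obtain i u where xy: "x = CI i" "y = CK u" by (auto simp: csort_iff)
      have "[ff x, ff y] \<in> rels N r \<longleftrightarrow> \<sigma> i \<in> memb N (kk u)" using 1 xy by (simp add: memb_def)
      also have "\<dots> \<longleftrightarrow> i \<in> u" using assms xy kk(2)[of u] inj_sig
        by (auto simp: nsub_def inj_on_def subset_iff)
      finally show ?thesis using 1 xy by (simp add: crel_simps)
    next
      case 2
      then obtain g u where xy: "x = CG g" "y = CK u" by (auto simp: csort_iff)
      then show ?thesis using 2 assms kkg by (simp add: crel_simps Supp_el kkg_mem)
    next
      case 3
      then obtain g u v where xy: "x = CGs v g" "y = CK u" by (auto simp: csort_iff)
      then have "ff x \<in> Gs" using assms ff_srt[of x] by simp
      then have "[ff x, ff y] \<in> rels N r \<longleftrightarrow> kk u = kk v" using 3 xy assms prg_ff[of v g] by (auto simp: PrG_iff)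
      then show ?thesis using 3 xy assms kk_inj by (auto simp: crel_simps)
    next
      case 4
      then obtain g u v where xy: "x = CHs v g" "y = CK u" by (auto simp: csort_iff)
      then have "ff x \<in> Hs" using assms ff_srt[of x] by simp
      then have "[ff x, ff y] \<in> rels N r \<longleftrightarrow> kk u = kk v" using 4 xy assms prh_ff[of v g] by (auto simp: PrH_iff)
      then show ?thesis using 4 xy assms kk_inj by (auto simp: crel_simps)
    qed
  qed auto
qed

lemma rel_ff3:
  assumes xyz: "cin n J x" "cin n J y" "cin n J z'" and r: "r \<in> {HAdd, GAdd, Ev, ActG, ActH}"
  shows "[ff x, ff y, ff z'] \<in> rels N r \<longleftrightarrow> crel n cc r [x, y, z']"
proof -
  have ts: "(r, csort x, csort y, csort z') \<in> {(HAdd, SH, SH, SH), (GAdd, SG, SG, SG), (Ev, SG, SK, SH), (ActG, SG, SGs, SGs), (ActH, SH, SHs, SHs)}"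
    if "[ff x, ff y, ff z'] \<in> rels N r \<or> crel n cc r [x, y, z']"
    using that
  proof
    assume "[ff x, ff y, ff z'] \<in> rels N r"
    then show ?thesis using r by (elim insertE emptyE) (auto dest: rel_sort(2,3,4,7,9)[OF xyz])
  next
    assume "crel n cc r [x, y, z']"
    then show ?thesis using r by (elim insertE emptyE) (auto simp: crel_simps)
  qed
  show ?thesis
  proof (cases "[ff x, ff y, ff z'] \<in> rels N r \<or> crel n cc r [x, y, z']")
    case True
    from ts[OF True] consider
        (1) "r = HAdd" "csort x = SH" "csort y = SH" "csort z' = SH"
      | (2) "r = GAdd" "csort x = SG" "csort y = SG" "csort z' = SG"
      | (3) "r = Ev" "csort x = SG" "csort y = SK" "csort z' = SH"
      | (4) "r = ActG" "csort x = SG" "csort y = SGs" "csort z' = SGs"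
      | (5) "r = ActH" "csort x = SH" "csort y = SHs" "csort z' = SHs" by auto
    then show ?thesis
    proof cases
      case 1
      then obtain a b d where e: "x = CH a" "y = CH b" "z' = CH d" by (auto simp: csort_iff)
      show ?thesis unfolding e 1(1) ff.simps hh(4) hh(2) crel_simps by blast
    next
      case 2
      then obtain g h k where e: "x = CG g" "y = CG h" "z' = CG k" by (auto simp: csort_iff)
      then have "[ff x, ff y, ff z'] \<in> rels N r \<longleftrightarrow> kk ` k = kk ` sym_diff g h"
        using 2 xyz kkg kkg_sd by (simp add: GAdd_el)
      also have "\<dots> \<longleftrightarrow> k = sym_diff g h" using xyz e by (intro kkg_eq) auto
      finally show ?thesis using 2 e by (simp add: crel_simps)
    next
      case 3
      then obtain g u d where e: "x = CG g" "y = CK u" "z' = CH d" by (auto simp: csort_iff)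
      have "[ff x, ff y, ff z'] \<in> rels N r \<longleftrightarrow> hh d = hh (kk u \<in> kk ` g)"
        using 3 xyz kkg kk unfolding e by (simp add: Ev_el)
      also have "\<dots> \<longleftrightarrow> d = (u \<in> g)" unfolding hh(2) using xyz e by (simp add: kkg_mem)
      finally show ?thesis unfolding e 3(1) crel_simps by blast
    next
      case 4
      then obtain g u h v k where e: "x = CG g" "y = CGs u h" "z' = CGs v k" by (auto simp: csort_iff)
      have s: "sym_diff g h \<subseteq> nsub n J" "finite (sym_diff g h)" using xyz e by auto
      have a: "actg N (ff x) (ff y) = ff (CGs u (sym_diff g h))"
        using xyz e kkg sx by (simp add: actg_actg kkg_sd)
      have "ff x \<in> G" "ff y \<in> Gs" using ff_srt[OF xyz(1)] ff_srt[OF xyz(2)] e by simp_all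
      then have "[ff x, ff y, ff z'] \<in> rels N r \<longleftrightarrow> ff z' = ff (CGs u (sym_diff g h))"
        using 4 a by (simp only: ActG_iff)
      also have "\<dots> \<longleftrightarrow> z' = CGs u (sym_diff g h)"
        using inj_on_eq_iff[OF ff_inj, of z' "CGs u (sym_diff g h)"] xyz e s by simp
      finally show ?thesis using 4 e by (auto simp: crel_simps)
    next
      case 5
      then obtain g u h v k where e: "x = CH g" "y = CHs u h" "z' = CHs v k" by (auto simp: csort_iff)
      have a: "acth N (ff x) (ff y) = ff (CHs u (g \<noteq> h))"
        using xyz e sy by (simp add: acth_acth)
      have "ff x \<in> H" "ff y \<in> Hs" using ff_srt[OF xyz(1)] ff_srt[OF xyz(2)] e by simp_all
      then have "[ff x, ff y, ff z'] \<in> rels N r \<longleftrightarrow> ff z' = ff (CHs u (g \<noteq> h))"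
        using 5 a by (simp only: ActH_iff)
      also have "\<dots> \<longleftrightarrow> z' = CHs u (g \<noteq> h)"
        using inj_on_eq_iff[OF ff_inj, of z' "CHs u (g \<noteq> h)"] xyz e by simp
      finally show ?thesis using 5 e by (auto simp: crel_simps)
    qed
  qed auto
qed

lemma rel_ff_Qr:
  assumes "set xs \<subseteq> cdom n J"
  shows "map ff xs \<in> rels N Qr \<longleftrightarrow> crel n cc Qr xs"
proof -
  have ql: "\<exists>us gs v m. xs = qlist n us gs v m" if "map ff xs \<in> rels N Qr \<or> crel n cc Qr xs"
    using that
  proof
    assume q: "map ff xs \<in> rels N Qr"
    then have l: "length xs = Suc n" using len(1) by fastforce
    have c: "cin n J (xs ! l)" if "l < Suc n" for l using subsetD[OF assms nth_mem, of l] l that by simp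
    have "\<forall>l<n. ff (xs ! l) \<in> Gs" "ff (xs ! n) \<in> Hs" using KD2(19)[rule_format, OF q] l by auto
    then have "\<forall>l<n. csort (xs ! l) = SGs" "csort (xs ! n) = SHs"
      using c ff_srtD[OF c _ sorts_mem(5)] ff_srtD[OF c _ sorts_mem(6)] by simp_all
    then have "\<forall>l. \<exists>u g. l < n \<longrightarrow> xs ! l = CGs u g" "\<exists>v m. xs ! n = CHs v m" by (auto simp: csort_iff)
    then obtain us gs v m where "\<And>l. l < n \<Longrightarrow> xs ! l = CGs (us l) (gs l)" "xs ! n = CHs v m" by metis
    then have "xs = qlist n us gs v m" using l by (auto simp: list_eq_iff_nth_eq qlist_nth less_Suc_eq)
    then show ?thesis by blast
  next
    assume "crel n cc Qr xs" then show ?thesis unfolding crel_Qr by blast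
  qed
  show ?thesis
  proof (cases "\<exists>us gs v m. xs = qlist n us gs v m")
    case True
    then obtain us gs v m where x: "xs = qlist n us gs v m" by blast
    then have ok: "\<And>l. l < n \<Longrightarrow> us l \<in> nsub n J \<and> finite (gs l) \<and> gs l \<subseteq> nsub n J" "v \<in> nsub n J"
      using assms by (auto simp: set_qlist)
    show ?thesis
    proof (cases "\<exists>w. enum n w v us")
      case True
      then obtain w where w: "enum n w v us" by blast
      have "w = \<Union>(insert v (us ` {..<n}))" using w npos enum_eq[of n w v us] unfolding enum_def by blast
      then have "w \<subseteq> J" using ok by (auto simp: nsub_def)
      then show ?thesis unfolding x using Qr_ff[OF ok w] crel_Qr_qlist[OF npos w] by simp
    next
      case False
      have "\<not> compatible n N (map ff xs)" using compat_iff[of us gs v m] ok False x by blast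
      moreover have "\<not> crel n cc Qr xs"
      proof
        assume "crel n cc Qr xs"
        then obtain us' gs' v' m' w where w: "xs = qlist n us' gs' v' m'" "enum n w v' us'" unfolding crel_Qr by blast
        have "enum n w v us" using w enum_cong[of n us us' w v] unfolding x qlist_eq_iff by simp
        then show False using False by blast
      qed
      ultimately show ?thesis using KD2(19) by blast
    qed
  qed (use ql in blast)
qed

lemma rel_ff:
  assumes "set xs \<subseteq> cdom n J"
  shows "map ff xs \<in> rels N r \<longleftrightarrow> crel n cc r xs"
proof (cases "r = Qr")
  case False
  have lc: "length xs = arity n r" if "crel n cc r xs" using that False by (cases r) (auto simp: crel_simps)
  show ?thesis
  proof (cases "length xs = arity n r")
    case True
    consider "r \<in> sorts" | "r \<in> {Mem, Supp, PrG, PrH}" | "r \<in> {HAdd, GAdd, Ev, ActG, ActH}"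
      using False by (cases r) (auto simp: sorts_def)
    then show ?thesis
    proof cases
      case 1
      then obtain x where "xs = [x]" using True by (auto simp: sorts_def length_Suc_conv)
      then show ?thesis using 1 assms rel_ff1[of x r] by (auto simp: sorts_def crel_simps csort_iff)
    next
      case 2
      then obtain x y where "xs = [x, y]" using True by (auto simp: length_Suc_conv numeral_2_eq_2)
      then show ?thesis using 2 assms rel_ff2[of x y r] by simp
    next
      case 3
      then obtain x y y' where "xs = [x, y, y']" using True by (auto simp: length_Suc_conv numeral_3_eq_3)
      then show ?thesis using 3 assms rel_ff3[of x y y' r] by simp
    qed
  next
    case False
    then show ?thesis using lc len(1)[of "map ff xs" r] by auto
  qed
qed (use rel_ff_Qr assms in simp)

text \<open>The image is closed under supports because the set \<open>g\<close> in a cell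
  \<open>CG g\<close> consists of stalks over \<open>J\<close>, whose cells \<open>CK\<close> are in
  the image as well.\<close>

lemma csub_ff: "csub n (mimg ff (cstr n J cc)) N"
proof -
  interpret C: coord n ff J cc by unfold_locales (use npos ff_inj in auto)
  have s: "set xs \<subseteq> ff ` cdom n J \<Longrightarrow> \<exists>ys. xs = map ff ys \<and> set ys \<subseteq> cdom n J" for xs
  proof -
    assume "set xs \<subseteq> ff ` cdom n J"
    then have "xs \<in> lists (ff ` cdom n J)" by auto
    then show ?thesis unfolding lists_image by auto
  qed
  have "rels C.M r = {xs \<in> rels N r. set xs \<subseteq> dom C.M}" for r
  proof (intro set_eqI iffI)
    fix xs assume "xs \<in> rels C.M r"
    then obtain ys where ys: "xs = map ff ys" "crel n cc r ys" "set ys \<subseteq> cdom n J" by (rule C.relE)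
    then have "xs \<in> rels N r" using rel_ff by blast
    moreover have "set xs \<subseteq> ff ` cdom n J" unfolding ys(1) set_map using image_mono[OF ys(3)] .
    ultimately show "xs \<in> {xs \<in> rels N r. set xs \<subseteq> dom C.M}" by simp
  next
    fix xs assume a: "xs \<in> {xs \<in> rels N r. set xs \<subseteq> dom C.M}"
    then obtain ys where "xs = map ff ys" "set ys \<subseteq> cdom n J" using s[of xs] by auto
    then show "xs \<in> rels C.M r" using a C.rel_iff rel_ff by blast
  qed
  moreover have "u \<in> dom C.M" if gu: "[g, u] \<in> rels N Supp" "g \<in> dom C.M" for g u
  proof -
    obtain x where x: "cin n J x" "g = ff x" using gu(2) by auto
    then obtain h where h: "x = CG h" using rel_ty(5)[OF gu(1)] ff_srtD[of x SG] sorts_mem by (auto simp: csort_iff)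
    then have "u \<in> kk ` h" using gu(1) x Supp_el kkg by simp
    then obtain v where "v \<in> h" "u = ff (CK v)" by auto
    then show ?thesis using x h by (auto simp del: ff.simps intro!: imageI)
  qed
  ultimately show ?thesis unfolding csub_def using C.Kn_M Kn ff_dom by auto
qed

end

text \<open>All choices of base points below go through this lemma. \<open>\<sigma>\<close> need not
  be onto the indices of \<open>N\<close>; the coordinates then describe the submodel spanned by its
  image, which is what back-and-forth needs.\<close>

lemma coords_exist:
  fixes \<sigma> :: "'i \<Rightarrow> 'u"
  assumes "0 < n" "Kn n N" "inj_on \<sigma> J" "\<And>i. i \<in> J \<Longrightarrow> \<sigma> i \<in> srt N SI"
    "\<And>u. u \<in> nsub n J \<Longrightarrow> sx u \<in> srt N SGs \<and> memb N (prg N (sx u)) = \<sigma> ` u"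
    "\<And>u. u \<in> nsub n J \<Longrightarrow> sy u \<in> srt N SHs \<and> memb N (prh N (sy u)) = \<sigma> ` u"
  shows "\<exists>f c. inj_on f (cdom n J) \<and> csub n (mimg f (cstr n J c)) N \<and> (\<forall>i\<in>J. f (CI i) = \<sigma> i) \<and>
     (\<forall>u\<in>nsub n J. f (CGs u {}) = sx u \<and> f (CHs u False) = sy u) \<and>
     (\<sigma> ` J = srt N SI \<longrightarrow> mimg f (cstr n J c) = N)"
proof -
  interpret kcoord n N J \<sigma> sx sy by unfold_locales (use assms in auto)
  have "mimg ff (cstr n J cc) = N" if "\<sigma> ` J = srt N SI"
  proof -
    have d: "dom (mimg ff (cstr n J cc)) = dom N" using ff_surj[OF that] by simp
    then have "rels (mimg ff (cstr n J cc)) r = rels N r" for r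
      using csub_ff len(2) unfolding csub_def d by blast
    then show ?thesis using d by (intro str.equality) auto
  qed
  then show ?thesis using ff_inj csub_ff sx sy actg_empty acth_False
    by (intro exI[of _ ff] exI[of _ cc]) simp
qed

section \<open>Comparing coordinates\<close>

lemma Kn_wf: "Kn n M \<Longrightarrow> xs \<in> rels M r \<Longrightarrow> length xs = arity n r \<and> set xs \<subseteq> dom M"
proof -
  assume "Kn n M" and x: "xs \<in> rels M r"
  then have "wf_str n M" unfolding Kn_def Let_def by (elim conjE)
  then show ?thesis using x by (simp add: wf_str_def)
qed

lemma csub_rel: "csub n M N \<Longrightarrow> set xs \<subseteq> dom M \<Longrightarrow> xs \<in> rels M r \<longleftrightarrow> xs \<in> rels N r"
  by (auto simp: csub_def)

lemma csub_dom: "csub n M N \<Longrightarrow> dom M \<subseteq> dom N"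
  and csub_Kn: "csub n M N \<Longrightarrow> Kn n M" "csub n M N \<Longrightarrow> Kn n N"
  by (simp_all add: csub_def)

lemma csub_refl: assumes "Kn n M" shows "csub n M M"
proof -
  have "rels M r = {xs \<in> rels M r. set xs \<subseteq> dom M}" for r 
    by (intro set_eqI) (metis (no_types, lifting) Kn_wf[OF assms] mem_Collect_eq)
  moreover have "u \<in> dom M" if "[g, u] \<in> rels M Supp" for g u using Kn_wf[OF assms that] by simp
  ultimately show ?thesis unfolding csub_def using assms by blast
qed

lemma csubI:
  assumes "Kn n M" "Kn n N" "dom M \<subseteq> dom N"
    "\<And>xs r. set xs \<subseteq> dom M \<Longrightarrow> xs \<in> rels M r \<longleftrightarrow> xs \<in> rels N r"
    "\<And>g u. [g, u] \<in> rels N Supp \<Longrightarrow> g \<in> dom M \<Longrightarrow> u \<in> dom M"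
  shows "csub n M N"
proof -
  have "rels M r = {xs \<in> rels N r. set xs \<subseteq> dom M}" for r
    using assms(4) Kn_wf[OF assms(1)] by (intro set_eqI) (metis (no_types, lifting) mem_Collect_eq)
  then show ?thesis unfolding csub_def using assms(1,2,3,5) by simp
qed

lemma csub_supp: "csub n M N \<Longrightarrow> [g, u] \<in> rels N Supp \<Longrightarrow> g \<in> dom M \<Longrightarrow> u \<in> dom M"
  by (simp add: csub_def)

lemma csub_trans:
  assumes "csub n M N" "csub n N P" shows "csub n M P"
proof (rule csubI)
  show "xs \<in> rels M r \<longleftrightarrow> xs \<in> rels P r" if "set xs \<subseteq> dom M" for xs r
    using csub_rel[OF assms(1) that] csub_rel[OF assms(2)] csub_dom[OF assms(1)] that by blast
  show "u \<in> dom M" if "[g, u] \<in> rels P Supp" "g \<in> dom M" for g u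
  proof -
    have g: "g \<in> dom N" using that csub_dom[OF assms(1)] by blast
    then have "u \<in> dom N" using csub_supp[OF assms(2) that(1)] by simp
    then have "[g, u] \<in> rels N Supp" using csub_rel[OF assms(2), of "[g, u]"] that g by simp
    then show ?thesis using csub_supp[OF assms(1)] that by simp
  qed
qed (use assms csub_dom csub_Kn in blast)+

lemma csub_between:
  assumes "csub n X Z" "csub n Y Z" "dom X \<subseteq> dom Y" shows "csub n X Y"
proof (rule csubI)
  show "xs \<in> rels X r \<longleftrightarrow> xs \<in> rels Y r" if "set xs \<subseteq> dom X" for xs r
    using csub_rel[OF assms(1) that] csub_rel[OF assms(2)] assms(3) that by blast
  show "u \<in> dom X" if "[g, u] \<in> rels Y Supp" "g \<in> dom X" for g u
  proof -
    have "[g, u] \<in> rels Z Supp"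
      using csub_rel[OF assms(2), of "[g, u]"] that Kn_wf[OF csub_Kn(1)[OF assms(2)] that(1)] by simp
    then show ?thesis using csub_supp[OF assms(1)] that by simp
  qed
qed (use assms csub_dom csub_Kn in blast)+

lemma csub_srt: "csub n M N \<Longrightarrow> srt M s = srt N s \<inter> dom M"
  unfolding csub_def srt_def by auto

lemma csub_antisym: assumes "csub n M N" "dom M = dom N" shows "M = N"
proof -
  have "rels M r = rels N r" for r
    using assms Kn_wf[OF csub_Kn(2)[OF assms(1)]] unfolding csub_def
    by (intro set_eqI) (metis (no_types, lifting) mem_Collect_eq)
  then show ?thesis using assms(2) by (intro str.equality) auto
qed

definition crd :: "nat \<Rightarrow> ('i cel \<Rightarrow> 'u) \<Rightarrow> 'i set \<Rightarrow> ('i set \<Rightarrow> 'i set \<Rightarrow> bool) \<Rightarrow> 'u str \<Rightarrow> bool" where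
  "crd n f J c M = (inj_on f (cdom n J) \<and> M = mimg f (cstr n J c))"

lemma crd_coord: "0 < n \<Longrightarrow> crd n f J c M \<Longrightarrow> coord n f J"
  by (simp add: crd_def coord_def)

lemma crd_Kn: "0 < n \<Longrightarrow> crd n f J c M \<Longrightarrow> Kn n M"
  using coord.Kn_M[OF crd_coord] by (metis crd_def)

lemma crd_dom: "crd n f J c M \<Longrightarrow> dom M = f ` cdom n J"
  by (simp add: crd_def)

lemma crd_SI: "0 < n \<Longrightarrow> crd n f J c M \<Longrightarrow> srt M SI = (\<lambda>i. f (CI i)) ` J"
proof -
  assume a: "0 < n" "crd n f J c M"
  show ?thesis using coord.srt_M(1)[OF crd_coord[OF a], of c] a(2) by (auto simp: crd_def)
qed

section \<open>Coordinates of a submodel, computed in the larger model\<close>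

locale crd_in = kmodel n N for n and N :: "'u str" +
  fixes f :: "'i cel \<Rightarrow> 'u" and J c
  assumes inj: "inj_on f (cdom n J)" and sub: "csub n (mimg f (cstr n J c)) N"
begin

sublocale C: coord n f J c by unfold_locales (use npos inj in auto)

lemma relN: "set xs \<subseteq> cdom n J \<Longrightarrow> map f xs \<in> rels N r \<longleftrightarrow> crel n c r xs"
  using C.rel_iff[of xs r] csub_rel[OF sub, of "map f xs" r] by (metis C.rel_iff dom_cstr dom_mimg image_mono set_map)

lemma relN1: "cin n J x \<Longrightarrow> [f x] \<in> rels N r \<longleftrightarrow> crel n c r [x]"
  using relN[of "[x]" r] by simp
lemma relN2: "cin n J x \<Longrightarrow> cin n J y \<Longrightarrow> [f x, f y] \<in> rels N r \<longleftrightarrow> crel n c r [x, y]"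
  using relN[of "[x, y]" r] by simp
lemma relN3: "cin n J x \<Longrightarrow> cin n J y \<Longrightarrow> cin n J t \<Longrightarrow> [f x, f y, f t] \<in> rels N r \<longleftrightarrow> crel n c r [x, y, t]"
  using relN[of "[x, y, t]" r] by simp

lemma srtN:
  "i \<in> J \<Longrightarrow> f (CI i) \<in> I"
  "u \<in> nsub n J \<Longrightarrow> f (CK u) \<in> K"
  "f (CH b) \<in> H"
  "finite g \<Longrightarrow> g \<subseteq> nsub n J \<Longrightarrow> f (CG g) \<in> G"
  "u \<in> nsub n J \<Longrightarrow> finite g \<Longrightarrow> g \<subseteq> nsub n J \<Longrightarrow> f (CGs u g) \<in> Gs"
  "u \<in> nsub n J \<Longrightarrow> f (CHs u m) \<in> Hs"
  by (simp_all add: srt_def relN1 crel_simps)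

lemma injI: "inj_on (\<lambda>i. f (CI i)) J"
  by (auto simp: inj_on_def C.f_eq)

text \<open>The members known in the submodel are still members in \<open>N\<close>, and both sets
  have \<open>n\<close> elements, so none can be added.\<close>

lemma f_CK: "u \<in> nsub n J \<Longrightarrow> memb N (f (CK u)) = (\<lambda>i. f (CI i)) ` u"
proof -
  assume u: "u \<in> nsub n J"
  then have uJ: "u \<subseteq> J" "finite u" "card u = n" by (auto simp: nsub_def)
  have "(\<lambda>i. f (CI i)) ` u \<subseteq> memb N (f (CK u))" using u uJ by (auto simp: memb_def relN2 crel_simps)
  moreover have "finite (memb N (f (CK u))) \<and> card (memb N (f (CK u))) = n" using KD(5) srtN(2)[OF u] by blast
  moreover have "card ((\<lambda>i. f (CI i)) ` u) = n" using inj_on_subset[OF injI uJ(1)] uJ by (simp add: card_image)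
  ultimately show ?thesis by (metis card_subset_eq)
qed

text \<open>The zero of \<open>H\<close> is its only idempotent, so \<open>b\<close> can be read off
  from whether the element added to itself gives itself.\<close>

lemma f_CH: "f (CH b) = hh b"
proof -
  obtain a where a: "f (CH b) = hh a" using srtN(3)[of b] hh(3) by blast
  have "[f (CH b), f (CH b), f (CH b)] \<in> rels N HAdd \<longleftrightarrow> \<not> b" by (auto simp: relN3 crel_simps)
  then have "hh a = hh (a \<noteq> a) \<longleftrightarrow> \<not> b" unfolding a hh(4) .
  then show ?thesis unfolding a hh(2) by blast
qed

lemma fK_sub: "g \<subseteq> nsub n J \<Longrightarrow> (\<lambda>u. f (CK u)) ` g \<subseteq> K"
  using srtN(2) by auto

text \<open>Closure under supports is needed here: otherwise the support of \<open>f (CG g)\<close>,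
  computed in \<open>N\<close>, could contain stalks outside the submodel.\<close>

lemma f_CG: "finite g \<Longrightarrow> g \<subseteq> nsub n J \<Longrightarrow> f (CG g) = el ((\<lambda>u. f (CK u)) ` g)"
proof -
  assume g: "finite g" "g \<subseteq> nsub n J"
  obtain S where S: "finite S" "S \<subseteq> K" "f (CG g) = el S" using srtN(4)[OF g] el_surj by blast
  have s: "u \<in> S \<longleftrightarrow> [f (CG g), u] \<in> rels N Supp" for u using Supp_el[OF S(1,2)] S(3) by simp
  have "S = (\<lambda>u. f (CK u)) ` g"
  proof (intro set_eqI iffI)
    fix u assume u: "u \<in> S"
    have "f (CG g) \<in> f ` cdom n J" using g by (intro imageI) simp
    then have "u \<in> dom C.M" using s u sub unfolding csub_def by simp
    moreover have "u \<in> K" using S u by blast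
    ultimately have "u \<in> srt C.M SK" using csub_srt[OF sub, of SK] by blast
    then obtain v where v: "u = f (CK v)" "v \<in> nsub n J" by (auto simp: C.srt_M)
    have "v \<in> g" using s u v g by (simp add: relN2 crel_simps)
    then show "u \<in> (\<lambda>u. f (CK u)) ` g" using v by blast
  next
    fix u assume "u \<in> (\<lambda>u. f (CK u)) ` g"
    then obtain v where v: "u = f (CK v)" "v \<in> g" by blast
    moreover have "v \<in> nsub n J" using v g by blast
    ultimately show "u \<in> S" using g by (simp add: s relN2 crel_simps)
  qed
  then show ?thesis using S by simp
qed

lemma f_CGs: "u \<in> nsub n J \<Longrightarrow> finite g \<Longrightarrow> g \<subseteq> nsub n J \<Longrightarrow> f (CGs u g) = actg N (f (CG g)) (f (CGs u {}))"
proof -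
  assume g: "u \<in> nsub n J" "finite g" "g \<subseteq> nsub n J"
  then have "[f (CG g), f (CGs u {}), f (CGs u g)] \<in> rels N ActG" by (simp add: relN3 crel_simps)
  moreover have "f (CG g) \<in> G" "f (CGs u {}) \<in> Gs" using g srtN by simp_all
  ultimately show ?thesis by (simp add: ActG_iff)
qed

lemma f_CHs: "u \<in> nsub n J \<Longrightarrow> f (CHs u m) = acth N (hh m) (f (CHs u False))"
proof -
  assume g: "u \<in> nsub n J"
  then have "[f (CH m), f (CHs u False), f (CHs u m)] \<in> rels N ActH" by (auto simp add: relN3 crel_simps)
  moreover have "f (CH m) \<in> H" "f (CHs u False) \<in> Hs" using g srtN by simp_all
  ultimately show ?thesis by (simp add: ActH_iff f_CH)
qed

lemma prg_f: "u \<in> nsub n J \<Longrightarrow> finite g \<Longrightarrow> g \<subseteq> nsub n J \<Longrightarrow> prg N (f (CGs u g)) = f (CK u)"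
  using PrG_iff[of "f (CGs u g)" "f (CK u)"] srtN by (simp add: relN2 crel_simps)

lemma prh_f: "u \<in> nsub n J \<Longrightarrow> prh N (f (CHs u m)) = f (CK u)"
  using PrH_iff[of "f (CHs u m)" "f (CK u)"] srtN by (simp add: relN2 crel_simps)

lemma fK_inj: "inj_on (\<lambda>u. f (CK u)) (nsub n J)"
  by (auto simp: inj_on_def C.f_eq)

end

text \<open>Once two coordinate maps agree on indices they agree on the cells \<open>CK\<close>,
  \<open>CH\<close> and \<open>CG\<close>, which are determined by the indices. Only the base
  points, and with them \<open>c\<close>, can differ.\<close>

locale crd_pair = A: crd_in n N f J c + B: crd_in n N F L C
  for n and N :: "'u str" and f F :: "'i cel \<Rightarrow> 'u" and J L c C +
  assumes JL: "J \<subseteq> L" and CI: "\<And>i. i \<in> J \<Longrightarrow> f (CI i) = F (CI i)"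
begin

lemma nJL: "u \<in> nsub n J \<Longrightarrow> u \<in> nsub n L"
  using nsub_mono[OF JL] by blast

lemma gJL: "g \<subseteq> nsub n J \<Longrightarrow> g \<subseteq> nsub n L"
  using nsub_mono[OF JL] by blast

lemma CK: "u \<in> nsub n J \<Longrightarrow> f (CK u) = F (CK u)"
proof -
  assume u: "u \<in> nsub n J"
  have "memb N (f (CK u)) = memb N (F (CK u))"
    unfolding A.f_CK[OF u] B.f_CK[OF nJL[OF u]] using CI u by (intro image_cong) (auto simp: nsub_def)
  then show ?thesis using A.KD(6) A.srtN(2)[OF u] B.srtN(2)[OF nJL[OF u]] by (meson inj_onD)
qed

lemma CH: "f (CH b) = F (CH b)"
  by (simp add: A.f_CH B.f_CH)

lemma CG: "finite g \<Longrightarrow> g \<subseteq> nsub n J \<Longrightarrow> f (CG g) = F (CG g)"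
proof -
  assume g: "finite g" "g \<subseteq> nsub n J"
  have "(\<lambda>u. f (CK u)) ` g = (\<lambda>u. F (CK u)) ` g" using g CK by (intro image_cong) auto
  then show ?thesis using A.f_CG[OF g] B.f_CG[OF g(1) gJL[OF g(2)]] by simp
qed


text \<open>Since the action is additive, a shift of the base point shifts every point of the stalk
  by the same amount.\<close>

lemma shift_CGs:
  assumes "u \<in> nsub n J" "finite \<gamma>" "\<gamma> \<subseteq> nsub n L" "f (CGs u {}) = F (CGs u \<gamma>)"
    "finite g" "g \<subseteq> nsub n J"
  shows "f (CGs u g) = F (CGs u (sym_diff g \<gamma>))"
proof -
  let ?k = "\<lambda>g. (\<lambda>u. F (CK u)) ` g"
  have gL: "g \<subseteq> nsub n L" using assms gJL by blast
  have uL: "u \<in> nsub n L" using assms nJL by blast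
  have s: "sym_diff (?k g) (?k \<gamma>) = ?k (sym_diff g \<gamma>)"
    using inj_on_image_set_diff[OF B.fK_inj, of g \<gamma>] inj_on_image_set_diff[OF B.fK_inj, of \<gamma> g] gL assms
    by (simp add: image_Un le_infI1 Diff_eq)
  have sL: "sym_diff g \<gamma> \<subseteq> nsub n L" using gL assms by auto
  have "f (CGs u g) = actg N (F (CG g)) (F (CGs u \<gamma>))"
    using A.f_CGs[of u g] CG[of g] assms by simp
  also have "\<dots> = actg N (A.el (?k g)) (actg N (A.el (?k \<gamma>)) (F (CGs u {})))"
    using B.f_CG[OF assms(5) gL] B.f_CG[OF assms(2,3)] B.f_CGs[OF uL assms(2,3)] by simp
  also have "\<dots> = actg N (A.el (?k (sym_diff g \<gamma>))) (F (CGs u {}))"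
    unfolding s[symmetric] using assms gL uL B.fK_sub B.srtN(5) by (intro A.actg_actg) auto
  also have "\<dots> = F (CGs u (sym_diff g \<gamma>))"
    using B.f_CG[OF _ sL] B.f_CGs[OF uL _ sL] assms by simp
  finally show ?thesis .
qed

lemma shift_CHs:
  assumes "u \<in> nsub n J" "f (CHs u False) = F (CHs u \<mu>)"
  shows "f (CHs u m) = F (CHs u (m \<noteq> \<mu>))"
  using A.f_CHs[OF assms(1), of m] B.f_CHs[OF nJL[OF assms(1)]] assms(2)
    A.acth_acth[OF B.srtN(6)[OF nJL[OF assms(1)], of False], of m \<mu>] by metis

text \<open>The effect on \<open>c\<close> of moving the base points by \<open>\<gamma>\<close> and \<open>\<mu>\<close>.\<close>
lemma base_change:
  assumes \<gamma>: "\<And>u. u \<in> nsub n J \<Longrightarrow> finite (\<gamma> u) \<and> \<gamma> u \<subseteq> nsub n L \<and> f (CGs u {}) = F (CGs u (\<gamma> u))"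
    and \<mu>: "\<And>u. u \<in> nsub n J \<Longrightarrow> f (CHs u False) = F (CHs u (\<mu> u))"
    and w: "w \<in> nsub (Suc n) J" "v \<in> nsub n w"
  shows "c v w = (C v w \<noteq> (odd (card {u \<in> nsub n w - {v}. v \<in> \<gamma> u}) \<noteq> \<mu> v))"
proof -
  have "finite w" "card w = Suc n" using w(1) by (simp_all add: nsub_def)
  then obtain us where e: "enum n w v us" using enum_exists w(2) by blast
  have b: "bij_betw us {..<n} (nsub n w - {v})" using e by (simp add: enum_def)
  have wJ: "nsub n w \<subseteq> nsub n J" using w by (intro nsub_mono) (simp add: nsub_def)
  have us: "us l \<in> nsub n J" if "l < n" for l using bij_betwE[OF b] that wJ by blast
  have v: "v \<in> nsub n J" using w wJ by blast
  \<comment> \<open>One tuple seen in two ways: it consists of base points of \<open>f\<close>, and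
    of base points of \<open>F\<close> moved by \<open>\<gamma>\<close> and \<open>\<mu>\<close>.
    Evaluating \<open>Q\<close> in both coordinate systems yields the formula.\<close>
  have "map f (qlist n us (\<lambda>_. {}) v False) = map F (qlist n us (\<lambda>l. \<gamma> (us l)) v (\<mu> v))"
    unfolding map_qlist using us v \<gamma> \<mu> by (intro map_cong) auto
  moreover have "map f (qlist n us (\<lambda>_. {}) v False) \<in> rels N Qr \<longleftrightarrow> c v w = par n (\<lambda>l. False) False"
    using us v by (subst A.relN) (auto simp: set_qlist crel_Qr_qlist[OF A.npos e])
  moreover have "map F (qlist n us (\<lambda>l. \<gamma> (us l)) v (\<mu> v)) \<in> rels N Qr \<longleftrightarrow> C v w = par n (\<lambda>l. v \<in> \<gamma> (us l)) (\<mu> v)"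
    using us v nJL \<gamma> by (subst B.relN) (auto simp: set_qlist crel_Qr_qlist[OF A.npos e])
  moreover have "par n (\<lambda>l. False) False = False" by (simp add: par_def)
  ultimately show ?thesis using par_bij[OF b, of "\<lambda>u. v \<in> \<gamma> u" "\<mu> v"] by auto
qed

end

lemma cstr_cong:
  assumes "0 < n" "\<And>v w. w \<in> nsub (Suc n) J \<Longrightarrow> v \<in> nsub n w \<Longrightarrow> c v w = C v w"
  shows "cstr n J c = cstr n J C"
proof -
  have "crel n c r xs \<longleftrightarrow> crel n C r xs" if s: "set xs \<subseteq> cdom n J" for r xs
  proof (cases "r = Qr")
    case True
    have *: "c v w = C v w" if e: "enum n w v us" and q: "xs = qlist n us gs v m" for us gs v m w
    proof -
      have "w = \<Union>(insert v (us ` {..<n}))" using e assms(1) enum_eq[of n w v us] unfolding enum_def by blast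
      moreover have "v \<in> nsub n J" "\<And>l. l < n \<Longrightarrow> us l \<in> nsub n J" using s unfolding q by (auto simp: set_qlist)
      ultimately have "w \<subseteq> J" by (auto simp: nsub_def)
      then show ?thesis using e by (intro assms(2)) (auto simp: enum_def nsub_def)
    qed
    show ?thesis unfolding True crel_Qr using * by metis
  next
    case False
    then show ?thesis by (cases r) (simp_all add: crel_simps)
  qed
  then show ?thesis unfolding cstr_def by auto
qed

lemma mimg_cong: "(\<And>x. x \<in> cdom n J \<Longrightarrow> f x = g x) \<Longrightarrow> mimg f (cstr n J c) = mimg g (cstr n J c)"
proof -
  assume a: "\<And>x. x \<in> cdom n J \<Longrightarrow> f x = g x"
  then have "map f xs = map g xs" if "set xs \<subseteq> cdom n J" for xs using that by (intro map_cong) auto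
  then have "map f ` rels (cstr n J c) r = map g ` rels (cstr n J c) r" for r
    by (intro image_cong) (auto simp: rels_cstr)
  moreover have "f ` cdom n J = g ` cdom n J" using a by (intro image_cong) auto
  ultimately show ?thesis by (simp add: mimg_def)
qed

context crd_pair begin

lemma agree:
  assumes "\<And>u. u \<in> nsub n J \<Longrightarrow> f (CGs u {}) = F (CGs u {})"
    "\<And>u. u \<in> nsub n J \<Longrightarrow> f (CHs u False) = F (CHs u False)"
  shows "\<And>x. x \<in> cdom n J \<Longrightarrow> f x = F x" "mimg F (cstr n J C) = mimg f (cstr n J c)"
proof -
  show *: "f x = F x" if "x \<in> cdom n J" for x
  proof (cases x)
    case (CGs u g) then show ?thesis using that assms(1) shift_CGs[of u "{}" g] by simp
  next
    case (CHs u m) then show ?thesis using that assms(2) shift_CHs[of u False m] by simp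
  qed (use that CI CK CH CG in auto)
  have "cstr n J c = cstr n J C"
  proof (rule cstr_cong[OF A.npos])
    show "c v w = C v w" if "w \<in> nsub (Suc n) J" "v \<in> nsub n w" for v w
      using base_change[of "\<lambda>_. {}" "\<lambda>_. False" w v] assms that by simp
  qed
  then show "mimg F (cstr n J C) = mimg f (cstr n J c)" using mimg_cong[of n J f F c] * by simp
qed

end

section \<open>Extending coordinates of submodels\<close>

lemma sections_exist:
  assumes "0 < n" "Kn n N" "w \<subseteq> srt N SI" "finite w" "card w = n"
  shows "\<exists>x. x \<in> srt N SGs \<and> memb N (prg N x) = w" "\<exists>y. y \<in> srt N SHs \<and> memb N (prh N y) = w"
proof -
  interpret kmodel n N by unfold_locales (use assms in auto)
  obtain k where "k \<in> K" "memb N k = w" using KD(7) assms by blast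
  then show "\<exists>x. x \<in> srt N SGs \<and> memb N (prg N x) = w" "\<exists>y. y \<in> srt N SHs \<and> memb N (prh N y) = w"
    using KD2(3,12) by metis+
qed

lemma crd_srt_sections:
  assumes "0 < n" "crd n f J c M" "csub n M N" "u \<in> nsub n J"
  shows "f (CGs u {}) \<in> srt N SGs" "memb N (prg N (f (CGs u {}))) = (\<lambda>i. f (CI i)) ` u"
    "f (CHs u False) \<in> srt N SHs" "memb N (prh N (f (CHs u False))) = (\<lambda>i. f (CI i)) ` u"
proof -
  interpret crd_in n N f J c
    by unfold_locales (use assms csub_Kn in \<open>auto simp: crd_def\<close>)
  show "f (CGs u {}) \<in> srt N SGs" "memb N (prg N (f (CGs u {}))) = (\<lambda>i. f (CI i)) ` u"
    "f (CHs u False) \<in> srt N SHs" "memb N (prh N (f (CHs u False))) = (\<lambda>i. f (CI i)) ` u"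
    using assms(4) srtN prg_f prh_f f_CK by simp_all
qed

text \<open>Base points are taken from \<open>f1\<close> on \<open>n\<close>-sets inside
  \<open>J1\<close>, from \<open>f2\<close> on the remaining ones inside \<open>J2\<close>, and
  arbitrarily elsewhere. An \<open>n\<close>-set inside both lies in the intersection, where the two
  choices agree. Applied with the same submodel twice, the lemma extends coordinates of a single
  submodel.\<close>

lemma ext_coords:
  fixes f1 f2 :: "'i cel \<Rightarrow> 'u"
  assumes n: "0 < n" and M1: "crd n f1 J1 c1 M1" "csub n M1 N" and M2: "crd n f2 J2 c2 M2" "csub n M2 N"
    and ag: "\<And>x. x \<in> cdom n (J1 \<inter> J2) \<Longrightarrow> f1 x = f2 x"
    and J: "J1 \<subseteq> J" "J2 \<subseteq> J" "inj_on \<sigma> J" "\<And>i. i \<in> J \<Longrightarrow> \<sigma> i \<in> srt N SI"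
      "\<And>i. i \<in> J1 \<Longrightarrow> \<sigma> i = f1 (CI i)" "\<And>i. i \<in> J2 \<Longrightarrow> \<sigma> i = f2 (CI i)"
  shows "\<exists>f c. inj_on f (cdom n J) \<and> csub n (mimg f (cstr n J c)) N \<and> (\<forall>i\<in>J. f (CI i) = \<sigma> i) \<and>
     (\<forall>x\<in>cdom n J1. f x = f1 x) \<and> (\<forall>x\<in>cdom n J2. f x = f2 x) \<and>
     mimg f (cstr n J1 c) = M1 \<and> mimg f (cstr n J2 c) = M2 \<and>
     (\<sigma> ` J = srt N SI \<longrightarrow> mimg f (cstr n J c) = N)"
proof -
  define sx where "sx u = (if u \<subseteq> J1 then f1 (CGs u {}) else if u \<subseteq> J2 then f2 (CGs u {})
     else SOME x. x \<in> srt N SGs \<and> memb N (prg N x) = \<sigma> ` u)" for u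
  define sy where "sy u = (if u \<subseteq> J1 then f1 (CHs u False) else if u \<subseteq> J2 then f2 (CHs u False)
     else SOME x. x \<in> srt N SHs \<and> memb N (prh N x) = \<sigma> ` u)" for u
  have N: "Kn n N" using M1(2) csub_Kn by blast
  have s: "(sx u \<in> srt N SGs \<and> memb N (prg N (sx u)) = \<sigma> ` u) \<and> (sy u \<in> srt N SHs \<and> memb N (prh N (sy u)) = \<sigma> ` u)"
    if u: "u \<in> nsub n J" for u
  proof -
    consider "u \<subseteq> J1" | "\<not> u \<subseteq> J1" "u \<subseteq> J2" | "\<not> u \<subseteq> J1" "\<not> u \<subseteq> J2" by blast
    then show ?thesis
    proof cases
      case 1
      then have "u \<in> nsub n J1" using u by (simp add: nsub_def)
      moreover have "\<sigma> ` u = (\<lambda>i. f1 (CI i)) ` u" using 1 J(5) by (intro image_cong) auto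
      ultimately show ?thesis using 1 crd_srt_sections[OF n M1] by (simp add: sx_def sy_def)
    next
      case 2
      then have "u \<in> nsub n J2" using u by (simp add: nsub_def)
      moreover have "\<sigma> ` u = (\<lambda>i. f2 (CI i)) ` u" using 2 J(6) by (intro image_cong) auto
      ultimately show ?thesis using 2 crd_srt_sections[OF n M2] by (simp add: sx_def sy_def)
    next
      case 3
      have uJ: "u \<subseteq> J" "finite u" "card u = n" using u by (auto simp: nsub_def)
      have "\<sigma> ` u \<subseteq> srt N SI" "finite (\<sigma> ` u)" "card (\<sigma> ` u) = n"
        using uJ J(4) inj_on_subset[OF J(3) uJ(1)] by (auto simp: card_image)
      note ex = sections_exist[OF n N this]
      show ?thesis using 3 someI_ex[OF ex(1)] someI_ex[OF ex(2)] by (simp add: sx_def sy_def)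
    qed
  qed
  obtain f c where fc: "inj_on f (cdom n J)" "csub n (mimg f (cstr n J c)) N" "\<forall>i\<in>J. f (CI i) = \<sigma> i"
     "\<forall>u\<in>nsub n J. f (CGs u {}) = sx u \<and> f (CHs u False) = sy u" "\<sigma> ` J = srt N SI \<longrightarrow> mimg f (cstr n J c) = N"
    using coords_exist[OF n N J(3,4), of sx sy] s by blast
  interpret P1: crd_pair n N f1 f J1 J c1 c
    by unfold_locales (use n N M1 fc J in \<open>auto simp: crd_def\<close>)
  interpret P2: crd_pair n N f2 f J2 J c2 c
    by unfold_locales (use n N M2 fc J in \<open>auto simp: crd_def\<close>)
  have a1: "f1 (CGs u {}) = f (CGs u {})" "f1 (CHs u False) = f (CHs u False)" if u: "u \<in> nsub n J1" for u
    using fc(4) P1.nJL[OF u] u by (auto simp: sx_def sy_def nsub_def)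
  have a2: "f2 (CGs u {}) = f (CGs u {}) \<and> f2 (CHs u False) = f (CHs u False)" if u: "u \<in> nsub n J2" for u
  proof (cases "u \<subseteq> J1")
    case True
    then have "u \<in> nsub n (J1 \<inter> J2)" "u \<in> nsub n J1" using u by (auto simp: nsub_def)
    then show ?thesis using ag[of "CGs u {}"] ag[of "CHs u False"] a1[of u] by simp
  next
    case False
    then show ?thesis using fc(4) P2.nJL[OF u] u by (auto simp: sx_def sy_def nsub_def)
  qed
  note g1 = P1.agree[OF a1] and g2 = P2.agree[OF a2[THEN conjunct1] a2[THEN conjunct2]]
  show ?thesis using fc g1 g2 M1(1) M2(1) unfolding crd_def
    by (intro exI[of _ f] exI[of _ c]) (simp add: Ball_def)
qed

lemma coords_any:
  fixes \<sigma> :: "'i \<Rightarrow> 'u"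
  assumes n: "0 < n" and M: "Kn n M" and b: "bij_betw \<sigma> J (srt M SI)"
  shows "\<exists>f c. crd n f J c M \<and> (\<forall>i\<in>J. f (CI i) = \<sigma> i)"
proof -
  have "\<exists>x. x \<in> srt M SGs \<and> memb M (prg M x) = \<sigma> ` u" "\<exists>x. x \<in> srt M SHs \<and> memb M (prh M x) = \<sigma> ` u"
    if u: "u \<in> nsub n J" for u
  proof -
    have "\<sigma> ` u \<subseteq> srt M SI" "finite (\<sigma> ` u)" "card (\<sigma> ` u) = n"
      using u b inj_on_subset[of \<sigma> J u] by (auto simp: nsub_def bij_betw_def card_image)
    from sections_exist[OF n M this]
    show "\<exists>x. x \<in> srt M SGs \<and> memb M (prg M x) = \<sigma> ` u" "\<exists>x. x \<in> srt M SHs \<and> memb M (prh M x) = \<sigma> ` u" .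
  qed
  then obtain sx sy where "\<And>u. u \<in> nsub n J \<Longrightarrow> sx u \<in> srt M SGs \<and> memb M (prg M (sx u)) = \<sigma> ` u"
    "\<And>u. u \<in> nsub n J \<Longrightarrow> sy u \<in> srt M SHs \<and> memb M (prh M (sy u)) = \<sigma> ` u" by metis
  from coords_exist[OF n M _ _ this, of J] b show ?thesis
    unfolding crd_def bij_betw_def by (metis imageI)
qed

lemma crd_sub:
  assumes n: "0 < n" and f: "inj_on f (cdom n J)" and J: "J0 \<subseteq> J"
  shows "csub n (mimg f (cstr n J0 c)) (mimg f (cstr n J c))"
proof -
  have f0: "inj_on f (cdom n J0)" using f cdom_mono[OF J] inj_on_subset by blast
  interpret A: coord n f J0 c by unfold_locales (use n f0 in auto)
  interpret B: coord n f J c by unfold_locales (use n f in auto)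
  show ?thesis
  proof (rule csubI)
    show "dom A.M \<subseteq> dom B.M" using cdom_mono[OF J, of n] by auto
    show "xs \<in> rels A.M r \<longleftrightarrow> xs \<in> rels B.M r" if s: "set xs \<subseteq> dom A.M" for xs r
    proof -
      have "xs \<in> lists (f ` cdom n J0)" using s by auto
      then obtain ys where ys: "xs = map f ys" "set ys \<subseteq> cdom n J0" unfolding lists_image by auto
      then show ?thesis using A.rel_iff[OF ys(2)] B.rel_iff[of ys] cdom_mono[OF J, of n] by auto
    qed
    show "u \<in> dom A.M" if gu: "[g, u] \<in> rels B.M Supp" "g \<in> dom A.M" for g u
    proof -
      obtain xs where xs: "[g, u] = map f xs" "crel n c Supp xs" "set xs \<subseteq> cdom n J" using gu(1) by (rule B.relE)
      then obtain h v where hv: "xs = [CG h, CK v]" "v \<in> h" by (auto simp: crel_simps)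
      obtain x where x: "g = f x" "cin n J0 x" using gu(2) by auto
      have "x = CG h" using x xs hv B.f_eq[of x "CG h"] cin_mono[OF J] by auto
      then have "v \<in> nsub n J0" using x hv by auto
      then show ?thesis using xs hv by auto
    qed
  qed (use A.Kn_M B.Kn_M in auto)
qed

section \<open>Isomorphic copies and finite character\<close>

lemma srt_mimg: "srt (mimg h M) s = h ` srt M s"
  by (auto simp: srt_def rels_mimg image_iff) (metis list.simps(8) list.simps(9))

lemma crd_mimg: "crd n f J c M \<Longrightarrow> inj_on h (dom M) \<Longrightarrow> crd n (h \<circ> f) J c (mimg h M)"
  by (simp add: crd_def mimg_mimg comp_inj_on)

text \<open>With the indices themselves as labels, index sets double as label sets.\<close>

lemma coords_id:
  assumes "0 < n" "Kn n M"
  shows "\<exists>f c. crd n f (srt M SI) c M \<and> (\<forall>i\<in>srt M SI. f (CI i) = i)"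
  using coords_any[OF assms, of id "srt M SI"] by simp

lemma Kn_mimg:
  assumes n: "0 < n" and M: "Kn n M" and h: "inj_on h (dom M)"
  shows "Kn n (mimg h M)"
proof -
  obtain f c where "crd n f (srt M SI) c M" using coords_id[OF n M] by blast
  then show ?thesis using crd_mimg h crd_Kn[OF n] by blast
qed

lemma csub_mimg:
  assumes n: "0 < n" and AB: "csub n A B" and h: "inj_on h (dom B)"
  shows "csub n (mimg h A) (mimg h B)"
proof -
  have d: "dom A \<subseteq> dom B" using csub_dom[OF AB] .
  have hA: "inj_on h (dom A)" using inj_on_subset[OF h d] .
  have rel: "map h xs \<in> rels (mimg h X) r \<longleftrightarrow> xs \<in> rels X r"
    if X: "Kn n X" "inj_on h (dom X)" and xs: "set xs \<subseteq> dom X" for X xs r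
  proof
    assume "map h xs \<in> rels (mimg h X) r"
    then obtain ys where "map h xs = map h ys" "ys \<in> rels X r" by (auto simp: rels_mimg)
    moreover from this have "set ys \<subseteq> dom X" using Kn_wf[OF X(1)] by blast
    ultimately show "xs \<in> rels X r" using xs X(2) by (metis inj_on_map_eq_map inj_on_subset Un_least)
  qed (simp add: rels_mimg)
  show ?thesis
  proof (rule csubI)
    show "dom (mimg h A) \<subseteq> dom (mimg h B)" using d by auto
    show "xs \<in> rels (mimg h A) r \<longleftrightarrow> xs \<in> rels (mimg h B) r" if s: "set xs \<subseteq> dom (mimg h A)" for xs r
    proof -
      have "xs \<in> lists (h ` dom A)" using s by auto
      then obtain ys where ys: "xs = map h ys" "set ys \<subseteq> dom A" unfolding lists_image by auto
      then show ?thesis using rel[OF csub_Kn(1)[OF AB] hA ys(2)] rel[OF csub_Kn(2)[OF AB] h, of ys] d csub_rel[OF AB ys(2)] by auto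
    qed
    show "u \<in> dom (mimg h A)" if gu: "[g, u] \<in> rels (mimg h B) Supp" "g \<in> dom (mimg h A)" for g u
    proof -
      obtain g' u' where g': "g = h g'" "u = h u'" "[g', u'] \<in> rels B Supp" using gu(1) by (auto simp: rels_mimg)
      then have "g' \<in> dom B" using Kn_wf[OF csub_Kn(2)[OF AB]] by fastforce
      then have "g' \<in> dom A" using gu(2) g'(1) d h by (auto simp: inj_on_def)
      then show ?thesis using csub_supp[OF AB g'(3)] g' by auto
    qed
  qed (use Kn_mimg[OF n] csub_Kn[OF AB] h hA in auto)
qed

lemma finite_cdom:
  fixes J :: "'i set" assumes "finite J" shows "finite (cdom n J)"
proof -
  have K: "finite (nsub n J)" using finite_nsub[OF assms] .
  have "cdom n J \<subseteq> CI ` J \<union> CK ` nsub n J \<union> range CH \<union> CG ` Pow (nsub n J) \<union>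
     case_prod CGs ` (nsub n J \<times> Pow (nsub n J)) \<union> case_prod CHs ` (nsub n J \<times> UNIV)"
  proof
    fix x assume "x \<in> cdom n J"
    then show "x \<in> CI ` J \<union> CK ` nsub n J \<union> range CH \<union> CG ` Pow (nsub n J) \<union>
     case_prod CGs ` (nsub n J \<times> Pow (nsub n J)) \<union> case_prod CHs ` (nsub n J \<times> UNIV)"
      by (cases x) (auto simp: image_iff)
  qed
  then show ?thesis by (rule finite_subset) (use assms K in auto)
qed

text \<open>The finitely many indices that an element involves. They reduce single elements to
  finite index sets in back-and-forth, and tuples to one member of a chain in unions.\<close>

fun csupp :: "'i cel \<Rightarrow> 'i set" where
  "csupp (CI i) = {i}" | "csupp (CK u) = u" | "csupp (CH b) = {}" | "csupp (CG g) = \<Union>g"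
| "csupp (CGs u g) = u \<union> \<Union>g" | "csupp (CHs u m) = u"

lemma csupp: "cin n J x \<Longrightarrow> finite (csupp x) \<and> csupp x \<subseteq> J"
  by (cases x) (auto simp: nsub_def)

lemma cin_csupp: "cin n J x \<Longrightarrow> csupp x \<subseteq> A \<Longrightarrow> cin n A x"
  by (cases x) (auto simp: nsub_def)

text \<open>Two distinct stalks determine the carrier, and hence the single equation in which they
  can meet; \<open>gauge\<close> rests on this.\<close>

lemma nsub_Un:
  assumes "w \<in> nsub (Suc n) J" "u \<in> nsub n w" "v \<in> nsub n w" "u \<noteq> v"
  shows "u \<union> v = w"
proof (rule card_seteq)
  have f: "finite w" "card w = Suc n" "finite u" "card u = n" "finite v" "card v = n" "u \<subseteq> w" "v \<subseteq> w"
    using assms by (auto simp: nsub_def)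
  show "finite w" "u \<union> v \<subseteq> w" using f by auto
  have "\<not> v \<subseteq> u" using card_seteq[of u v] f assms(4) by auto
  then have "u \<subset> u \<union> v" by blast
  then have "card u < card (u \<union> v)" using f by (intro psubset_card_mono) auto
  then show "card w \<le> card (u \<union> v)" using f by simp
qed

section \<open>Elementary substructures\<close>

text \<open>The unknown \<open>v \<in> \<gamma> u\<close> occurs only in the equation for \<open>v\<close> and \<open>w = u \<union> v\<close>, so one unknown can be
  reserved for each equation. Finiteness of each \<open>\<gamma> u\<close> is what fails for infinite \<open>J\<close>.\<close>
lemma gauge:
  assumes n: "2 \<le> n"
  shows "\<exists>\<gamma>. (\<forall>u. \<gamma> u \<subseteq> nsub n J) \<and> (\<forall>u. u \<subseteq> A \<longrightarrow> \<gamma> u = {}) \<and>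
    (\<forall>w\<in>nsub (Suc n) J. \<forall>v\<in>nsub n w. (w \<subseteq> A \<longrightarrow> \<not> \<delta> v w) \<longrightarrow>
        odd (card {u \<in> nsub n w - {v}. v \<in> \<gamma> u}) = \<delta> v w)"
proof -
  have ex: "\<exists>u. u \<in> nsub n w - {v} \<and> \<not> u \<subseteq> A"
    if w: "w \<in> nsub (Suc n) J" "\<not> w \<subseteq> A" "v \<in> nsub n w" for v w
  proof -
    obtain a where a: "a \<in> w" "a \<notin> A" using w by blast
    have f: "finite w" "card w = Suc n" "v \<subseteq> w" "finite v" "card v = n" using w by (auto simp: nsub_def)
    then have "card (w - v) = 1" by (simp add: card_Diff_subset)
    then obtain b where b: "w - v = {b}" by (auto simp: card_1_singleton_iff)
    \<comment> \<open>The wanted stalk is \<open>w\<close> without a point \<open>d\<close>. It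
      differs from \<open>v\<close>, which is \<open>w\<close> without \<open>b\<close>, when
      \<open>d\<close> is not \<open>b\<close>, and it leaves \<open>A\<close> when it keeps
      \<open>a\<close>. So \<open>d\<close> has to avoid two points, and \<open>2 \<le> n\<close>
      leaves a third.\<close>
    have "card {a, b} < card w" using f n by (simp add: card_insert_if)
    then obtain d where d: "d \<in> w" "d \<noteq> a" "d \<noteq> b"
      using f(1) by (metis card_mono finite.emptyI finite_insert insertCI not_le subsetI)
    then have "w - {d} \<in> nsub n w" using f by (auto simp: nsub_def)
    moreover have "d \<in> v" using b d by blast
    ultimately show ?thesis using a d by blast
  qed
  \<comment> \<open>The stalk reserved for the equation at \<open>v\<close> and \<open>w\<close>.
    Choosing it not inside \<open>A\<close> is what lets \<open>\<gamma>\<close> vanish over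
    \<open>A\<close>, so that base points fixed earlier are not moved.\<close>
  define U where "U v w = (SOME u. u \<in> nsub n w - {v} \<and> \<not> u \<subseteq> A)" for v w
  have U: "U v w \<in> nsub n w - {v} \<and> \<not> U v w \<subseteq> A"
    if "w \<in> nsub (Suc n) J" "\<not> w \<subseteq> A" "v \<in> nsub n w" for v w
    unfolding U_def by (rule someI_ex[OF ex[OF that]])
  define \<gamma> where "\<gamma> u = {v \<in> nsub n J. u \<union> v \<in> nsub (Suc n) J \<and> \<not> u \<union> v \<subseteq> A \<and> U v (u \<union> v) = u \<and> \<delta> v (u \<union> v)}" for u
  have "\<gamma> u = {}" if "u \<subseteq> A" for u
  proof -
    have "v \<notin> \<gamma> u" for v
    proof
      assume v: "v \<in> \<gamma> u"
      then have "v \<in> nsub n (u \<union> v)" by (auto simp: \<gamma>_def nsub_def)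
      then show False using U[of "u \<union> v" v] v that by (auto simp: \<gamma>_def)
    qed
    then show ?thesis by blast
  qed
  moreover have "odd (card {u \<in> nsub n w - {v}. v \<in> \<gamma> u}) = \<delta> v w"
    if w: "w \<in> nsub (Suc n) J" "v \<in> nsub n w" "w \<subseteq> A \<longrightarrow> \<not> \<delta> v w" for v w
  proof -
    have vJ: "v \<in> nsub n J" using w by (auto simp: nsub_def)
    \<comment> \<open>Inside \<open>w\<close> one has \<open>u \<union> v = w\<close> by
      \<open>nsub_Un\<close>, so the condition in \<open>\<gamma> u\<close> speaks of this equation
      only and singles out the reserved stalk.\<close>
    have "{u \<in> nsub n w - {v}. v \<in> \<gamma> u} = {u \<in> nsub n w - {v}. \<not> w \<subseteq> A \<and> U v w = u \<and> \<delta> v w}"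
      using nsub_Un[OF w(1) _ w(2)] w(1) vJ unfolding \<gamma>_def by fastforce
    also have "\<dots> = (if \<delta> v w then {U v w} else {})" using U[OF w(1) _ w(2)] w(3) by auto
    finally show ?thesis by simp
  qed
  ultimately show ?thesis by (intro exI[of _ \<gamma>]) (auto simp: \<gamma>_def)
qed

lemma inj_CI:
  assumes "inj_on f (cdom n A)" shows "inj_on (\<lambda>i. f (CI i)) A"
proof (rule inj_onI)
  fix x y assume "x \<in> A" "y \<in> A" "f (CI x) = f (CI y)"
  then show "x = y" using inj_onD[OF assms, of "CI x" "CI y"] by simp
qed

lemma crd_restrict:
  assumes "0 < n" "crd n f J c M" "J0 \<subseteq> J"
  shows "csub n (mimg f (cstr n J0 c)) M" "crd n f J0 c (mimg f (cstr n J0 c))"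
proof -
  have "inj_on f (cdom n J)" "mimg f (cstr n J c) = M" using assms(2) by (simp_all add: crd_def)
  then show "csub n (mimg f (cstr n J0 c)) M" "crd n f J0 c (mimg f (cstr n J0 c))"
    using crd_sub[OF assms(1) _ assms(3)] cdom_mono[OF assms(3)] inj_on_subset unfolding crd_def by metis+
qed

section \<open>Back-and-forth between two models\<close>

text \<open>The global coordinates \<open>g\<close>, unrelated to \<open>f\<close>, serve only to
  find a finite index set \<open>S\<close> whose span \<open>?Z\<close> contains \<open>b\<close>
  and the image of \<open>f\<close>. The map \<open>f\<close> is then extended to coordinates of
  \<open>?Z\<close>, whatever \<open>c1\<close> this produces.\<close>

lemma back_step:
  fixes f :: "'i cel \<Rightarrow> 'u"
  assumes n: "0 < n" and M: "Kn n M" and A: "finite A" and i: "infinite (UNIV :: 'i set)"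
    and f: "inj_on f (cdom n A)" "csub n (mimg f (cstr n A c)) M" and b: "b \<in> dom M"
  shows "\<exists>A' f1 c1. finite A' \<and> A \<subseteq> A' \<and> inj_on f1 (cdom n A') \<and> csub n (mimg f1 (cstr n A' c1)) M \<and>
     (\<forall>x\<in>cdom n A. f1 x = f x) \<and> mimg f1 (cstr n A c1) = mimg f (cstr n A c) \<and> b \<in> f1 ` cdom n A'"
proof -
  let ?X = "mimg f (cstr n A c)"
  have X: "crd n f A c ?X" using f by (simp add: crd_def)
  obtain g d where g: "crd n g (srt M SI) d M" "\<And>i. i \<in> srt M SI \<Longrightarrow> g (CI i) = i" using coords_id[OF n M] by blast
  have "insert b (dom ?X) \<subseteq> g ` cdom n (srt M SI)"
    using b csub_dom[OF f(2)] unfolding crd_dom[OF g(1), symmetric] by blast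
  then have "\<exists>x. cin n (srt M SI) x \<and> y = g x" if "y \<in> insert b (dom ?X)" for y
    using that by (metis (no_types) cdom_iff imageE subsetD)
  then have "\<exists>h. \<forall>y. y \<in> insert b (dom ?X) \<longrightarrow> cin n (srt M SI) (h y) \<and> y = g (h y)" by metis
  then obtain h where h: "\<And>y. y \<in> insert b (dom ?X) \<Longrightarrow> cin n (srt M SI) (h y) \<and> y = g (h y)" by blast
  define S where "S = (\<Union>y\<in>insert b (dom ?X). csupp (h y))"
  have c: "finite (csupp (h y)) \<and> csupp (h y) \<subseteq> srt M SI" if "y \<in> insert b (dom ?X)" for y
    using csupp h[OF that] by blast
  have "finite (insert b (dom ?X))" using finite_cdom[OF A, of n] by simp
  then have fS: "finite S" "S \<subseteq> srt M SI" using c unfolding S_def by blast+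
  let ?Z = "mimg g (cstr n S d)"
  have ZM: "csub n ?Z M" using crd_restrict(1)[OF n g(1) fS(2)] .
  have Z: "crd n g S d ?Z" using crd_restrict(2)[OF n g(1) fS(2)] .
  have "y \<in> dom ?Z" if y: "y \<in> insert b (dom ?X)" for y
  proof -
    have hy: "cin n (srt M SI) (h y)" "g (h y) = y" using h[OF y] by metis+
    have "csupp (h y) \<subseteq> S" using y unfolding S_def by blast
    then have "g (h y) \<in> g ` cdom n S" using cin_csupp[OF hy(1)] by (intro imageI) simp
    then show ?thesis unfolding hy(2) by simp
  qed
  then have bZ: "b \<in> dom ?Z" and XZ: "csub n ?X ?Z" using csub_between[OF f(2) ZM] by auto
  have "(\<lambda>i. g (CI i)) ` S = (\<lambda>i. i) ` S" using g(2) fS(2) by (intro image_cong) auto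
  then have SI: "srt ?Z SI = S" using crd_SI[OF n Z] by simp
  have fA: "(\<lambda>i. f (CI i)) ` A \<subseteq> S" using crd_SI[OF n X] csub_srt[OF XZ, of SI] SI by auto
  have iA: "inj_on (\<lambda>i. f (CI i)) A" using inj_CI[OF f(1)] .
  \<comment> \<open>Fresh labels for the new indices; this is why the label type has to be
    infinite.\<close>
  obtain B where B: "finite B" "card B = card (S - (\<lambda>i. f (CI i)) ` A)" "B \<subseteq> - A"
    using infinite_arbitrarily_large[of "- A"] i A by (metis Diff_infinite_finite Compl_eq_Diff_UNIV)
  then obtain \<tau> where \<tau>: "bij_betw \<tau> B (S - (\<lambda>i. f (CI i)) ` A)"
    using finite_same_card_bij fS(1) by blast
  define \<sigma> where "\<sigma> i = (if i \<in> A then f (CI i) else \<tau> i)" for i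
  have s1: "\<sigma> ` A = (\<lambda>i. f (CI i)) ` A" by (intro image_cong) (auto simp: \<sigma>_def)
  have s2: "\<sigma> ` B = \<tau> ` B" using B(3) by (intro image_cong) (auto simp: \<sigma>_def)
  have sS: "\<sigma> ` (A \<union> B) = S" unfolding image_Un s1 s2 using \<tau> fA by (auto simp: bij_betw_def)
  have si: "inj_on \<sigma> (A \<union> B)"
  proof (rule inj_on_Un[THEN iffD2], intro conjI)
    show "inj_on \<sigma> A" using iA by (simp add: \<sigma>_def inj_on_def)
    have "inj_on \<tau> B" using \<tau> by (simp add: bij_betw_def)
    moreover have "\<sigma> x = \<tau> x" if "x \<in> B" for x using that B(3) by (auto simp: \<sigma>_def)
    ultimately show "inj_on \<sigma> B" by (simp add: inj_on_def)
    show "\<sigma> ` (A - B) \<inter> \<sigma> ` (B - A) = {}"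
    proof -
      have "\<sigma> ` (A - B) \<subseteq> \<sigma> ` A" "\<sigma> ` (B - A) \<subseteq> \<sigma> ` B" by auto
      moreover have "\<sigma> ` A \<inter> \<sigma> ` B = {}" unfolding s1 s2 using \<tau> by (auto simp: bij_betw_def)
      ultimately show ?thesis by blast
    qed
  qed
  have sZ: "\<sigma> i \<in> srt ?Z SI" if "i \<in> A \<union> B" for i using that sS unfolding SI by blast
  obtain f1 c1 where f1: "inj_on f1 (cdom n (A \<union> B))" "csub n (mimg f1 (cstr n (A \<union> B) c1)) ?Z"
     "\<forall>x\<in>cdom n A. f1 x = f x" "mimg f1 (cstr n A c1) = ?X" "mimg f1 (cstr n (A \<union> B) c1) = ?Z"
    using ext_coords[OF n X XZ X XZ _ _ _ si sZ] sS unfolding SI \<sigma>_def by auto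
  show ?thesis
  proof (intro exI conjI)
    show "finite (A \<union> B)" using A B by simp
    show "csub n (mimg f1 (cstr n (A \<union> B) c1)) M" unfolding f1(5) by (rule ZM)
    show "b \<in> f1 ` cdom n (A \<union> B)" using bZ unfolding f1(5)[symmetric] by simp
  qed (use f1 in auto)
qed

text \<open>Here \<open>c1\<close> is dictated by the other model. New indices are taken
  arbitrarily, since \<open>N\<close> has infinitely many, and base points over new stalks are then
  moved until the function \<open>c\<close> of \<open>N\<close> on \<open>A'\<close> becomes
  \<open>c1\<close>.\<close>

lemma forth_step:
  fixes f :: "'i cel \<Rightarrow> 'u"
  assumes n: "2 \<le> n" and N: "Kn n N" "infinite (srt N SI)" and A: "finite A'" "A \<subseteq> A'"
    and f: "inj_on f (cdom n A)" "csub n (mimg f (cstr n A c)) N"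
    and c: "\<And>v w. w \<in> nsub (Suc n) A \<Longrightarrow> v \<in> nsub n w \<Longrightarrow> c1 v w = c v w"
  shows "\<exists>f3. inj_on f3 (cdom n A') \<and> csub n (mimg f3 (cstr n A' c1)) N \<and> (\<forall>x\<in>cdom n A. f3 x = f x)"
proof -
  have n0: "0 < n" using n by simp
  let ?X = "mimg f (cstr n A c)"
  have X: "crd n f A c ?X" using f by (simp add: crd_def)
  have fA: "finite A" using A finite_subset by blast
  have "infinite (srt N SI - (\<lambda>i. f (CI i)) ` A)" using N(2) fA by simp
  then obtain B where B: "finite B" "card B = card (A' - A)" "B \<subseteq> srt N SI - (\<lambda>i. f (CI i)) ` A"
    using infinite_arbitrarily_large by metis
  then obtain \<tau> where \<tau>: "bij_betw \<tau> (A' - A) B" using A finite_same_card_bij by (metis finite_Diff)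
  define \<sigma> where "\<sigma> i = (if i \<in> A then f (CI i) else \<tau> i)" for i
  have iA: "inj_on (\<lambda>i. f (CI i)) A" using inj_CI[OF f(1)] .
  have XI: "(\<lambda>i. f (CI i)) ` A \<subseteq> srt N SI" using crd_SI[OF n0 X] csub_srt[OF f(2), of SI] by auto
  have t: "\<tau> i \<in> srt N SI - (\<lambda>i. f (CI i)) ` A" if "i \<in> A'" "i \<notin> A" for i
    using bij_betwE[OF \<tau>] that B(3) by blast
  have sI: "\<sigma> i \<in> srt N SI" if "i \<in> A'" for i using XI t that by (auto simp: \<sigma>_def)
  have si: "inj_on \<sigma> A'"
  proof (rule inj_onI)
    fix x y assume xy: "x \<in> A'" "y \<in> A'" "\<sigma> x = \<sigma> y"
    consider "x \<in> A" "y \<in> A" | "x \<in> A" "y \<notin> A" | "x \<notin> A" "y \<in> A" | "x \<notin> A" "y \<notin> A" by blast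
    then show "x = y"
    proof cases
      case 1 then show ?thesis using xy(3) inj_onD[OF iA, of x y] by (simp add: \<sigma>_def)
    next
      case 2
      then have "\<tau> y = f (CI x)" using xy(3) by (simp add: \<sigma>_def)
      then show ?thesis using 2 t[OF xy(2)] by blast
    next
      case 3
      then have "\<tau> x = f (CI y)" using xy(3) by (simp add: \<sigma>_def)
      then show ?thesis using 3 t[OF xy(1)] by blast
    next
      case 4
      then show ?thesis using xy inj_onD[OF bij_betw_imp_inj_on[OF \<tau>], of x y] by (simp add: \<sigma>_def)
    qed
  qed
  obtain f2 c2 where f2: "inj_on f2 (cdom n A')" "csub n (mimg f2 (cstr n A' c2)) N" "\<forall>i\<in>A'. f2 (CI i) = \<sigma> i"
     "\<forall>x\<in>cdom n A. f2 x = f x" 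
    using ext_coords[OF n0 X f(2) X f(2) _ A(2) A(2) si sI] unfolding \<sigma>_def by auto
  have X2: "crd n f2 A' c2 (mimg f2 (cstr n A' c2))" using f2 by (simp add: crd_def)
  interpret P: crd_pair n N f f2 A A' c c2
    by unfold_locales (use n0 N f f2 A in auto)
  have c2: "c2 v w = c v w" if "w \<in> nsub (Suc n) A" "v \<in> nsub n w" for v w
    using P.base_change[of "\<lambda>_. {}" "\<lambda>_. False", OF _ _ that] f2(4) by simp
  \<comment> \<open>\<open>gauge\<close> is applied to the discrepancy between the prescribed
    \<open>c1\<close> and the \<open>c2\<close> that was found. It vanishes inside \<open>A\<close>,
    where both equal \<open>c\<close>, so the correction leaves the base points over
    \<open>A\<close> alone.\<close>
  obtain \<gamma> where \<gamma>1: "\<forall>u. \<gamma> u \<subseteq> nsub n A'" "\<forall>u. u \<subseteq> A \<longrightarrow> \<gamma> u = {}"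
     and \<gamma>2: "\<forall>w\<in>nsub (Suc n) A'. \<forall>v\<in>nsub n w. (w \<subseteq> A \<longrightarrow> \<not> (c1 v w \<noteq> c2 v w)) \<longrightarrow>
        odd (card {u \<in> nsub n w - {v}. v \<in> \<gamma> u}) = (c1 v w \<noteq> c2 v w)"
    using gauge[OF n, of A' A "\<lambda>v w. c1 v w \<noteq> c2 v w"] by (elim exE conjE) (rule that)
  have \<gamma>: "\<gamma> u \<subseteq> nsub n A'" "u \<subseteq> A \<Longrightarrow> \<gamma> u = {}" for u using \<gamma>1 by simp_all
  have \<gamma>3: "odd (card {u \<in> nsub n w - {v}. v \<in> \<gamma> u}) = (c1 v w \<noteq> c2 v w)"
    if "w \<in> nsub (Suc n) A'" "v \<in> nsub n w" "w \<subseteq> A \<longrightarrow> c1 v w = c2 v w" for v w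
    using bspec[OF bspec[OF \<gamma>2 that(1)] that(2)] that(3) by blast
  have f\<gamma>: "finite (\<gamma> u)" for u using \<gamma>(1) finite_nsub[OF A(1)] finite_subset by blast
  have img: "(\<lambda>i. f2 (CI i)) ` u = \<sigma> ` u" if "u \<in> nsub n A'" for u
    using f2(3) that by (intro image_cong) (auto simp: nsub_def)
  have sec: "f2 (CGs u (\<gamma> u)) \<in> srt N SGs \<and> memb N (prg N (f2 (CGs u (\<gamma> u)))) = \<sigma> ` u"
     "f2 (CHs u False) \<in> srt N SHs \<and> memb N (prh N (f2 (CHs u False))) = \<sigma> ` u"
     if "u \<in> nsub n A'" for u
    using that P.B.srtN(5,6) P.B.prg_f P.B.prh_f P.B.f_CK f\<gamma> \<gamma>(1) img by simp_all
  obtain f3 c3 where f3: "inj_on f3 (cdom n A')" "csub n (mimg f3 (cstr n A' c3)) N" "\<forall>i\<in>A'. f3 (CI i) = \<sigma> i"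
     "\<forall>u\<in>nsub n A'. f3 (CGs u {}) = f2 (CGs u (\<gamma> u)) \<and> f3 (CHs u False) = f2 (CHs u False)"
    using coords_exist[OF n0 N(1) si sI sec] by blast
  interpret Q: crd_pair n N f3 f2 A' A' c3 c2
    by unfold_locales (use n0 N f3 f2 A in auto)
  have "c3 v w = c1 v w" if w: "w \<in> nsub (Suc n) A'" "v \<in> nsub n w" for v w
  proof -
    have "w \<subseteq> A \<longrightarrow> c1 v w = c2 v w" using c c2 w by (auto simp: nsub_def)
    note o = \<gamma>3[OF w this]
    have "c3 v w = (c2 v w \<noteq> (odd (card {u \<in> nsub n w - {v}. v \<in> \<gamma> u}) \<noteq> False))"
      using \<gamma>(1) f\<gamma> f3(4) by (intro Q.base_change[of \<gamma> "\<lambda>_. False", OF _ _ w]) auto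
    then show ?thesis using o by argo
  qed
  then have e: "cstr n A' c3 = cstr n A' c1" by (rule cstr_cong[OF n0])
  have f3A: "inj_on f3 (cdom n A)" using f3(1) cdom_mono[OF A(2)] inj_on_subset by blast
  have f3CI: "f3 (CI i) = f2 (CI i)" if "i \<in> A" for i using f3(3) f2(3) A that by auto
  interpret R: crd_pair n N f3 f2 A A' c3 c2
    by unfold_locales (use n0 N f3A csub_trans[OF crd_sub[OF n0 f3(1) A(2)] f3(2)] f2(1,2) f3CI A in auto)
  have r: "f3 x = f2 x" if "x \<in> cdom n A" for x
  proof (rule R.agree(1)[OF _ _ that])
    show "f3 (CGs u {}) = f2 (CGs u {})" "f3 (CHs u False) = f2 (CHs u False)" if "u \<in> nsub n A" for u
      using that \<gamma>(2)[of u] f3(4) R.nJL[OF that] by (auto simp: nsub_def)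
  qed
  show ?thesis using f3(1,2) e r f2(4) by (intro exI[of _ f3]) auto
qed

text \<open>The invariant of the game: both models carry coordinates on the same finite label set
  \<open>A\<close> with the same \<open>c\<close>, and \<open>t\<close> gives the common label of
  the two values of each free variable.\<close>

lemma back_forth_sat:
  fixes M :: "'u str" and N :: "'v str" and f :: "'i cel \<Rightarrow> 'u"
  assumes "2 \<le> n" "infinite (UNIV :: 'i set)" "Kn n M" "infinite (srt M SI)" "Kn n N" "infinite (srt N SI)"
    and "wff \<phi>" "finite A"
    and "inj_on f (cdom n A)" "csub n (mimg f (cstr n A c)) M"
    and "inj_on f' (cdom n A)" "csub n (mimg f' (cstr n A c)) N"
    and "\<And>x. x \<in> fv \<phi> \<Longrightarrow> cin n A (t x) \<and> e x = f (t x) \<and> e' x = f' (t x)"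
  shows "sat M e \<phi> = sat N e' \<phi>"
  using assms(7-)
proof (induction \<phi> arbitrary: A f f' c t e e')
  case (FEq x y)
  have "cin n A (t x) \<and> e x = f (t x) \<and> e' x = f' (t x)" "cin n A (t y) \<and> e y = f (t y) \<and> e' y = f' (t y)"
    using FEq.prems(7) by simp_all
  then show ?case
    using inj_on_eq_iff[OF FEq.prems(3), of "t x" "t y"] inj_on_eq_iff[OF FEq.prems(5), of "t x" "t y"] by simp
next
  case (FRel r xs)
  interpret F: crd_in n M f A c by unfold_locales (use assms FRel.prems in auto)
  interpret G: crd_in n N f' A c by unfold_locales (use assms FRel.prems in auto)
  have a: "map e xs = map f (map t xs)" "map e' xs = map f' (map t xs)" and b: "set (map t xs) \<subseteq> cdom n A"
    using FRel.prems(7) by auto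
  show ?case unfolding sat.simps a F.relN[OF b] G.relN[OF b] by (rule refl)
next
  case (FNeg \<phi>)
  then show ?case by (simp only: sat.simps wff.simps fv.simps) metis
next
  case (FConj \<phi>s)
  have "sat M e (\<phi>s i) = sat N e' (\<phi>s i)" for i
    by (rule FConj.IH[OF _ _ FConj.prems(2-6)]) (use FConj.prems(1,7) in auto)
  then show ?case by simp
next
  case (FEx y \<phi>)
  have n0: "0 < n" using assms(1) by simp
  have W: "wff \<phi>" using FEx.prems by simp
  have t': "cin n A' ((t(y := x)) z) \<and> (e(y := f1 x)) z = f1 ((t(y := x)) z) \<and> (e'(y := f3 x)) z = f3 ((t(y := x)) z)"
    if "z \<in> fv \<phi>" "A \<subseteq> A'" "cin n A' x" "\<forall>x\<in>cdom n A. f1 x = f x" "\<forall>x\<in>cdom n A. f3 x = f' x" for z A' x f1 f3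
    using that FEx.prems(7)[of z] cin_mono[OF that(2), of n "t z"] by auto
  show ?case
  proof
    assume "sat M e (FEx y \<phi>)"
    then obtain a where a: "a \<in> dom M" "sat M (e(y := a)) \<phi>" by auto
    obtain A' f1 c1 where *: "finite A'" "A \<subseteq> A'" "inj_on f1 (cdom n A')" "csub n (mimg f1 (cstr n A' c1)) M"
     "\<forall>x\<in>cdom n A. f1 x = f x" "mimg f1 (cstr n A c1) = mimg f (cstr n A c)" "a \<in> f1 ` cdom n A'"
      using back_step[OF n0 assms(3) FEx.prems(2) assms(2) FEx.prems(3,4) a(1)] by blast
    interpret P: crd_pair n M f f1 A A' c c1 by unfold_locales (use n0 assms FEx.prems * in auto)
    have cc: "c1 v w = c v w" if "w \<in> nsub (Suc n) A" "v \<in> nsub n w" for v w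
      using P.base_change[of "\<lambda>_. {}" "\<lambda>_. False", OF _ _ that] *(5) by simp
    obtain f3 where f3: "inj_on f3 (cdom n A')" "csub n (mimg f3 (cstr n A' c1)) N" "\<forall>x\<in>cdom n A. f3 x = f' x"
      using forth_step[OF assms(1,5,6) *(1,2) FEx.prems(5,6) cc] by blast
    obtain x where x: "a = f1 x" "cin n A' x" using *(7) by auto
    have "sat M (e(y := f1 x)) \<phi> = sat N (e'(y := f3 x)) \<phi>"
      by (rule FEx.IH[OF W *(1,3,4) f3(1,2) t'[OF _ *(2) x(2) *(5) f3(3)]])
    moreover have "f3 x \<in> dom N" using csub_dom[OF f3(2)] x(2) by auto
    ultimately show "sat N e' (FEx y \<phi>)" using a x by auto
  next
    assume "sat N e' (FEx y \<phi>)"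
    then obtain a where a: "a \<in> dom N" "sat N (e'(y := a)) \<phi>" by auto
    obtain A' f1 c1 where *: "finite A'" "A \<subseteq> A'" "inj_on f1 (cdom n A')" "csub n (mimg f1 (cstr n A' c1)) N"
     "\<forall>x\<in>cdom n A. f1 x = f' x" "mimg f1 (cstr n A c1) = mimg f' (cstr n A c)" "a \<in> f1 ` cdom n A'"
      using back_step[OF n0 assms(5) FEx.prems(2) assms(2) FEx.prems(5,6) a(1)] by blast
    interpret P: crd_pair n N f' f1 A A' c c1 by unfold_locales (use n0 assms FEx.prems * in auto)
    have cc: "c1 v w = c v w" if "w \<in> nsub (Suc n) A" "v \<in> nsub n w" for v w
      using P.base_change[of "\<lambda>_. {}" "\<lambda>_. False", OF _ _ that] *(5) by simp
    obtain f3 where f3: "inj_on f3 (cdom n A')" "csub n (mimg f3 (cstr n A' c1)) M" "\<forall>x\<in>cdom n A. f3 x = f x"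
      using forth_step[OF assms(1,3,4) *(1,2) FEx.prems(3,4) cc] by blast
    obtain x where x: "a = f1 x" "cin n A' x" using *(7) by auto
    have "sat M (e(y := f3 x)) \<phi> = sat N (e'(y := f1 x)) \<phi>"
      by (rule FEx.IH[OF W *(1) f3(1,2) *(3,4) t'[OF _ *(2) x(2) f3(3) *(5)]])
    moreover have "f3 x \<in> dom M" using csub_dom[OF f3(2)] x(2) by auto
    ultimately show "sat M e (FEx y \<phi>)" using a x by auto
  qed
qed

lemma finite_fv: "wff \<phi> \<Longrightarrow> finite (fv \<phi>)"
  by (induction \<phi>) auto

lemma csub_coords:
  assumes n: "0 < n" and MN: "csub n M N" and f0: "crd n f0 (srt M SI) c0 M" "\<And>i. i \<in> srt M SI \<Longrightarrow> f0 (CI i) = i"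
  shows "\<exists>f c. crd n f (srt N SI) c N \<and> mimg f (cstr n (srt M SI) c) = M \<and> (\<forall>i\<in>srt N SI. f (CI i) = i) \<and>
     (\<forall>x\<in>cdom n (srt M SI). f x = f0 x)"
proof -
  have sub: "srt M SI \<subseteq> srt N SI" using csub_srt[OF MN, of SI] by auto
  obtain f c where f: "inj_on f (cdom n (srt N SI))" "\<forall>i\<in>srt N SI. f (CI i) = id i"
      "\<forall>x\<in>cdom n (srt M SI). f x = f0 x" "mimg f (cstr n (srt M SI) c) = M" "mimg f (cstr n (srt N SI) c) = N"
    using ext_coords[OF n f0(1) MN f0(1) MN _ sub sub, of id] f0(2) by auto
  have "crd n f (srt N SI) c N" unfolding crd_def using f(1) f(5)[symmetric] by (rule conjI)
  then show ?thesis using f(2-4) by (intro exI[of _ f] exI[of _ c]) simp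
qed

text \<open>Coordinates of \<open>M\<close> extend to \<open>N\<close>. Parameters from
  \<open>M\<close> occurring in a formula lie over a finite \<open>A\<close>, where one and the same
  coordinate map serves for both models and starts the back-and-forth.\<close>

lemma csub_leK:
  assumes n: "2 \<le> n" and MN: "csub n M N" and i: "infinite (srt M SI)"
  shows "leK n M N"
proof -
  have n0: "0 < n" using n by simp
  have K: "Kn n M" "Kn n N" using MN csub_Kn by blast+
  have sub: "srt M SI \<subseteq> srt N SI" using csub_srt[OF MN, of SI] by auto
  have iN: "infinite (srt N SI)" using i sub infinite_super by blast
  obtain f0 c0 where f0: "crd n f0 (srt M SI) c0 M" "\<And>i. i \<in> srt M SI \<Longrightarrow> f0 (CI i) = i"
    using coords_id[OF n0 K(1)] by blast
  obtain f c where f: "crd n f (srt N SI) c N" "mimg f (cstr n (srt M SI) c) = M"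
    using csub_coords[OF n0 MN f0] by blast
  have "sat M e \<phi> = sat N e \<phi>" if \<phi>: "wff \<phi>" "\<forall>x. e x \<in> dom M" for \<phi> e
  proof -
    have "dom M = f ` cdom n (srt M SI)" using f(2) by (metis dom_cstr dom_mimg)
    then have "\<forall>x. \<exists>y. cin n (srt M SI) y \<and> e x = f y" using \<phi>(2) by (metis cdom_iff imageE)
    then obtain t where t: "\<And>x. cin n (srt M SI) (t x) \<and> e x = f (t x)" by metis
    define A where "A = (\<Union>x\<in>fv \<phi>. csupp (t x))"
    have A: "finite A" "A \<subseteq> srt M SI" using t csupp finite_fv[OF \<phi>(1)] by (auto simp: A_def) blast
    have AN: "A \<subseteq> srt N SI" using A sub by blast
    have fi: "inj_on f (cdom n (srt N SI))" "mimg f (cstr n (srt N SI) c) = N" using f(1) by (auto simp: crd_def)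
    have fiM: "inj_on f (cdom n (srt M SI))" using fi(1) cdom_mono[OF sub] inj_on_subset by blast
    have fiA: "inj_on f (cdom n A)" using fi(1) cdom_mono[OF AN] inj_on_subset by blast
    have "csub n (mimg f (cstr n A c)) M" "csub n (mimg f (cstr n A c)) N"
      using crd_sub[OF n0 fiM A(2), of c] crd_sub[OF n0 fi(1) AN, of c] f(2) fi(2) by simp_all
    moreover have "infinite (UNIV :: 'a set)" using infinite_super[OF subset_UNIV i] .
    moreover have "cin n A (t x)" if "x \<in> fv \<phi>" for x
      using t[of x] cin_csupp[of n "srt M SI" "t x" A] that unfolding A_def by blast
    ultimately show ?thesis
      using back_forth_sat[OF n _ K(1) i K(2) iN \<phi>(1) A(1) fiA _ fiA, of c t e e] t by blast
  qed
  then show ?thesis using K csub_dom[OF MN] unfolding leK_def elem_sub_def by blast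
qed

text \<open>Closure under supports: if \<open>b\<^sub>1, \<dots>, b\<^sub>m\<close> is the support of \<open>g\<close> in \<open>M\<close>, then \<open>M\<close>, hence \<open>N\<close>, satisfies
  that nothing else is in the support.\<close>
lemma leK_csub:
  assumes MN: "leK n M N"
  shows "csub n M N"
proof (rule csubI)
  show K: "Kn n M" "Kn n N" and d: "dom M \<subseteq> dom N" using MN by (auto simp: leK_def elem_sub_def)
  have el: "sat M e \<phi> \<longleftrightarrow> sat N e \<phi>" if "wff \<phi>" "\<forall>x. e x \<in> dom M" for \<phi> e
    using MN that by (auto simp: leK_def elem_sub_def)
  show rel: "xs \<in> rels M r \<longleftrightarrow> xs \<in> rels N r" if s: "set xs \<subseteq> dom M" for xs r
  proof (cases xs)
    \<comment> \<open>The assignment used for a non-empty tuple takes its head as default value. The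
      empty tuple is in no relation, because every arity is positive.\<close>
    case Nil
    have "arity n r \<noteq> 0" by (cases r) auto
    then show ?thesis using Kn_wf[OF K(1), of xs r] Kn_wf[OF K(2), of xs r] Nil by auto
  next
    case (Cons a ys)
    define e where "e i = (if i < length xs then xs ! i else a)" for i
    have "e i \<in> dom M" for i using s Cons subsetD[OF s nth_mem, of i] by (auto simp: e_def)
    moreover have "map e [0..<length xs] = xs" by (rule nth_equalityI) (simp_all add: e_def)
    ultimately show ?thesis using el[of "FRel r [0..<length xs]" e] by simp
  qed
  show "u \<in> dom M" if gu: "[g, u] \<in> rels N Supp" "g \<in> dom M" for g u
  proof -
    have "[g, u] \<in> {[g, u] | g u. g \<in> srt N SG \<and> u \<in> srt N SK \<and> ev N g u \<noteq> hzero N}"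
      using gu(1) K(2) unfolding Kn_def Let_def by (elim conjE) simp
    then have "g \<in> srt N SG" by blast
    then have gG: "g \<in> srt M SG" using rel[of "[g]" SG] gu(2) by (simp add: srt_def)
    define S where "S = {u. [g, u] \<in> rels M Supp}"
    have fin: "\<forall>g\<in>srt M SG. finite {u\<in>srt M SK. ev M g u \<noteq> hzero M}"
      using K(1) unfolding Kn_def Let_def by (elim conjE)
    have "rels M Supp = {[g, u] | g u. g \<in> srt M SG \<and> u \<in> srt M SK \<and> ev M g u \<noteq> hzero M}"
      using K(1) unfolding Kn_def Let_def by (elim conjE)
    then have "S \<subseteq> {u\<in>srt M SK. ev M g u \<noteq> hzero M}" unfolding S_def by auto
    then have "finite S" using fin gG finite_subset by blast
    then obtain us where us: "set us = S" using finite_list by blast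
    define m where "m = length us"
    define e where "e i = (if 2 \<le> i \<and> i < m + 2 then us ! (i - 2) else g)" for i
    \<comment> \<open>Variable 0 is \<open>g\<close>, variables 2 to \<open>m + 1\<close> run
      through the support of \<open>g\<close> in \<open>M\<close>, and variable 1 is a further
      element of the support. \<open>FConj\<close> takes an infinite sequence, so the true formula
      \<open>FEq 0 0\<close> fills it up.\<close>
    define \<phi> where "\<phi> = FNeg (FEx 1 (FConj (\<lambda>i. if i = 0 then FRel Supp [0, 1]
       else if i \<le> m then FNeg (FEq 1 (i + 1)) else FEq 0 0)))"
    have SM: "S \<subseteq> dom M" using Kn_wf[OF K(1)] unfolding S_def by fastforce
    have em: "e i \<in> dom M" for i
    proof (cases "2 \<le> i \<and> i < m + 2")
      case True
      then have "us ! (i - 2) \<in> set us" by (intro nth_mem) (auto simp: m_def)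
      then show ?thesis using True us SM by (auto simp: e_def)
    qed (use gu(2) in \<open>auto simp: e_def\<close>)
    have "(\<Union>i. fv (if i = 0 then FRel Supp [0, 1] else if i \<le> m then FNeg (FEq 1 (i + 1)) else FEq 0 0)) \<subseteq> {..m + 2}"
      by (auto split: if_splits)
    then have w: "wff \<phi>" unfolding \<phi>_def using finite_subset by auto
    have sat: "sat P e \<phi> \<longleftrightarrow> \<not> (\<exists>u\<in>dom P. [g, u] \<in> rels P Supp \<and> u \<notin> S)" for P :: "'a str"
    proof -
      have "(\<forall>i. sat P (e(1 := u)) (if i = 0 then FRel Supp [0, 1] else if i \<le> m then FNeg (FEq 1 (i + 1)) else FEq 0 0))
         \<longleftrightarrow> [g, u] \<in> rels P Supp \<and> u \<notin> S" for u
      proof -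
        have "u \<notin> S \<longleftrightarrow> (\<forall>j<m. u \<noteq> us ! j)" using us unfolding m_def by (metis in_set_conv_nth)
        also have "\<dots> \<longleftrightarrow> (\<forall>i. i \<noteq> 0 \<longrightarrow> i \<le> m \<longrightarrow> u \<noteq> e (i + 1))"
        proof (intro iffI allI impI)
          fix i assume "\<forall>j<m. u \<noteq> us ! j" "i \<noteq> 0" "i \<le> m"
          then show "u \<noteq> e (i + 1)" by (auto simp: e_def)
        next
          fix j assume *: "\<forall>i. i \<noteq> 0 \<longrightarrow> i \<le> m \<longrightarrow> u \<noteq> e (i + 1)" "j < m"
          then show "u \<noteq> us ! j" using *(1)[rule_format, of "Suc j"] *(2) by (simp add: e_def)
        qed
        finally have S: "u \<notin> S \<longleftrightarrow> (\<forall>i. i \<noteq> 0 \<longrightarrow> i \<le> m \<longrightarrow> u \<noteq> e (i + 1))" .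
        have e0: "e 0 = g" by (simp add: e_def)
        show ?thesis unfolding S by (auto simp: e0)
      qed
      then show ?thesis unfolding \<phi>_def by simp
    qed
    have "sat M e \<phi>" unfolding sat by (auto simp: S_def)
    then have "sat N e \<phi>" using el[OF w] em by blast
    moreover have "u \<in> dom N" using Kn_wf[OF K(2) gu(1)] by simp
    ultimately show ?thesis using gu(1) SM unfolding sat by blast
  qed
qed

section \<open>Cardinalities\<close>

abbreviation cle :: "'a set \<Rightarrow> 'b set \<Rightarrow> bool" where
  "cle A B \<equiv> (card_of A, card_of B) \<in> ordLeq"

abbreviation ceq :: "'a set \<Rightarrow> 'b set \<Rightarrow> bool" where
  "ceq A B \<equiv> (card_of A, card_of B) \<in> ordIso"

lemma cle_trans: "cle A B \<Longrightarrow> cle B C \<Longrightarrow> cle A C"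
  by (rule ordLeq_transitive)

lemma ceq_iff: "ceq A B \<longleftrightarrow> cle A B \<and> cle B A"
  by (rule ordIso_iff_ordLeq)

lemma cle_inj: "inj_on f A \<Longrightarrow> f ` A \<subseteq> B \<Longrightarrow> cle A B"
  using card_of_ordLeq by blast

lemma cle_Un: "infinite C \<Longrightarrow> cle A C \<Longrightarrow> cle B C \<Longrightarrow> cle (A \<union> B) C"
  by (rule card_of_Un_ordLeq_infinite_Field) (simp_all add: Field_card_of card_of_card_order_on)

lemma cle_Times: "infinite C \<Longrightarrow> cle A C \<Longrightarrow> cle B C \<Longrightarrow> cle (A \<times> B) C"
  by (rule card_of_Times_ordLeq_infinite_Field) (simp_all add: Field_card_of card_of_card_order_on)

lemma cle_refl: "cle A A"
  by (rule card_of_mono1) simp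

lemma cle_finite:
  assumes "finite A" "infinite B" shows "cle A B"
proof -
  obtain C where "finite C" "card C = card A" "C \<subseteq> B" using infinite_arbitrarily_large[OF assms(2)] by blast
  moreover from this obtain h where "bij_betw h A C" using finite_same_card_bij assms(1) by metis
  ultimately show ?thesis by (intro cle_inj[of h]) (auto simp: bij_betw_def)
qed

lemma cle_image: "cle A C \<Longrightarrow> cle (f ` A) C"
  using card_of_image cle_trans by blast

lemma cle_finite_subsets:
  assumes "infinite A" shows "cle {X. X \<subseteq> A \<and> finite X} A"
proof -
  have L: "cle {xs. set xs \<subseteq> A \<and> length xs = m} A" for m
  proof (induction m)
    case 0
    have "{xs. set xs \<subseteq> A \<and> length xs = 0} = {[]}" by auto
    then show ?case using cle_finite[OF _ assms, of "{[]}"] by simp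
  next
    case (Suc m)
    have "{xs. set xs \<subseteq> A \<and> length xs = Suc m} = case_prod (#) ` (A \<times> {xs. set xs \<subseteq> A \<and> length xs = m})"
      by (auto simp: length_Suc_conv image_iff)
    then show ?case using cle_image[OF cle_Times[OF assms cle_refl Suc]] by simp
  qed
  have "cle (\<Union>m\<in>UNIV. {xs. set xs \<subseteq> A \<and> length xs = m}) A"
    by (rule card_of_UNION_ordLeq_infinite) (use assms L infinite_iff_card_of_nat in auto)
  moreover have "{X. X \<subseteq> A \<and> finite X} \<subseteq> set ` (\<Union>m\<in>UNIV. {xs. set xs \<subseteq> A \<and> length xs = m})"
  proof
    fix X assume "X \<in> {X. X \<subseteq> A \<and> finite X}"
    then obtain xs where "set xs = X" "X \<subseteq> A" using finite_list by blast
    then show "X \<in> set ` (\<Union>m\<in>UNIV. {xs. set xs \<subseteq> A \<and> length xs = m})" by auto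
  qed
  ultimately show ?thesis using cle_image card_of_mono1 cle_trans by meson
qed

lemma cle_cdom:
  fixes J :: "'i set" assumes "infinite J" shows "cle (cdom n J) J"
proof -
  have JJ: "cle J J" by (rule cle_refl)
  have K: "cle (nsub n J) J"
  proof -
    have "nsub n J \<subseteq> {X. X \<subseteq> J \<and> finite X}" by (auto simp: nsub_def)
    then show ?thesis using cle_finite_subsets[OF assms] card_of_mono1 cle_trans by blast
  qed
  have G: "cle {g. g \<subseteq> nsub n J \<and> finite g} J"
  proof (cases "finite (nsub n J)")
    case True
    then show ?thesis using assms by (intro cle_finite) auto
  next
    case False
    then show ?thesis using cle_finite_subsets K cle_trans by blast
  qed
  have B: "cle (UNIV :: bool set) J" using assms by (intro cle_finite) auto
  let ?S = "CI ` J \<union> (CK ` nsub n J \<union> (range CH \<union> (CG ` {g. g \<subseteq> nsub n J \<and> finite g} \<union>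
     (case_prod CGs ` (nsub n J \<times> {g. g \<subseteq> nsub n J \<and> finite g}) \<union> case_prod CHs ` (nsub n J \<times> UNIV)))))"
  have "cdom n J \<subseteq> ?S"
  proof
    fix x assume "x \<in> cdom n J" then show "x \<in> ?S" by (cases x) (auto simp: image_iff)
  qed
  moreover have "cle ?S J"
    by (intro cle_Un cle_image cle_Times assms JJ K G B)
  ultimately show ?thesis using card_of_mono1 cle_trans by blast
qed

lemma ceq_cdom:
  fixes J :: "'i set" assumes "infinite J" shows "ceq (cdom n J) J"
proof -
  have "cle J (cdom n J)" by (rule cle_inj[of CI]) (auto simp: inj_on_def)
  then show ?thesis using cle_cdom[OF assms] ceq_iff by blast
qed

lemma ceq_crd:
  fixes J :: "'i set"
  assumes "crd n f J c M" "infinite (dom M)"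
  shows "infinite J" "ceq (dom M) J"
proof -
  have i: "inj_on f (cdom n J)" and d: "dom M = f ` cdom n J" using assms(1) crd_dom by (auto simp: crd_def)
  show iJ: "infinite J" using finite_cdom[of J n] assms(2) d by auto
  have "ceq (cdom n J) (dom M)" using i d card_of_ordIso bij_betw_def by metis
  then show "ceq (dom M) J" using ceq_cdom[OF iJ] ordIso_symmetric ordIso_transitive by metis
qed

lemma card_aleph_ceq: "card_aleph k (A :: 'a set) \<Longrightarrow> ceq A (B :: 'a set) \<Longrightarrow> card_aleph k B"
proof (cases k)
  case 0
  assume "card_aleph k A" "ceq A B"
  then show ?thesis using 0 ordIso_symmetric ordIso_transitive by (metis card_aleph.simps(1))
next
  case (Suc m)
  assume *: "card_aleph k A" "ceq A B"
  then obtain C :: "'a set" where "card_aleph m C" "(card_of A, cardSuc (card_of C)) \<in> ordIso"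
    unfolding Suc card_aleph.simps by blast
  then show ?thesis using * Suc ordIso_symmetric ordIso_transitive by (metis card_aleph.simps(2))
qed

lemma card_aleph_unique: "card_aleph k (A :: 'a set) \<Longrightarrow> card_aleph k (B :: 'a set) \<Longrightarrow> ceq A B"
proof (induction k arbitrary: A B)
  case 0
  then show ?case using ordIso_symmetric ordIso_transitive by (metis card_aleph.simps(1))
next
  case (Suc k)
  then obtain C D :: "'a set" where "card_aleph k C" "(card_of A, cardSuc (card_of C)) \<in> ordIso"
    "card_aleph k D" "(card_of B, cardSuc (card_of D)) \<in> ordIso"
    unfolding card_aleph.simps by blast
  moreover from this have "(cardSuc (card_of C), cardSuc (card_of D)) \<in> ordIso"
    using Suc.IH cardSuc_invar_ordIso[of "card_of C" "card_of D"] card_of_Card_order by blast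
  ultimately show ?case using ordIso_symmetric ordIso_transitive by metis
qed

lemma card_aleph_infinite: "card_aleph k (A :: 'a set) \<Longrightarrow> infinite A"
proof (induction k arbitrary: A)
  case 0
  then show ?case using infinite_iff_natLeq_ordLeq[of A] ordIso_symmetric ordIso_imp_ordLeq by auto
next
  case (Suc k)
  then obtain C :: "'a set" where C: "card_aleph k C" "(card_of A, cardSuc (card_of C)) \<in> ordIso"
    unfolding card_aleph.simps by blast
  then have "infinite (Field (cardSuc (card_of C)))"
    using Suc.IH cardSuc_finite[of "card_of C"] by (simp add: Field_card_of card_of_card_order_on)
  moreover have "ceq (Field (cardSuc (card_of C))) A"
    using C(2) card_of_Field_ordIso[of "cardSuc (card_of C)"] cardSuc_Card_order[OF card_of_Card_order]
      ordIso_symmetric ordIso_transitive by metis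
  ultimately show ?case using card_of_ordIso_finite by blast
qed

lemma card_aleph_between:
  fixes A B C :: "'a set"
  assumes "card_aleph k A" "card_aleph k C" "cle A B" "cle B C"
  shows "card_aleph k B"
proof -
  have "cle C A" using card_aleph_unique[OF assms(2,1)] ceq_iff by blast
  then have "ceq A B" using assms cle_trans ceq_iff by blast
  then show ?thesis using card_aleph_ceq assms(1) by blast
qed

lemma Kl_inf: "0 < n \<Longrightarrow> Kl n k M \<Longrightarrow> infinite (srt M SI)"
proof -
  assume n: "0 < n" and M: "Kl n k M"
  obtain f c where "crd n f (srt M SI) c M" using coords_id[OF n] M unfolding Kl_def by blast
  then show ?thesis using ceq_crd(1) M card_aleph_infinite unfolding Kl_def by blast
qed

text \<open>Models of size aleph_k have infinitely many indices, so back-and-forth applies. From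
  here on \<open>csub\<close> can replace elementarity throughout.\<close>

lemma Kl_leK_iff: "2 \<le> n \<Longrightarrow> Kl n k M \<Longrightarrow> leK n M N \<longleftrightarrow> csub n M N"
  using csub_leK leK_csub Kl_inf by (metis gr0I not_numeral_le_zero)

lemma Kl_between:
  assumes "Kl n k M" "Kl n k N" "csub n M X" "csub n X N"
  shows "Kl n k X"
  using assms card_aleph_between[of k "dom M" "dom N" "dom X"] csub_Kn(1)[OF assms(4)]
    card_of_mono1[OF csub_dom[OF assms(3)]] card_of_mono1[OF csub_dom[OF assms(4)]]
  unfolding Kl_def by blast

lemma Kl_mimg:
  fixes h :: "'u \<Rightarrow> 'u"
  assumes "0 < n" "Kl n k M" "inj_on h (dom M)"
  shows "Kl n k (mimg h M)"
proof -
  have "bij_betw h (dom M) (h ` dom M)" using assms(3) by (simp add: bij_betw_def)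
  then have "ceq (dom M) (h ` dom M)" using card_of_ordIso by blast
  then have "card_aleph k (dom (mimg h M))" using card_aleph_ceq assms(2) unfolding Kl_def dom_mimg by blast
  then show ?thesis using assms Kn_mimg[OF assms(1) _ assms(3)] unfolding Kl_def by blast
qed

text \<open>The type of elements leaves room for copies of \<open>M\<close>: the \<open>n\<close>-sets containing one new index \<open>a\<close> are
  already \<open>|M|\<close> many elements outside \<open>M\<close>.\<close>
lemma room_for_copy:
  assumes n: "2 \<le> n" and MB: "csub n M B" and a: "a \<in> srt B SI - srt M SI" and i: "infinite (dom M)"
  shows "cle (dom M) (- dom M)"
proof -
  have n0: "0 < n" using n by simp
  have K: "Kn n M" "Kn n B" using MB csub_Kn by blast+
  have sub: "srt M SI \<subseteq> srt B SI" using csub_srt[OF MB, of SI] by auto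
  obtain f0 c0 where f0: "crd n f0 (srt M SI) c0 M" "\<And>i. i \<in> srt M SI \<Longrightarrow> f0 (CI i) = i"
    using coords_id[OF n0 K(1)] by blast
  obtain f c where f: "crd n f (srt B SI) c B" "mimg f (cstr n (srt M SI) c) = M"
    using csub_coords[OF n0 MB f0] by blast
  have fi: "inj_on f (cdom n (srt B SI))" using f(1) by (simp add: crd_def)
  have dM: "dom M = f ` cdom n (srt M SI)" using f(2) by (metis dom_cstr dom_mimg)
  have iJ: "infinite (srt M SI)" and eJ: "ceq (dom M) (srt M SI)" using ceq_crd[OF f0(1) i] by blast+
  \<comment> \<open>With \<open>n - 2\<close> fixed indices, the index \<open>a\<close> and one
    varying \<open>i\<close> make an \<open>n\<close>-set, so there are as many new stalks as there
    are choices of \<open>i\<close>.\<close>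
  obtain F where F: "finite F" "card F = n - 2" "F \<subseteq> srt M SI" using infinite_arbitrarily_large[OF iJ] by blast
  define S where "S = srt M SI - F"
  define h where "h i = f (CK (insert a (insert i F)))" for i
  have u: "insert a (insert i F) \<in> nsub n (srt B SI)" "insert a (insert i F) \<notin> nsub n (srt M SI)" if "i \<in> S" for i
    using that F n a sub by (auto simp: nsub_def S_def card_insert_if)
  have "inj_on h S"
  proof (rule inj_onI)
    fix i j assume ij: "i \<in> S" "j \<in> S" "h i = h j"
    then have "insert a (insert i F) = insert a (insert j F)"
      using inj_onD[OF fi, of "CK (insert a (insert i F))" "CK (insert a (insert j F))"] u[OF ij(1)] u[OF ij(2)]
      unfolding h_def by simp
    moreover have "i \<notin> F" "j \<notin> F" "a \<noteq> i" "a \<noteq> j" using ij a by (auto simp: S_def)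
    ultimately show "i = j" by (metis insert_iff)
  qed
  moreover have "h ` S \<subseteq> - dom M"
  proof -
    have "h i \<notin> dom M" if i: "i \<in> S" for i
    proof
      assume "h i \<in> dom M"
      then obtain x where x: "h i = f x" "cin n (srt M SI) x" unfolding dM by auto
      have "CK (insert a (insert i F)) = x"
        using inj_onD[OF fi, of "CK (insert a (insert i F))" x] x u[OF i] cin_mono[OF sub x(2)] unfolding h_def by simp
      then show False using x(2) u[OF i] by auto
    qed
    then show ?thesis by blast
  qed
  ultimately have SM: "cle S (- dom M)" by (rule cle_inj)
  have "infinite S" using iJ F(1) by (simp add: S_def)
  moreover have "srt M SI = F \<union> S" using F(3) by (auto simp: S_def)
  ultimately have "cle (srt M SI) S" using cle_Un[of S F S] cle_finite[OF F(1)] cle_refl by metis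
  then show ?thesis using eJ SM cle_trans ceq_iff by blast
qed

section \<open>Amalgamation\<close>

text \<open>The working form of \<open>kemb\<close>, with \<open>csub\<close> in place of
  \<open>leK\<close>; the two agree on models of size aleph_k.\<close>

definition iemb :: "nat \<Rightarrow> ('u \<Rightarrow> 'u) \<Rightarrow> 'u str \<Rightarrow> 'u str \<Rightarrow> bool" where
  "iemb n h M N = (inj_on h (dom M) \<and> csub n (mimg h M) N)"

lemma kemb_iff:
  assumes "2 \<le> n" "Kl n k M" shows "kemb n h M N \<longleftrightarrow> iemb n h M N"
proof -
  have n0: "0 < n" using assms(1) by simp
  have "leK n (mimg h M) N \<longleftrightarrow> csub n (mimg h M) N" if "inj_on h (dom M)"
    using Kl_leK_iff[OF assms(1) Kl_mimg[OF n0 assms(2) that]] .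
  then show ?thesis using assms(2) unfolding kemb_def iemb_def img_eq_mimg Kl_def by blast
qed

lemma iemb_comp:
  assumes "0 < n" "iemb n g M N" "iemb n h N P" shows "iemb n (h \<circ> g) M P"
proof -
  have s: "g ` dom M \<subseteq> dom N" using assms(2) csub_dom unfolding iemb_def by (metis dom_mimg)
  have "inj_on (h \<circ> g) (dom M)" using assms(2,3) s unfolding iemb_def by (meson comp_inj_on inj_on_subset)
  moreover have "csub n (mimg h (mimg g M)) (mimg h N)" using assms csub_mimg unfolding iemb_def by blast
  ultimately show ?thesis using assms(3) csub_trans unfolding iemb_def mimg_mimg by blast
qed

lemma mimg_id: "mimg id M = M"
  by (simp add: mimg_def)

lemma iemb_id: "csub n M N \<Longrightarrow> iemb n id M N"
  by (simp add: iemb_def mimg_id)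

lemma mimg_cong_Kn:
  assumes "Kn n M" "\<And>x. x \<in> dom M \<Longrightarrow> f x = g x" shows "mimg f M = mimg g M"
proof -
  have "map f ` rels M r = map g ` rels M r" for r
  proof (intro image_cong refl)
    fix xs assume "xs \<in> rels M r"
    then have "set xs \<subseteq> dom M" using Kn_wf[OF assms(1)] by blast
    then show "map f xs = map g xs" using assms(2) by (intro map_cong) auto
  qed
  moreover have "f ` dom M = g ` dom M" using assms(2) by (intro image_cong) auto
  ultimately show ?thesis by (simp add: mimg_def)
qed

lemma mimg_fix: "Kn n M \<Longrightarrow> (\<And>x. x \<in> dom M \<Longrightarrow> f x = x) \<Longrightarrow> mimg f M = M"
  using mimg_cong_Kn[of n M f id] by (simp add: mimg_id)

text \<open>The labels of the new indices are left to the caller, so that two extensions of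
  \<open>B\<close> can be given new labels that are disjoint from each other.\<close>

lemma iemb_coords:
  fixes fB :: "'i cel \<Rightarrow> 'u"
  assumes n: "0 < n" and e: "iemb n e B X" and fB: "crd n fB JB cB B" and J: "JB \<subseteq> JX"
    and t: "bij_betw \<tau> (JX - JB) (srt X SI - e ` srt B SI)"
  shows "\<exists>fX cX. crd n fX JX cX X \<and> (\<forall>x\<in>cdom n JB. fX x = e (fB x)) \<and>
    (\<forall>w\<in>nsub (Suc n) JB. \<forall>v\<in>nsub n w. cX v w = cB v w)"
proof -
  have ei: "inj_on e (dom B)" and sub: "csub n (mimg e B) X" using e by (auto simp: iemb_def)
  have eB: "crd n (e \<circ> fB) JB cB (mimg e B)" using crd_mimg[OF fB ei] .
  define \<sigma> where "\<sigma> i = (if i \<in> JB then e (fB (CI i)) else \<tau> i)" for i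
  have bJ: "(\<lambda>i. (e \<circ> fB) (CI i)) ` JB = e ` srt B SI"
    using crd_SI[OF n fB] by (simp add: image_image)
  have s1: "\<sigma> ` JB = e ` srt B SI" unfolding bJ[symmetric] by (intro image_cong) (auto simp: \<sigma>_def)
  have s2: "\<sigma> ` (JX - JB) = srt X SI - e ` srt B SI"
    using t unfolding bij_betw_def by (metis (no_types, lifting) DiffD2 \<sigma>_def image_cong)
  have eS: "e ` srt B SI \<subseteq> srt X SI" using csub_srt[OF sub, of SI] unfolding srt_mimg by blast
  have sX: "\<sigma> ` JX = srt X SI"
  proof -
    have "JX = JB \<union> (JX - JB)" using J by blast
    then have "\<sigma> ` JX = \<sigma> ` JB \<union> \<sigma> ` (JX - JB)" by (metis image_Un)
    then show ?thesis unfolding s1 s2 using eS by blast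
  qed
  have si: "inj_on \<sigma> JX"
  proof (rule inj_onI)
    fix x y assume xy: "x \<in> JX" "y \<in> JX" "\<sigma> x = \<sigma> y"
    have iB: "inj_on (\<lambda>i. (e \<circ> fB) (CI i)) JB" using eB inj_CI unfolding crd_def by blast
    consider "x \<in> JB" "y \<in> JB" | "x \<in> JB" "y \<notin> JB" | "x \<notin> JB" "y \<in> JB" | "x \<notin> JB" "y \<notin> JB" by blast
    then show "x = y"
    proof cases
      case 1 then show ?thesis using xy(3) inj_onD[OF iB, of x y] by (simp add: \<sigma>_def)
    next
      case 2
      then have "\<sigma> x \<in> e ` srt B SI" "\<sigma> y \<notin> e ` srt B SI" using s1 s2 xy by blast+
      then show ?thesis using xy(3) by simp
    next
      case 3
      then have "\<sigma> y \<in> e ` srt B SI" "\<sigma> x \<notin> e ` srt B SI" using s1 s2 xy by blast+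
      then show ?thesis using xy(3) by simp
    next
      case 4
      then show ?thesis using xy inj_onD[OF bij_betw_imp_inj_on[OF t], of x y] by (simp add: \<sigma>_def)
    qed
  qed
  have sI: "\<sigma> i \<in> srt X SI" if "i \<in> JX" for i using sX that by blast
  obtain fX cX where f: "inj_on fX (cdom n JX)" "csub n (mimg fX (cstr n JX cX)) X"
     "\<forall>i\<in>JX. fX (CI i) = \<sigma> i" "\<forall>x\<in>cdom n JB. fX x = (e \<circ> fB) x" "mimg fX (cstr n JX cX) = X"
    using ext_coords[OF n eB sub eB sub _ J J si sI] sX unfolding \<sigma>_def by auto
  interpret P: crd_pair n X "e \<circ> fB" fX JB JX cB cX
    by unfold_locales (use n eB sub csub_Kn f J in \<open>auto simp: crd_def\<close>)
  have "cX v w = cB v w" if "w \<in> nsub (Suc n) JB" "v \<in> nsub n w" for v w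
    using P.base_change[of "\<lambda>_. {}" "\<lambda>_. False", OF _ _ that] f(4) by simp
  moreover have "crd n fX JX cX X" unfolding crd_def using f(1) f(5)[symmetric] by (rule conjI)
  ultimately show ?thesis using f(4) by (intro exI[of _ fX] exI[of _ cX]) simp
qed

text \<open>The amalgam is the concrete structure on the labels of both sides, glued along those of
  \<open>B\<close>. Only \<open>R\<close> is kept pointwise, for \<open>e1\<close> and
  \<open>e2\<close> may move the rest of \<open>B\<close>; everything else is renamed outside
  \<open>R\<close>, which is where \<open>room\<close> is used.\<close>

lemma amalg:
  fixes X Y B :: "'u str"
  assumes n: "2 \<le> n" and K: "Kl n k X" "Kl n k Y" "Kl n k B"
    and e: "iemb n e1 B X" "iemb n e2 B Y"
    and R: "R \<subseteq> dom B" "\<And>x. x \<in> R \<Longrightarrow> e1 x = x" "\<And>x. x \<in> R \<Longrightarrow> e2 x = x" and room: "cle (dom B) (- R)"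
  shows "\<exists>P p q. Kl n k P \<and> iemb n p X P \<and> iemb n q Y P \<and> (\<forall>x\<in>dom B. p (e1 x) = q (e2 x)) \<and>
    (\<forall>x\<in>R. p x = x \<and> q x = x) \<and> p ` dom X \<inter> q ` dom Y = p ` e1 ` dom B"
proof -
  have n0: "0 < n" using n by simp
  \<comment> \<open>Three summands keep the labels of \<open>B\<close>, the new labels of
    \<open>X\<close> and the new labels of \<open>Y\<close> apart, even if \<open>X\<close> and
    \<open>Y\<close> overlap as sets.\<close>
  define JB :: "('u + 'u + 'u) set" where "JB = Inl ` srt B SI"
  define JX where "JX = JB \<union> (\<lambda>x. Inr (Inl x)) ` (srt X SI - e1 ` srt B SI)"
  define JY where "JY = JB \<union> (\<lambda>x. Inr (Inr x)) ` (srt Y SI - e2 ` srt B SI)"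
  have "bij_betw projl JB (srt B SI)" by (auto simp: JB_def bij_betw_def inj_on_def image_image)
  then obtain fB cB where fB: "crd n fB JB cB B" using coords_any[OF n0, of B projl JB] K(3) unfolding Kl_def by blast
  have dX: "JX - JB = (\<lambda>x. Inr (Inl x)) ` (srt X SI - e1 ` srt B SI)" by (auto simp: JX_def JB_def)
  have dY: "JY - JB = (\<lambda>x. Inr (Inr x)) ` (srt Y SI - e2 ` srt B SI)" by (auto simp: JY_def JB_def)
  have bX: "bij_betw (projl \<circ> projr) (JX - JB) (srt X SI - e1 ` srt B SI)"
    unfolding dX by (auto simp: bij_betw_def inj_on_def image_image)
  have bY: "bij_betw (projr \<circ> projr) (JY - JB) (srt Y SI - e2 ` srt B SI)"
    unfolding dY by (auto simp: bij_betw_def inj_on_def image_image)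
  have JXY: "JX \<inter> JY = JB" "JB \<subseteq> JX" "JB \<subseteq> JY" by (auto simp: JX_def JY_def JB_def)
  obtain fX cX where fX: "crd n fX JX cX X" "\<forall>x\<in>cdom n JB. fX x = e1 (fB x)"
     "\<forall>w\<in>nsub (Suc n) JB. \<forall>v\<in>nsub n w. cX v w = cB v w"
    using iemb_coords[OF n0 e(1) fB JXY(2) bX] by blast
  obtain fY cY where fY: "crd n fY JY cY Y" "\<forall>x\<in>cdom n JB. fY x = e2 (fB x)"
     "\<forall>w\<in>nsub (Suc n) JB. \<forall>v\<in>nsub n w. cY v w = cB v w"
    using iemb_coords[OF n0 e(2) fB JXY(3) bY] by blast
  \<comment> \<open>The two functions agree inside \<open>JB\<close>. On a set inside neither
    \<open>JX\<close> nor \<open>JY\<close> any value would do, and \<open>cY\<close> is a mere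
    default.\<close>
  define C where "C v w = (if w \<subseteq> JX then cX v w else cY v w)" for v w
  define J where "J = JX \<union> JY"
  have J: "JX \<subseteq> J" "JY \<subseteq> J" "JB \<subseteq> J" using JXY by (auto simp: J_def)
  have CX: "cstr n JX cX = cstr n JX C" by (rule cstr_cong[OF n0]) (auto simp: C_def nsub_def)
  have CY: "cstr n JY cY = cstr n JY C"
  proof (rule cstr_cong[OF n0])
    fix v w assume w: "w \<in> nsub (Suc n) JY" "v \<in> nsub n w"
    show "cY v w = C v w"
    proof (cases "w \<subseteq> JX")
      case True
      then have "w \<in> nsub (Suc n) JB" using w JXY(1) by (auto simp: nsub_def)
      then show ?thesis using True w(2) fX(3) fY(3) by (simp add: C_def)
    qed (simp add: C_def)
  qed
  have inf: "infinite (dom X)" "infinite (dom Y)" "infinite (dom B)"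
    using K card_aleph_infinite unfolding Kl_def by blast+
  have XB: "cle (dom X) (dom B)" "cle (dom Y) (dom B)"
    using K card_aleph_unique ceq_iff unfolding Kl_def by metis+
  have "cle JX (dom B)" "cle JY (dom B)"
    using ceq_crd(2)[OF fX(1) inf(1)] ceq_crd(2)[OF fY(1) inf(2)] XB ceq_iff cle_trans by metis+
  then have "cle J (dom B)" unfolding J_def by (rule cle_Un[OF inf(3)])
  moreover have iJ: "infinite J" using ceq_crd(1)[OF fX(1) inf(1)] J(1) infinite_super by blast
  ultimately have cJ: "cle (cdom n J) (dom B)" using cle_cdom[OF iJ] cle_trans by blast
  then have "cle (cdom n J) (- R)" using room cle_trans by blast
  then obtain \<phi> where \<phi>: "inj_on \<phi> (cdom n J)" "\<phi> ` cdom n J \<subseteq> - R" using card_of_ordLeq by metis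
  \<comment> \<open>Elements of \<open>R\<close> keep their names and all others go into the
    complement of \<open>R\<close>, so the two clauses cannot collide.\<close>
  define F where "F x = (if x \<in> cdom n JB \<and> fB x \<in> R then fB x else \<phi> x)" for x
  have Fi: "inj_on F (cdom n J)"
  proof (rule inj_onI)
    fix x y assume xy: "x \<in> cdom n J" "y \<in> cdom n J" "F x = F y"
    have iB: "inj_on fB (cdom n JB)" using fB by (simp add: crd_def)
    have "\<phi> x \<notin> R" "\<phi> y \<notin> R" using xy \<phi>(2) by blast+
    then show "x = y" using xy inj_onD[OF \<phi>(1), of x y] inj_onD[OF iB, of x y]
      unfolding F_def by (auto split: if_splits simp del: cdom_iff)
  qed
  define P where "P = mimg F (cstr n J C)"
  define p where "p = F \<circ> inv_into (cdom n JX) fX"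
  define q where "q = F \<circ> inv_into (cdom n JY) fY"
  have iX: "inj_on fX (cdom n JX)" and iY: "inj_on fY (cdom n JY)" using fX fY by (simp_all add: crd_def)
  have pX: "p (fX x) = F x" if "x \<in> cdom n JX" for x using inv_into_f_f[OF iX that] by (simp add: p_def)
  have qY: "q (fY x) = F x" if "x \<in> cdom n JY" for x using inv_into_f_f[OF iY that] by (simp add: q_def)
  have P: "crd n F J C P" using Fi by (simp add: crd_def P_def)
  have emb: "iemb n h Z P" if Z: "crd n g JZ cZ Z" "JZ \<subseteq> J" "cstr n JZ cZ = cstr n JZ C" "\<And>x. x \<in> cdom n JZ \<Longrightarrow> h (g x) = F x"
    for h Z g JZ cZ
  proof -
    have "mimg h Z = mimg (h \<circ> g) (cstr n JZ cZ)" using Z(1) unfolding crd_def by (simp add: mimg_mimg)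
    also have "\<dots> = mimg F (cstr n JZ C)" unfolding Z(3) using Z(4) by (intro mimg_cong) simp
    finally have "csub n (mimg h Z) P" using crd_restrict(1)[OF n0 P Z(2)] by simp
    moreover have "inj_on (h \<circ> g) (cdom n JZ)"
      using Z(4) inj_on_subset[OF Fi cdom_mono[OF Z(2)]] by (simp add: inj_on_def)
    then have "inj_on h (dom Z)" unfolding crd_dom[OF Z(1)] by (rule inj_on_imageI)
    ultimately show ?thesis by (simp add: iemb_def)
  qed
  have ep: "iemb n p X P" using emb[OF fX(1) J(1) CX pX] .
  have eq: "iemb n q Y P" using emb[OF fY(1) J(2) CY qY] .
  have BX: "cdom n JB \<subseteq> cdom n JX" "cdom n JB \<subseteq> cdom n JY" using cdom_mono JXY by blast+
  have c1: "p (e1 (fB x)) = F x" "q (e2 (fB x)) = F x" if "x \<in> cdom n JB" for x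
    using that fX(2) fY(2) pX[of x] qY[of x] BX by (metis subsetD)+
  have dB: "dom B = fB ` cdom n JB" using crd_dom[OF fB] .
  have cm: "p (e1 x) = q (e2 x)" if "x \<in> dom B" for x using that c1 unfolding dB by auto
  have fx: "p x = x \<and> q x = x" if "x \<in> R" for x
  proof -
    have "x \<in> fB ` cdom n JB" using that R(1) unfolding dB by (rule rev_subsetD)
    then obtain y where y: "y \<in> cdom n JB" "x = fB y" by blast
    then have "F y = x" using that by (simp add: F_def)
    then show ?thesis using c1[OF y(1)] y(2) R(2,3)[OF that] by simp
  qed
  have imX: "p ` dom X = F ` cdom n JX" unfolding crd_dom[OF fX(1)] image_image using pX by (intro image_cong) auto
  have imY: "q ` dom Y = F ` cdom n JY" unfolding crd_dom[OF fY(1)] image_image using qY by (intro image_cong) auto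
  have imB: "p ` e1 ` dom B = F ` cdom n JB" unfolding dB image_image using c1 by (intro image_cong) auto
  have dis: "p ` dom X \<inter> q ` dom Y = p ` e1 ` dom B"
    unfolding imX imY imB JXY(1)[symmetric] cdom_Int
    using inj_on_image_Int[OF Fi cdom_mono[OF J(1)] cdom_mono[OF J(2)]] by simp
  have "p ` dom X \<subseteq> dom P" "inj_on p (dom X)" using csub_dom[of n "mimg p X" P] ep by (simp_all add: iemb_def)
  then have "cle (dom X) (dom P)" by (intro cle_inj[of p])
  moreover have "cle (dom P) (dom B)" unfolding crd_dom[OF P] using cJ by (rule cle_image)
  ultimately have "Kl n k P" using card_aleph_between K(1,3) crd_Kn[OF n0 P] unfolding Kl_def by blast
  then show ?thesis using ep eq cm fx dis by blast
qed

text \<open>Inside \<open>Z\<close> the base points of \<open>Y\<close> differ from those of \<open>X\<close> by \<open>\<gamma> u\<close>. Only the part of \<open>\<gamma> u\<close> over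
  the indices of \<open>X\<close> influences \<open>Q\<close> on these stalks, and that part can be undone inside \<open>Y\<close>.\<close>
lemma embed_over_common_part:
  assumes n: "0 < n" and s: "csub n X Z" "csub n Y Z" "csub n M X" "csub n M Y" and I: "srt X SI \<subseteq> srt Y SI"
  shows "\<exists>t. iemb n t X Y \<and> (\<forall>x\<in>dom M. t x = x) \<and> (\<forall>i\<in>srt X SI. t i = i)"
proof -
  let ?I = "srt M SI" and ?J = "srt X SI" and ?L = "srt Y SI" and ?Z = "srt Z SI"
  have K: "Kn n M" "Kn n X" "Kn n Y" "Kn n Z" using s csub_Kn by blast+
  have IJ: "?I \<subseteq> ?J" and LZ: "?L \<subseteq> ?Z" and JZ: "?J \<subseteq> ?Z" using csub_srt[OF s(3), of SI] csub_srt[OF s(2), of SI] csub_srt[OF s(1), of SI] by auto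
  obtain f0 c0 where f0: "crd n f0 ?I c0 M" "\<And>i. i \<in> ?I \<Longrightarrow> f0 (CI i) = i" using coords_id[OF n K(1)] by blast
  obtain f c where f: "crd n f ?J c X" "\<forall>i\<in>?J. f (CI i) = i" "\<forall>x\<in>cdom n ?I. f x = f0 x"
    using csub_coords[OF n s(3) f0] by blast
  obtain h d where h: "crd n h ?L d Y" "\<forall>i\<in>?L. h (CI i) = i" "\<forall>x\<in>cdom n ?I. h x = f0 x"
    using csub_coords[OF n s(4) f0] by blast
  obtain F C where F: "crd n F ?Z C Z" "mimg F (cstr n ?J C) = X" "\<forall>i\<in>?Z. F (CI i) = i" "\<forall>x\<in>cdom n ?J. F x = f x"
    using csub_coords[OF n s(1) f(1)] f(2) by blast
  have Fi: "inj_on F (cdom n ?Z)" using F(1) by (simp add: crd_def)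
  interpret H: crd_pair n Z h F ?L ?Z d C
    by unfold_locales (use n K h F s csub_refl[OF K(4)] LZ in \<open>auto simp: crd_def\<close>)
  have ZF: "Z = H.B.C.M" using F(1) by (simp add: crd_def)
  have "\<exists>\<gamma>. finite \<gamma> \<and> \<gamma> \<subseteq> nsub n ?Z \<and> h (CGs u {}) = F (CGs u \<gamma>)" "\<exists>\<mu>. h (CHs u False) = F (CHs u \<mu>)"
    if u: "u \<in> nsub n ?L" for u
  proof -
    have "h (CGs u {}) \<in> srt H.B.C.M SGs" using H.A.srtN(5)[OF u, of "{}"] ZF by simp
    then obtain u' \<gamma> where g: "h (CGs u {}) = F (CGs u' \<gamma>)" "u' \<in> nsub n ?Z" "finite \<gamma>" "\<gamma> \<subseteq> nsub n ?Z"
      by (auto simp: H.B.C.srt_M)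
    have "F (CK u) = F (CK u')" using H.A.prg_f[OF u, of "{}"] H.B.prg_f[OF g(2-4)] H.CK[OF u] g(1) by simp
    then have "u = u'" using H.B.C.f_eq[of "CK u" "CK u'"] H.nJL[OF u] g(2) by simp
    then show "\<exists>\<gamma>. finite \<gamma> \<and> \<gamma> \<subseteq> nsub n ?Z \<and> h (CGs u {}) = F (CGs u \<gamma>)" using g by blast
    have "h (CHs u False) \<in> srt H.B.C.M SHs" using H.A.srtN(6)[OF u, of False] ZF by simp
    then obtain u' \<mu> where g: "h (CHs u False) = F (CHs u' \<mu>)" "u' \<in> nsub n ?Z"
      by (auto simp: H.B.C.srt_M)
    have "F (CK u) = F (CK u')" using H.A.prh_f[OF u, of False] H.B.prh_f[OF g(2)] H.CK[OF u] g(1) by simp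
    then have "u = u'" using H.B.C.f_eq[of "CK u" "CK u'"] H.nJL[OF u] g(2) by simp
    then show "\<exists>\<mu>. h (CHs u False) = F (CHs u \<mu>)" using g by blast
  qed
  then obtain \<gamma> \<mu> where g: "\<And>u. u \<in> nsub n ?L \<Longrightarrow> finite (\<gamma> u) \<and> \<gamma> u \<subseteq> nsub n ?Z \<and> h (CGs u {}) = F (CGs u (\<gamma> u))"
    and m: "\<And>u. u \<in> nsub n ?L \<Longrightarrow> h (CHs u False) = F (CHs u (\<mu> u))" by metis
  have JL: "nsub n ?J \<subseteq> nsub n ?L" "nsub n ?I \<subseteq> nsub n ?J" using nsub_mono I IJ by blast+
  \<comment> \<open>Over \<open>M\<close> the coordinates of \<open>X\<close> and \<open>Y\<close>
    coincide, so no correction occurs there; this is why the embedding fixes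
    \<open>M\<close>.\<close>
  have gm0: "\<gamma> u = {} \<and> \<mu> u = False" if u: "u \<in> nsub n ?I" for u
  proof -
    have uJ: "u \<in> nsub n ?J" "u \<in> nsub n ?L" "u \<in> nsub n ?Z" using u JL H.nJL by blast+
    have "F (CGs u (\<gamma> u)) = F (CGs u {})" using g[OF uJ(2)] h(3) F(4) f(3) u uJ by simp
    then have 1: "\<gamma> u = {}" using H.B.C.f_eq[of "CGs u (\<gamma> u)" "CGs u {}"] uJ(3) g[OF uJ(2)] by simp
    have "F (CHs u (\<mu> u)) = F (CHs u False)" using m[OF uJ(2)] h(3) F(4) f(3) u uJ by simp
    then have 2: "\<mu> u = False" using H.B.C.f_eq[of "CHs u (\<mu> u)" "CHs u False"] uJ(3) by simp
    show ?thesis using 1 2 by simp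
  qed
  \<comment> \<open>\<open>\<gamma> u\<close> may involve stalks of \<open>Z\<close> outside
    \<open>Y\<close>, so a base point of \<open>X\<close> need not belong to \<open>Y\<close>.
    Translating by the part of \<open>\<gamma> u\<close> over \<open>?J\<close> stays inside
    \<open>Y\<close> and leaves only the part outside \<open>?J\<close> as a difference from the
    base points of \<open>X\<close>. The shift \<open>\<mu>\<close> is a single bit and is undone
    completely.\<close>
  define sx where "sx u = h (CGs u (\<gamma> u \<inter> nsub n ?J))" for u
  define sy where "sy u = h (CHs u (\<mu> u))" for u
  have sxF: "sx u = F (CGs u (\<gamma> u - nsub n ?J))" and syF: "sy u = F (CHs u False)" if u: "u \<in> nsub n ?J" for u
  proof -
    have uL: "u \<in> nsub n ?L" using u JL by blast
    have "sym_diff (\<gamma> u \<inter> nsub n ?J) (\<gamma> u) = \<gamma> u - nsub n ?J" by auto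
    then show "sx u = F (CGs u (\<gamma> u - nsub n ?J))"
      using H.shift_CGs[OF uL, of "\<gamma> u" "\<gamma> u \<inter> nsub n ?J"] g[OF uL] JL(1) unfolding sx_def by auto
    show "sy u = F (CHs u False)" using H.shift_CHs[OF uL, of "\<mu> u" "\<mu> u"] m[OF uL] unfolding sy_def by simp
  qed
  interpret HY: crd_in n Y h ?L d
    by unfold_locales (use n K h csub_refl[OF K(3)] in \<open>auto simp: crd_def\<close>)
  have sec: "sx u \<in> srt Y SGs \<and> memb Y (prg Y (sx u)) = id ` u" "sy u \<in> srt Y SHs \<and> memb Y (prh Y (sy u)) = id ` u"
    if u: "u \<in> nsub n ?J" for u
  proof -
    have uL: "u \<in> nsub n ?L" using u JL by blast
    have "(\<lambda>i. h (CI i)) ` u = id ` u" using h(2) uL by (intro image_cong) (auto simp: nsub_def)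
    then show "sx u \<in> srt Y SGs \<and> memb Y (prg Y (sx u)) = id ` u" "sy u \<in> srt Y SHs \<and> memb Y (prh Y (sy u)) = id ` u"
      using HY.srtN(5,6)[OF uL] HY.prg_f[OF uL] HY.prh_f[OF uL] HY.f_CK[OF uL] g[OF uL] JL(1)
      unfolding sx_def sy_def by (simp_all add: le_infI2)
  qed
  obtain f' c' where f': "inj_on f' (cdom n ?J)" "csub n (mimg f' (cstr n ?J c')) Y" "\<forall>i\<in>?J. f' (CI i) = i"
     "\<forall>u\<in>nsub n ?J. f' (CGs u {}) = sx u \<and> f' (CHs u False) = sy u"
    using coords_exist[OF n K(3) inj_on_id _ sec, of ?J] I by auto
  have f'F: "f' (CI i) = F (CI i)" if "i \<in> ?J" for i using that F(3) f'(3) JZ by auto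
  interpret Q: crd_pair n Z f' F ?J ?Z c' C
    by unfold_locales (use n K f'(1) f'F F(1) csub_trans[OF f'(2) s(2)] csub_refl[OF K(4)] JZ in \<open>auto simp: crd_def\<close>)
  have "c' v w = C v w" if w: "w \<in> nsub (Suc n) ?J" "v \<in> nsub n w" for v w
  proof -
    have v: "v \<in> nsub n ?J" using w by (auto simp: nsub_def)
    \<comment> \<open>The remaining shifts avoid all stalks over \<open>?J\<close>, and
      \<open>v\<close> is such a stalk, so the coboundary term is empty.\<close>
    have "c' v w = (C v w \<noteq> (odd (card {u \<in> nsub n w - {v}. v \<in> \<gamma> u - nsub n ?J}) \<noteq> False))"
    proof (rule Q.base_change[of "\<lambda>u. \<gamma> u - nsub n ?J" "\<lambda>_. False", OF _ _ w])
      fix u assume u: "u \<in> nsub n ?J"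
      then have uL: "u \<in> nsub n ?L" using JL by blast
      show "finite (\<gamma> u - nsub n ?J) \<and> \<gamma> u - nsub n ?J \<subseteq> nsub n ?Z \<and> f' (CGs u {}) = F (CGs u (\<gamma> u - nsub n ?J))"
        using f'(4) u sxF[OF u] g[OF uL] by auto
      show "f' (CHs u False) = F (CHs u False)" using f'(4) u syF[OF u] by simp
    qed
    then show ?thesis using v by simp
  qed
  then have cs: "cstr n ?J c' = cstr n ?J C" by (rule cstr_cong[OF n])
  have FJ: "inj_on F (cdom n ?J)" using inj_on_subset[OF Fi cdom_mono[OF JZ]] .
  define t where "t = f' \<circ> inv_into (cdom n ?J) F"
  have tF: "t (F x) = f' x" if "x \<in> cdom n ?J" for x using inv_into_f_f[OF FJ that] by (simp add: t_def)
  have "mimg t X = mimg (t \<circ> F) (cstr n ?J C)" using F(2) by (metis mimg_mimg)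
  also have "\<dots> = mimg f' (cstr n ?J c')" unfolding cs using tF by (intro mimg_cong) simp
  finally have "csub n (mimg t X) Y" using f'(2) by simp
  moreover have "inj_on t (dom X)"
  proof -
    have "dom X = F ` cdom n ?J" using F(2) by (metis dom_cstr dom_mimg)
    moreover have "inj_on (t \<circ> F) (cdom n ?J)" using tF f'(1) by (simp add: inj_on_def)
    ultimately show ?thesis by (simp add: inj_on_imageI)
  qed
  ultimately have "iemb n t X Y" by (simp add: iemb_def)
  moreover have "t i = i" if "i \<in> ?J" for i using tF[of "CI i"] that F(3) f'(3) JZ by auto
  moreover have "t x = x" if x: "x \<in> dom M" for x
  proof -
    interpret W: crd_pair n Y f0 f' ?I ?J c0 c'
      by unfold_locales (use n K f0 f' s(4) IJ in \<open>auto simp: crd_def\<close>)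
    obtain y where y: "y \<in> cdom n ?I" "x = f0 y" using x crd_dom[OF f0(1)] by blast
    have "f0 y = f' y"
    proof (rule W.agree(1)[OF _ _ y(1)])
      fix u assume u: "u \<in> nsub n ?I"
      then have uJ: "u \<in> nsub n ?J" using JL by blast
      show "f0 (CGs u {}) = f' (CGs u {})" "f0 (CHs u False) = f' (CHs u False)"
        using f'(4) uJ gm0[OF u] h(3) u by (simp_all add: sx_def sy_def)
    qed
    moreover have yJ: "y \<in> cdom n ?J" using y(1) cdom_mono[OF IJ] by blast
    moreover have "F y = f0 y" using F(4) f(3) y(1) yJ by simp
    ultimately show ?thesis using tF[OF yJ] y(2) by simp
  qed
  ultimately show ?thesis by blast
qed

section \<open>Uniqueness triples\<close>

lemma amalgam_iff:
  assumes n: "2 \<le> n" and K: "Kl n k M" "Kl n k N" "Kl n k M1" "csub n M M1"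
  shows "amalgam n k a M N M1 f1 f2 N1 \<longleftrightarrow> Kl n k N1 \<and> iemb n f1 N N1 \<and> iemb n f2 M1 N1 \<and>
    (\<forall>x\<in>dom M. f1 x = x \<and> f2 x = x) \<and> f1 a \<in> srt N1 SI - f2 ` srt M1 SI"
proof -
  have n0: "0 < n" using n by simp
  have "nonfork n k M (mimg f2 M1) (f1 a) N1 \<longleftrightarrow> f1 a \<in> srt N1 SI - f2 ` srt M1 SI"
    if h: "Kl n k N1" "iemb n f2 M1 N1" "\<forall>x\<in>dom M. f2 x = x"
  proof -
    have i: "inj_on f2 (dom M1)" and s: "csub n (mimg f2 M1) N1" using h(2) by (auto simp: iemb_def)
    have K1: "Kl n k (mimg f2 M1)" using Kl_mimg[OF n0 K(3) i] .
    have "mimg f2 M = M" using h(3) K(1) by (intro mimg_fix) (auto simp: Kl_def)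
    then have "csub n M (mimg f2 M1)" using csub_mimg[OF n0 K(4) i] by simp
    then show ?thesis unfolding nonfork_def srt_mimg
      using K h K1 s Kl_leK_iff[OF n K(1)] Kl_leK_iff[OF n K1] by blast
  qed
  then show ?thesis unfolding amalgam_def img_eq_mimg
    using kemb_iff[OF n K(2)] kemb_iff[OF n K(3)] by blast
qed

lemma srt_dom: "Kn n M \<Longrightarrow> x \<in> srt M s \<Longrightarrow> x \<in> dom M"
  using Kn_wf[of n M "[x]" s] by (simp add: srt_def)

lemma uq_disjoint:
  assumes n: "2 \<le> n" and uq: "uq_triple n k a M N" and K: "Kl n k M2" "Kl n k Z"
    and s: "csub n M M2" "csub n M2 Z" "csub n N Z" and a: "a \<notin> dom M2"
  shows "dom N \<inter> dom M2 = dom M"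
proof -
  have n0: "0 < n" using n by simp
  have KM: "Kl n k M" "Kl n k N" and MN: "csub n M N" and aN: "a \<in> srt N SI - srt M SI" "a \<in> dom N - dom M"
    using uq leK_csub unfolding uq_triple_def basic_def by auto
  have Kn: "Kn n M2" using K(1) by (simp add: Kl_def)
  have am1: "amalgam n k a M N M2 id id Z"
    unfolding amalgam_iff[OF n KM K(1) s(1)]
    using K s aN a csub_srt[OF s(3), of SI] srt_dom[OF Kn] by (auto intro: iemb_id)
  have "infinite (dom M)" using KM(1) card_aleph_infinite by (auto simp: Kl_def)
  then have "cle (dom M) (- dom M)" using room_for_copy[OF n MN aN(1)] by blast
  then obtain P p q where P: "Kl n k P" "iemb n p N P" "iemb n q M2 P"
     "\<forall>x\<in>dom M. p x = x \<and> q x = x" "p ` dom N \<inter> q ` dom M2 = p ` dom M"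
    using amalg[OF n KM(2) K(1) KM(1) iemb_id[OF MN] iemb_id[OF s(1)], of "dom M"] by auto
  have pi: "inj_on p (dom N)" and ps: "csub n (mimg p N) P" using P(2) by (auto simp: iemb_def)
  have "p a \<in> srt P SI" using aN csub_srt[OF ps, of SI] unfolding srt_mimg by blast
  moreover have "p a \<notin> q ` srt M2 SI"
  proof
    assume "p a \<in> q ` srt M2 SI"
    then have "p a \<in> p ` dom M" using P(5) aN(2) srt_dom[OF Kn] by blast
    then show False using pi aN(2) csub_dom[OF MN] by (auto simp: inj_on_def subset_iff)
  qed
  ultimately have am2: "amalgam n k a M N M2 p q P"
    unfolding amalgam_iff[OF n KM K(1) s(1)] using P by blast
  have "leK n M M2" using Kl_leK_iff[OF n KM(1)] s(1) by blast
  then have "amalgam_equiv n k N M2 id id Z p q P"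
    using uq K(1) am1 am2 unfolding uq_triple_def by blast
  then obtain Ns ha hb where h: "kemb n hb P Ns" "\<forall>x\<in>dom N. ha (id x) = hb (p x)" "\<forall>x\<in>dom M2. ha (id x) = hb (q x)"
    unfolding amalgam_equiv_def by blast
  have hi: "inj_on hb (dom P)" using h(1) by (simp add: kemb_def)
  have dP: "p ` dom N \<subseteq> dom P" "q ` dom M2 \<subseteq> dom P"
    using P(2,3) csub_dom[of n "mimg p N" P] csub_dom[of n "mimg q M2" P] by (auto simp: iemb_def)
  \<comment> \<open>A common element of \<open>N\<close> and \<open>M2\<close> is sent to one
    element of \<open>Ns\<close>, along \<open>N\<close> and along \<open>M2\<close>. Both ways pass
    through the disjoint amalgam \<open>P\<close> by an injective map, so they meet already in
    \<open>P\<close>, that is, over \<open>M\<close>.\<close>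
  have "x \<in> dom M" if x: "x \<in> dom N" "x \<in> dom M2" for x
  proof -
    have "hb (p x) = hb (q x)" using h(2,3) x by (metis id_apply)
    then have "p x = q x" using inj_onD[OF hi] dP x by blast
    then have "p x \<in> p ` dom M" using P(5) x by blast
    then obtain m where "m \<in> dom M" "p x = p m" by blast
    then show ?thesis using inj_onD[OF pi, of x m] x csub_dom[OF MN] by blast
  qed
  then show ?thesis using csub_dom[OF MN] csub_dom[OF s(1)] by blast
qed

section \<open>Types of one-index extensions\<close>

text \<open>Equality of types is the transitive closure of \<open>gtp_at\<close>, so an embedding of
  the one-index extension \<open>N\<close> has to be carried across a single link. In the model
  \<open>W\<close> witnessing the link the images of \<open>N\<close> and \<open>Z\<close> share the
  new index, but the image of \<open>N\<close> need not lie inside that of \<open>Z\<close>;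
  \<open>embed_over_common_part\<close> repairs this.\<close>

lemma gtp_at_pull:
  assumes n: "2 \<le> n" and g: "gtp_at n k (b, M1, Z) (b', M, Z')" and N: "csub n M N" "srt N SI = insert a (srt M SI)"
    and h: "iemb n h N Z'" "\<And>x. x \<in> dom M \<Longrightarrow> h x = x" "h a = b'"
  shows "M1 = M \<and> (\<exists>h'. iemb n h' N Z \<and> (\<forall>x\<in>dom M. h' x = x) \<and> h' a = b)"
proof -
  have n0: "0 < n" using n by simp
  have M1: "M1 = M" and KZ: "Kl n k Z" "Kl n k Z'" and bZ: "b \<in> dom Z" and MZ: "csub n M Z" "csub n M Z'"
    using g leK_csub unfolding gtp_at_def gtrip_def by auto
  obtain W f q where W: "Kl n k W" "kemb n f Z W" "kemb n q Z' W" "\<forall>x\<in>dom M. f x = x \<and> q x = x" "f b = q b'"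
    using g M1 unfolding gtp_at_def by auto
  have KM: "Kn n M" "Kn n N" using N(1) csub_Kn by blast+
  have fW: "iemb n f Z W" and qW: "iemb n q Z' W" using W kemb_iff[OF n KZ(1)] kemb_iff[OF n KZ(2)] by blast+
  define e where "e = q \<circ> h"
  have eW: "iemb n e N W" unfolding e_def using iemb_comp[OF n0 h(1) qW] .
  have ei: "inj_on e (dom N)" and es: "csub n (mimg e N) W" using eW by (auto simp: iemb_def)
  have fi: "inj_on f (dom Z)" and fs: "csub n (mimg f Z) W" using fW by (auto simp: iemb_def)
  have eM: "e x = x" if "x \<in> dom M" for x using that h(2) W(4) by (simp add: e_def)
  have fM: "f x = x" if "x \<in> dom M" for x using that W(4) by simp
  have MX: "csub n M (mimg e N)" using csub_mimg[OF n0 N(1) ei] mimg_fix[OF KM(1) eM] by simp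
  have MY: "csub n M (mimg f Z)" using csub_mimg[OF n0 MZ(1) fi] mimg_fix[OF KM(1) fM] by simp
  have ea: "e a = f b" using h(3) W(5) by (simp add: e_def)
  \<comment> \<open>The image of \<open>N\<close> has just one index beyond \<open>M\<close>, and
    the link identifies it with the index \<open>f b\<close> coming from \<open>Z\<close>. Hence the
    inclusion of index sets that the embedding requires.\<close>
  have sX: "srt (mimg e N) SI = insert (f b) (srt M SI)"
    unfolding srt_mimg N(2) using eM srt_dom[OF KM(1)] ea by force
  have "f b \<in> srt W SI" using sX csub_srt[OF es, of SI] by blast
  then have "f b \<in> srt (mimg f Z) SI" using csub_srt[OF fs, of SI] bZ by auto
  then have "srt (mimg e N) SI \<subseteq> srt (mimg f Z) SI" unfolding sX using csub_srt[OF MY, of SI] by blast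
  from embed_over_common_part[OF n0 es fs MX MY this] obtain t where t: "iemb n t (mimg e N) (mimg f Z)"
     "\<forall>x\<in>dom M. t x = x" "\<forall>i\<in>srt (mimg e N) SI. t i = i" by blast
  let ?r = "inv_into (dom Z) f"
  have r: "?r (f x) = x" if "x \<in> dom Z" for x using inv_into_f_f[OF fi that] .
  have "mimg ?r (mimg f Z) = Z" unfolding mimg_mimg
    using r KZ(1) by (intro mimg_fix) (auto simp: Kl_def)
  moreover have "inj_on ?r (dom (mimg f Z))" by (simp add: inj_on_inv_into)
  ultimately have rW: "iemb n ?r (mimg f Z) Z" using csub_refl[of n Z] KZ(1) by (simp add: iemb_def Kl_def)
  have "iemb n e N (mimg e N)" using ei csub_refl csub_Kn(1)[OF es] by (simp add: iemb_def)
  from iemb_comp[OF n0 this iemb_comp[OF n0 t(1) rW]]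
  have "iemb n (?r \<circ> t \<circ> e) N Z" .
  moreover have "(?r \<circ> t \<circ> e) x = x" if x: "x \<in> dom M" for x
  proof -
    have "x \<in> dom Z" using x csub_dom[OF MZ(1)] by blast
    then show ?thesis using r[of x] fM[OF x] eM[OF x] t(2) x by simp
  qed
  moreover have "(?r \<circ> t \<circ> e) a = b" using ea t(3) sX r[OF bZ] by simp
  ultimately show ?thesis using M1 by blast
qed

lemma gtp_eq_pull:
  assumes n: "2 \<le> n" and N: "csub n M N" "srt N SI = insert a (srt M SI)" and g: "gtp_eq n k (b, M1, Z) (a, M, N)"
  shows "M1 = M \<and> (\<exists>h. iemb n h N Z \<and> (\<forall>x\<in>dom M. h x = x) \<and> h a = b)"
proof -
  define Q where "Q t = (case t of (b, M1, Z) \<Rightarrow> M1 = M \<and> (\<exists>h. iemb n h N Z \<and> (\<forall>x\<in>dom M. h x = x) \<and> h a = b))" for t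
  have step: "Q t" if "gtp_at n k t t'" "Q t'" for t t'
  proof -
    obtain b1 M' Z1 b2 M2 Z2 where t: "t = (b1, M', Z1)" "t' = (b2, M2, Z2)" by (metis prod_cases3)
    show ?thesis using that gtp_at_pull[OF n, of k b1 M' Z1 b2 M Z2 N a] N unfolding t Q_def by auto
  qed
  have Q0: "Q (a, M, N)" using iemb_id[OF csub_refl[OF csub_Kn(2)[OF N(1)]]] unfolding Q_def by (auto intro!: exI[of _ id])
  \<comment> \<open>The chain of links is followed backwards from \<open>(a, M, N)\<close>, where
    the identity is an embedding of \<open>N\<close>.\<close>
  have "tranclp (gtp_at n k) t (a, M, N) \<Longrightarrow> Q t" for t
    by (induction rule: converse_tranclp_induct) (use step Q0 in blast)+
  then show ?thesis using g unfolding gtp_eq_def Q_def by blast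
qed

text \<open>An amalgam of \<open>N\<close> with \<open>M1\<close> is extended to one of \<open>N'\<close> with \<open>M1\<close> by amalgamating it with \<open>N'\<close>
  over \<open>N\<close>.\<close>
lemma uq_transfer:
  assumes n: "2 \<le> n" and uq: "uq_triple n k a' M N'" and K: "Kl n k M" "Kl n k N" "csub n M N"
    and a: "a \<in> srt N SI - srt M SI"
    and h: "iemb n h N N'" "\<And>x. x \<in> dom M \<Longrightarrow> h x = x" "h a = a'"
  shows "uq_triple n k a M N"
proof -
  have n0: "0 < n" using n by simp
  have K': "Kl n k N'" using uq by (simp add: uq_triple_def)
  have aN: "a \<in> dom N - dom M" using a srt_dom[of n N a SI] csub_srt[OF K(3), of SI] K(2) by (auto simp: Kl_def)
  have hN: "h ` dom N \<subseteq> dom N'" using h(1) csub_dom[of n "mimg h N" N'] by (simp add: iemb_def)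
  have "infinite (dom M)" using K(1) card_aleph_infinite by (auto simp: Kl_def)
  then have "cle (dom M) (- dom M)" using room_for_copy[OF n K(3) a] by blast
  moreover have "cle (dom N) (dom M)" using K card_aleph_unique ceq_iff unfolding Kl_def by metis
  ultimately have rm: "cle (dom N) (- dom M)" using cle_trans by blast
  have ext: "\<exists>P p q. Kl n k P \<and> iemb n p N1 P \<and> amalgam n k a' M N' M1 q (p \<circ> f2) P \<and> (\<forall>x\<in>dom N. p (f1 x) = q (h x))"
    if am: "amalgam n k a M N M1 f1 f2 N1" and M1: "Kl n k M1" "csub n M M1" for M1 f1 f2 N1
  proof -
    have A: "Kl n k N1" "iemb n f1 N N1" "iemb n f2 M1 N1" "\<forall>x\<in>dom M. f1 x = x \<and> f2 x = x" "f1 a \<in> srt N1 SI - f2 ` srt M1 SI"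
      using am unfolding amalgam_iff[OF n K(1,2) M1] by auto
    \<comment> \<open>Amalgamation is over \<open>N\<close>, but only \<open>M\<close> can be kept
      pointwise, since \<open>f1\<close> and \<open>h\<close> may move the other elements of
      \<open>N\<close>.\<close>
    obtain P p q where P: "Kl n k P" "iemb n p N1 P" "iemb n q N' P" "\<forall>x\<in>dom N. p (f1 x) = q (h x)" "\<forall>x\<in>dom M. p x = x \<and> q x = x"
      using amalg[OF n A(1) K' K(2) A(2) h(1) csub_dom[OF K(3)] _ h(2) rm] A(4) by auto
    have ps: "csub n (mimg p N1) P" and pi: "inj_on p (dom N1)" using P(2) by (auto simp: iemb_def)
    have qa: "q a' = p (f1 a)" using P(4) aN h(3) by auto
    have "p (f1 a) \<in> srt P SI" using A(5) csub_srt[OF ps, of SI] unfolding srt_mimg by blast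
    moreover have "p (f1 a) \<notin> (p \<circ> f2) ` srt M1 SI"
    proof
      assume "p (f1 a) \<in> (p \<circ> f2) ` srt M1 SI"
      then obtain y where y: "y \<in> srt M1 SI" "p (f1 a) = p (f2 y)" by auto
      have "f2 y \<in> dom N1" using A(3) y(1) srt_dom[of n M1 y SI] M1(1) csub_dom[of n "mimg f2 M1" N1] by (auto simp: iemb_def Kl_def)
      moreover have "f1 a \<in> dom N1" using A(1,5) srt_dom[of n N1] by (auto simp: Kl_def)
      ultimately show False using inj_onD[OF pi y(2)] A(5) y(1) by auto
    qed
    ultimately have "amalgam n k a' M N' M1 q (p \<circ> f2) P"
      unfolding amalgam_iff[OF n K(1) K' M1] using P A(4) iemb_comp[OF n0 A(3) P(2)] qa by simp
    then show ?thesis using P by blast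
  qed
  have main: "(\<exists>f1 f2 N1. amalgam n k a M N M1 f1 f2 N1) \<and>
        (\<forall>f1 f2 Na g1 g2 Nb. amalgam n k a M N M1 f1 f2 Na \<longrightarrow> amalgam n k a M N M1 g1 g2 Nb \<longrightarrow>
            amalgam_equiv n k N M1 f1 f2 Na g1 g2 Nb)" if M1': "Kl n k M1 \<and> leK n M M1" for M1
  proof -
    have M1: "Kl n k M1" "csub n M M1" using M1' leK_csub by blast+
    have uq1: "\<exists>f1 f2 N1. amalgam n k a' M N' M1 f1 f2 N1"
      "\<And>f1 f2 Na g1 g2 Nb. amalgam n k a' M N' M1 f1 f2 Na \<Longrightarrow> amalgam n k a' M N' M1 g1 g2 Nb \<Longrightarrow>
            amalgam_equiv n k N' M1 f1 f2 Na g1 g2 Nb"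
      using uq M1' unfolding uq_triple_def by blast+
    obtain f1 f2 N1 where "amalgam n k a' M N' M1 f1 f2 N1" using uq1(1) by blast
    \<comment> \<open>Existence needs no extension: an amalgam for \<open>N'\<close> restricts along
      \<open>h\<close>, because \<open>h\<close> sends \<open>a\<close> to
      \<open>a'\<close>.\<close>
    then have "amalgam n k a M N M1 (f1 \<circ> h) f2 N1"
      unfolding amalgam_iff[OF n K(1) K' M1] amalgam_iff[OF n K(1,2) M1]
      using iemb_comp[OF n0 h(1)] h(2,3) by simp
    moreover have "amalgam_equiv n k N M1 f1 f2 Na g1 g2 Nb"
      if am: "amalgam n k a M N M1 f1 f2 Na" "amalgam n k a M N M1 g1 g2 Nb" for f1 f2 Na g1 g2 Nb
    proof -
      have KN: "Kl n k Na" "Kl n k Nb" using am by (auto simp: amalgam_def)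
      obtain P p q where P: "Kl n k P" "iemb n p Na P" "amalgam n k a' M N' M1 q (p \<circ> f2) P" "\<forall>x\<in>dom N. p (f1 x) = q (h x)"
        using ext[OF am(1) M1] by blast
      obtain P' p' q' where P': "Kl n k P'" "iemb n p' Nb P'" "amalgam n k a' M N' M1 q' (p' \<circ> g2) P'" "\<forall>x\<in>dom N. p' (g1 x) = q' (h x)"
        using ext[OF am(2) M1] by blast
      obtain Ns ha hb where E: "Kl n k Ns" "kemb n ha P Ns" "kemb n hb P' Ns" "\<forall>x\<in>dom N'. ha (q x) = hb (q' x)"
         "\<forall>x\<in>dom M1. ha ((p \<circ> f2) x) = hb ((p' \<circ> g2) x)"
        using uq1(2)[OF P(3) P'(3)] unfolding amalgam_equiv_def by blast
      have "iemb n (ha \<circ> p) Na Ns" "iemb n (hb \<circ> p') Nb Ns"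
        using iemb_comp[OF n0 P(2)] iemb_comp[OF n0 P'(2)] E(2,3) kemb_iff[OF n P(1)] kemb_iff[OF n P'(1)] by blast+
      then have "kemb n (ha \<circ> p) Na Ns" "kemb n (hb \<circ> p') Nb Ns" using kemb_iff[OF n KN(1)] kemb_iff[OF n KN(2)] by blast+
      moreover have "(ha \<circ> p) (f1 x) = (hb \<circ> p') (g1 x)" if "x \<in> dom N" for x
        using that P(4) P'(4) E(4) hN by auto
      moreover have "(ha \<circ> p) (f2 x) = (hb \<circ> p') (g2 x)" if "x \<in> dom M1" for x
        using that E(5) by simp
      ultimately show ?thesis unfolding amalgam_equiv_def using E(1) by blast
    qed
    ultimately show ?thesis by blast
  qed
  have "leK n M N" using Kl_leK_iff[OF n K(1)] K(3) by blast
  then show ?thesis unfolding uq_triple_def basic_def using K a aN main by blast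
qed

lemma onepoint_uq:
  fixes M N :: "'u str"
  assumes n: "2 \<le> n" and ws: "weakly_successful n k TYPE('u)" and K: "Kl n k M" "Kl n k N" "csub n M N"
    and a: "srt N SI = insert a (srt M SI)" "a \<notin> srt M SI"
  shows "uq_triple n k a M N"
proof -
  have "leK n M N" using Kl_leK_iff[OF n K(1)] K(3) by blast
  then have "basic n k a M N" using K a by (simp add: basic_def)
  then obtain a' N' where u: "uq_triple n k a' M N'" "gtp_eq n k (a', M, N') (a, M, N)"
    using ws unfolding weakly_successful_def by blast
  obtain h where "iemb n h N N'" "\<forall>x\<in>dom M. h x = x" "h a = a'"
    using gtp_eq_pull[OF n K(3) a(1) u(2)] by blast
  then show ?thesis using uq_transfer[OF n u(1) K, of a h] a by simp
qed

section \<open>Non-forking amalgamation\<close>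

text \<open>The induction compares \<open>C1 j\<close> with the fixed model \<open>N2\<close>
  instead of \<open>C2 j\<close>. This makes limit stages immediate, since unions commute with the
  intersection, and a successor stage passes through \<open>C2 i\<close>, which contains
  \<open>N2\<close>.\<close>

lemma NFstar_disjoint:
  assumes n: "2 \<le> n" and NF: "NFstar n k N0 N1 N2 N3"
  shows "dom N1 \<inter> dom N2 = dom N0"
proof -
  obtain W :: "'a rel" and bot top C1 C2 d where
    W: "Well_order W" "bot \<in> Field W" "top \<in> Field W" "\<forall>i\<in>Field W. (bot, i) \<in> W \<and> (i, top) \<in> W"
    and C: "\<forall>i\<in>Field W. Kl n k (C1 i) \<and> Kl n k (C2 i) \<and> leK n (C1 i) (C2 i)"
      "\<forall>i j. (i, j) \<in> W \<longrightarrow> leK n (C1 i) (C1 j) \<and> leK n (C2 i) (C2 j)"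
    and lim: "\<forall>j\<in>Field W. j \<noteq> bot \<and> \<not> (\<exists>i. isucc W i j) \<longrightarrow>
            C1 j = Union_str {C1 i | i. (i, j) \<in> W \<and> i \<noteq> j} \<and>
            C2 j = Union_str {C2 i | i. (i, j) \<in> W \<and> i \<noteq> j}"
    and ends: "C1 bot = N0" "C1 top = N1" "C2 bot = N2" "C2 top = N3"
    and succ: "\<forall>i j. isucc W i j \<longrightarrow>
            d i \<in> dom (C1 j) - dom (C1 i) \<and> uq_triple n k (d i) (C1 i) (C1 j) \<and>
            nonfork n k (C1 i) (C2 i) (d i) (C2 j)"
    using NF unfolding NFstar_def by (elim conjE exE) (rule that)
  have l: "leK n N0 N1" "leK n N0 N2" using NF unfolding NFstar_def by blast+
  have wf: "wf (W - Id)" using W(1) by (simp add: well_order_on_def)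
  have "j \<in> Field W \<longrightarrow> dom (C1 j) \<inter> dom N2 \<subseteq> dom N0" for j
  proof (rule wf_induct_rule[OF wf])
    fix j assume IH: "\<And>i. (i, j) \<in> W - Id \<Longrightarrow> i \<in> Field W \<longrightarrow> dom (C1 i) \<inter> dom N2 \<subseteq> dom N0"
    have IH': "dom (C1 i) \<inter> dom N2 \<subseteq> dom N0" if "(i, j) \<in> W" "i \<noteq> j" for i
      using IH[of i] that FieldI1 by fastforce
    show "j \<in> Field W \<longrightarrow> dom (C1 j) \<inter> dom N2 \<subseteq> dom N0"
    proof
      assume j: "j \<in> Field W"
      consider "j = bot" | i where "isucc W i j" | "j \<noteq> bot" "\<not> (\<exists>i. isucc W i j)" by blast
      then show "dom (C1 j) \<inter> dom N2 \<subseteq> dom N0"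
      proof cases
        case 1 then show ?thesis using ends by simp
      next
        case 2
        have ij: "(i, j) \<in> W" "i \<noteq> j" using 2 by (auto simp: isucc_def)
        have i: "i \<in> Field W" using ij(1) by (rule FieldI1)
        have u: "uq_triple n k (d i) (C1 i) (C1 j)" "d i \<in> srt (C2 j) SI - srt (C2 i) SI"
          using succ 2 unfolding nonfork_def by blast+
        have s: "csub n (C1 i) (C2 i)" "csub n (C2 i) (C2 j)" "csub n (C1 j) (C2 j)" "csub n N2 (C2 i)"
          using C i j ij(1) W(4) ends(3) leK_csub by metis+
        have "d i \<notin> dom (C2 i)" using u(2) csub_srt[OF s(2), of SI] by blast
        \<comment> \<open>Uniqueness of the triple makes the square from \<open>i\<close> to
          \<open>j\<close> disjoint, so what \<open>C1 j\<close> has in common with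
          \<open>N2\<close> lies already in \<open>C1 i\<close>.\<close>
        then have "dom (C1 j) \<inter> dom (C2 i) = dom (C1 i)"
          using uq_disjoint[OF n u(1) _ _ s(1-3)] C i j by blast
        then show ?thesis using IH'[OF ij] csub_dom[OF s(4)] by blast
      next
        case 3
        then have "C1 j = Union_str {C1 i | i. (i, j) \<in> W \<and> i \<noteq> j}" using lim j by blast
        then have "dom (C1 j) = (\<Union>i\<in>{i. (i, j) \<in> W \<and> i \<noteq> j}. dom (C1 i))" by (auto simp: Union_str_def)
        then show ?thesis using IH' by blast
      qed
    qed
  qed
  then have "dom N1 \<inter> dom N2 \<subseteq> dom N0" using W(3) ends(2) by blast
  then show ?thesis using csub_dom[OF leK_csub[OF l(1)]] csub_dom[OF leK_csub[OF l(2)]] by blast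
qed

section \<open>Well-orders and unions of chains\<close>

text \<open>A resolution that adds the elements of \<open>D\<close> one at a time has one stage more
  than \<open>D\<close> has elements in its order; the extra top carries the final model.\<close>

lemma well_order_add_top:
  assumes r: "well_order_on D r" and t: "t \<notin> D"
  defines "W \<equiv> r \<union> insert t D \<times> {t}"
  shows "well_order_on (insert t D) W"
proof -
  have rD: "r \<subseteq> D \<times> D" and rr: "\<forall>x\<in>D. (x, x) \<in> r" and rt: "trans r" and ra: "antisym r"
    and rl: "\<forall>x\<in>D. \<forall>y\<in>D. x \<noteq> y \<longrightarrow> (x, y) \<in> r \<or> (y, x) \<in> r" and rw: "wf (r - Id)"
    using r by (auto simp: well_order_on_def order_on_defs refl_on_def total_on_def)
  have "W \<subseteq> insert t D \<times> insert t D" "refl_on (insert t D) W" "total_on (insert t D) W"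
    using rD rr rl by (auto simp: W_def refl_on_def total_on_def)
  moreover have "trans W"
    using rt rD t unfolding W_def trans_def by blast
  moreover have "antisym W"
    using ra rD t unfolding W_def antisym_def by blast
  moreover have "wf (W - Id)"
  proof (rule wfI_min)
    fix x Q assume x: "x \<in> (Q :: 'a set)"
    show "\<exists>z\<in>Q. \<forall>y. (y, z) \<in> W - Id \<longrightarrow> y \<notin> Q"
    proof (cases "Q \<inter> D = {}")
      case True
      then show ?thesis using x rD t unfolding W_def by (intro bexI[of _ x]) auto
    next
      case False
      then obtain y where "y \<in> Q \<inter> D" by blast
      then obtain z where z: "z \<in> Q \<inter> D" "\<And>y. (y, z) \<in> r - Id \<Longrightarrow> y \<notin> Q \<inter> D" using wfE_min[OF rw] by metis
      then show ?thesis using rD t unfolding W_def by (intro bexI[of _ z]) auto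
    qed
  qed
  ultimately show ?thesis by (simp add: well_order_on_def order_on_defs)
qed

lemma well_order_least:
  assumes W: "well_order_on A W" and x: "x \<in> A"
  shows "\<exists>b\<in>A. \<forall>i\<in>A. (b, i) \<in> W"
proof -
  have "wf (W - Id)" using W by (simp add: well_order_on_def)
  then obtain b where b: "b \<in> A" "\<And>y. (y, b) \<in> W - Id \<Longrightarrow> y \<notin> A" using wfE_min x by metis
  have "(b, i) \<in> W" if "i \<in> A" for i
  proof (cases "i = b")
    case True
    then show ?thesis using W b(1) by (simp add: well_order_on_def order_on_defs refl_on_def)
  next
    case False
    then have "(b, i) \<in> W \<or> (i, b) \<in> W"
      using W b(1) that by (auto simp: well_order_on_def order_on_defs total_on_def)
    then show ?thesis using b(2)[of i] False that by blast
  qed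
  then show ?thesis using b by blast
qed

text \<open>A tuple involves finitely many indices, and a finite subset of the union of a chain lies
  in one of its members.\<close>

lemma Union_str_chain:
  assumes n: "0 < n" and ne: "\<S> \<noteq> {}" and ch: "\<And>S T. S \<in> \<S> \<Longrightarrow> T \<in> \<S> \<Longrightarrow> S \<subseteq> T \<or> T \<subseteq> S"
  shows "mimg f (cstr n (\<Union>\<S>) c) = Union_str ((\<lambda>S. mimg f (cstr n S c)) ` \<S>)"
proof -
  have chain: "subset.chain UNIV \<S>" using ch by (auto simp: subset_chain_def)
  have fin: "\<exists>S\<in>\<S>. X \<subseteq> cdom n S" if X: "finite X" "X \<subseteq> cdom n (\<Union>\<S>)" for X
  proof -
    have "finite (\<Union>x\<in>X. csupp x)" "(\<Union>x\<in>X. csupp x) \<subseteq> \<Union>\<S>" using X csupp[of n "\<Union>\<S>"] by (auto simp: subset_iff)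
    then obtain S where S: "S \<in> \<S>" "(\<Union>x\<in>X. csupp x) \<subseteq> S" using finite_subset_Union_chain[OF _ _ ne chain] by metis
    have "x \<in> cdom n S" if x: "x \<in> X" for x
    proof -
      have "x \<in> cdom n (\<Union>\<S>)" using X(2) x by (rule subsetD)
      moreover have "csupp x \<subseteq> S" using S(2) x by (auto simp: UN_subset_iff)
      ultimately show ?thesis using cin_csupp[of n "\<Union>\<S>" x S] by simp
    qed
    then show ?thesis using S(1) by blast
  qed
  have mono: "cdom n S \<subseteq> cdom n (\<Union>\<S>)" if "S \<in> \<S>" for S using that by (intro cdom_mono) blast
  have "cdom n (\<Union>\<S>) = (\<Union>S\<in>\<S>. cdom n S)"
    using fin[of "{x}" for x] mono by (auto simp del: cdom_iff)
  moreover have "rels (cstr n (\<Union>\<S>) c) r = (\<Union>S\<in>\<S>. rels (cstr n S c) r)" for r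
    using fin[of "set xs" for xs] mono unfolding rels_cstr by (auto simp del: cdom_iff)
  ultimately show ?thesis by (simp add: Union_str_def mimg_def image_UN cstr_def)
qed

lemma NF_of_disjoint:
  fixes M0 M1 M2 M3 :: "'u str"
  assumes n: "2 \<le> n" and K: "Kl n k M0" "Kl n k M1" "Kl n k M2" "Kl n k M3"
    and le: "leK n M0 M1" "leK n M1 M3" "leK n M0 M2" "leK n M2 M3"
    and ws: "weakly_successful n k TYPE('u)" and dis: "dom M1 \<inter> dom M2 = dom M0"
  shows "NF n k M0 M1 M2 M3"
proof -
  have n0: "0 < n" using n by simp
  have s: "csub n M0 M1" "csub n M1 M3" "csub n M0 M2" "csub n M2 M3" using le leK_csub by blast+
  have s03: "csub n M0 M3" using csub_trans s by blast
  let ?I0 = "srt M0 SI" and ?I1 = "srt M1 SI" and ?I2 = "srt M2 SI" and ?I3 = "srt M3 SI"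
  have KN: "Kn n M0" "Kn n M3" using K by (auto simp: Kl_def)
  have I: "?I0 \<subseteq> ?I1" "?I1 \<subseteq> ?I3" "?I0 \<subseteq> ?I2" "?I2 \<subseteq> ?I3"
    using csub_srt[OF s(1), of SI] csub_srt[OF s(2), of SI] csub_srt[OF s(3), of SI] csub_srt[OF s(4), of SI] by auto
  \<comment> \<open>This is how disjointness of the models is used. Coordinates of \<open>M1\<close>
    and \<open>M2\<close> that agree over \<open>?I0\<close> agree on all of the overlap and so
    extend to \<open>M3\<close>; later the equation places the indices of \<open>M1\<close> inside
    \<open>?I0 \<union> D\<close>.\<close>
  have I12: "?I1 \<inter> ?I2 = ?I0"
    using csub_srt[OF s(2), of SI] csub_srt[OF s(4), of SI] csub_srt[OF s03, of SI] dis by auto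
  obtain f0 c0 where f0: "crd n f0 ?I0 c0 M0" "\<And>i. i \<in> ?I0 \<Longrightarrow> f0 (CI i) = i" using coords_id[OF n0 KN(1)] by blast
  obtain f1 c1 where f1: "crd n f1 ?I1 c1 M1" "\<forall>i\<in>?I1. f1 (CI i) = i" "\<forall>x\<in>cdom n ?I0. f1 x = f0 x"
    using csub_coords[OF n0 s(1) f0] by blast
  obtain f2 c2 where f2: "crd n f2 ?I2 c2 M2" "\<forall>i\<in>?I2. f2 (CI i) = i" "\<forall>x\<in>cdom n ?I0. f2 x = f0 x"
    using csub_coords[OF n0 s(3) f0] by blast
  obtain f c where f: "inj_on f (cdom n ?I3)" "\<forall>i\<in>?I3. f (CI i) = id i" "\<forall>x\<in>cdom n ?I1. f x = f1 x"
      "mimg f (cstr n ?I1 c) = M1" "mimg f (cstr n ?I2 c) = M2" "mimg f (cstr n ?I3 c) = M3"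
    using ext_coords[OF n0 f1(1) s(2) f2(1) s(4) _ I(2,4), of id] f1 f2 unfolding I12 by auto
  define T where "T S = mimg f (cstr n S c)" for S
  have T3: "crd n f ?I3 c M3" unfolding crd_def using f(1) f(6)[symmetric] by (rule conjI)
  have TS: "csub n (T S) M3" "crd n f S c (T S)" if "S \<subseteq> ?I3" for S
    using crd_restrict[OF n0 T3 that] unfolding T_def by blast+
  have Tm: "csub n (T S) (T S')" if "S \<subseteq> S'" "S' \<subseteq> ?I3" for S S'
    using crd_restrict(1)[OF n0 TS(2)[OF that(2)] that(1)] unfolding T_def .
  have TI: "srt (T S) SI = S" if "S \<subseteq> ?I3" for S
  proof -
    have "(\<lambda>i. f (CI i)) ` S = (\<lambda>i. i) ` S" using f(2) that by (intro image_cong) auto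
    then show ?thesis using crd_SI[OF n0 TS(2)[OF that]] by simp
  qed
  have T0: "T ?I0 = M0"
  proof (rule csub_antisym)
    have "f ` cdom n ?I0 = f0 ` cdom n ?I0"
    proof (rule image_cong[OF refl])
      fix x assume x: "x \<in> cdom n ?I0"
      then have "x \<in> cdom n ?I1" using cdom_mono[OF I(1), of n] by (rule rev_subsetD)
      then show "f x = f0 x" using f(3) f1(3) x by metis
    qed
    then show d: "dom (T ?I0) = dom M0" unfolding T_def using crd_dom[OF f0(1)] by simp
    show "csub n (T ?I0) M0" using csub_between[OF TS(1) s03] I d by auto
  qed
  have T123: "T ?I1 = M1" "T ?I2 = M2" "T ?I3 = M3" using f by (simp_all add: T_def)
  have TK: "Kl n k (T S)" if "?I0 \<subseteq> S" "S \<subseteq> ?I3" for S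
    using Kl_between[OF K(1,4) _ TS(1)[OF that(2)]] Tm[OF that] T0 by simp
  have Tle: "leK n (T S) (T S')" if "?I0 \<subseteq> S" "S \<subseteq> S'" "S' \<subseteq> ?I3" for S S'
    using Kl_leK_iff[OF n TK[of S]] Tm[OF that(2,3)] that by blast
  define D where "D = ?I3 - ?I2"
  \<comment> \<open>The well-order must live on elements of the models' own type and have small
    field, so an old index serves as the additional top element.\<close>
  have "?I0 \<noteq> {}" using Kl_inf[OF n0 K(1)] by auto
  then obtain t where t: "t \<in> ?I0" by blast
  have tD: "t \<notin> D" using t I by (auto simp: D_def)
  obtain r where r: "well_order_on D r" using well_order_on by blast
  define W where "W = r \<union> insert t D \<times> {t}"
  have wo: "well_order_on (insert t D) W" unfolding W_def by (rule well_order_add_top[OF r tD])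
  have Wsub: "W \<subseteq> insert t D \<times> insert t D" and Wr: "\<And>x. x \<in> insert t D \<Longrightarrow> (x, x) \<in> W"
    and Wt: "\<And>x y z. (x, y) \<in> W \<Longrightarrow> (y, z) \<in> W \<Longrightarrow> (x, z) \<in> W" and Wa: "\<And>x y. (x, y) \<in> W \<Longrightarrow> (y, x) \<in> W \<Longrightarrow> x = y"
    and Wl: "\<And>x y. x \<in> insert t D \<Longrightarrow> y \<in> insert t D \<Longrightarrow> x \<noteq> y \<Longrightarrow> (x, y) \<in> W \<or> (y, x) \<in> W"
    using wo unfolding well_order_on_def order_on_defs refl_on_def total_on_def trans_def antisym_def by metis+
  have FW: "Field W = insert t D" using Wsub Wr by (auto simp: Field_def)
  have WW: "Well_order W" using wo FW by simp
  have top: "(i, t) \<in> W" if "i \<in> insert t D" for i using that by (auto simp: W_def)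
  obtain b where b: "b \<in> insert t D" "\<And>i. i \<in> insert t D \<Longrightarrow> (b, i) \<in> W" using well_order_least[OF wo, of t] by blast
  \<comment> \<open>Stage \<open>j\<close> has received the indices strictly below \<open>j\<close>.
    Thus the bottom stage adds nothing, and the stage at \<open>t\<close> adds all of
    \<open>D\<close>.\<close>
  define U where "U j = {i. (i, j) \<in> W \<and> i \<noteq> j}" for j
  have UD: "U j \<subseteq> D" for j
  proof
    fix i assume "i \<in> U j"
    then have "(i, j) \<in> W" "i \<noteq> j" by (auto simp: U_def)
    moreover have "(j, t) \<in> W" using top Wsub calculation(1) by blast
    ultimately show "i \<in> D" using Wsub Wa by blast
  qed
  have Ub: "U b = {}" using b Wa Wsub by (auto simp: U_def)
  have Ut: "U t = D" using UD[of t] top tD by (auto simp: U_def)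
  have Um: "U i \<subseteq> U j" if "(i, j) \<in> W" for i j using that Wt Wa unfolding U_def by blast
  have Us: "U j = insert i (U i)" if "isucc W i j" for i j
  proof (intro set_eqI iffI)
    fix x assume "x \<in> U j"
    then have x: "(x, j) \<in> W" "x \<noteq> j" by (auto simp: U_def)
    show "x \<in> insert i (U i)"
    proof (cases "x = i")
      case False
      moreover have "(i, x) \<notin> W" using x that False by (auto simp: isucc_def)
      ultimately have "(x, i) \<in> W" using Wl[of x i] x(1) that Wsub by (auto simp: isucc_def)
      then show ?thesis using False by (simp add: U_def)
    qed simp
  next
    fix x assume "x \<in> insert i (U i)"
    then show "x \<in> U j" using that Um[of i j] by (auto simp: isucc_def U_def)
  qed
  \<comment> \<open>With no immediate predecessor of \<open>j\<close>, each \<open>x\<close> below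
    \<open>j\<close> has some \<open>m\<close> strictly between. For the least \<open>j\<close> both
    sides are empty.\<close>
  have Ul: "U j = \<Union>(U ` U j)" if noi: "\<not> (\<exists>i. isucc W i j)" for j
  proof (intro set_eqI iffI)
    fix x assume "x \<in> U j"
    then have x: "(x, j) \<in> W" "x \<noteq> j" by (auto simp: U_def)
    then obtain m where "(x, m) \<in> W" "(m, j) \<in> W" "m \<noteq> x" "m \<noteq> j" using noi unfolding isucc_def by blast
    then show "x \<in> \<Union>(U ` U j)" by (auto simp: U_def)
  next
    fix x assume "x \<in> \<Union>(U ` U j)"
    then obtain m where "m \<in> U j" "x \<in> U m" by blast
    then show "x \<in> U j" using Um[of m j] by (auto simp: U_def)
  qed
  have A: "?I0 \<union> U j \<subseteq> ?I3" "?I2 \<union> U j \<subseteq> ?I3" for j using UD[of j] I by (auto simp: D_def)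
  have B: "?I0 \<subseteq> ?I2 \<union> U j" "?I0 \<union> U j \<subseteq> ?I2 \<union> U j" for j using I by auto
  have lim: "T (S \<union> U j) = Union_str {T (S \<union> U i) | i. (i, j) \<in> W \<and> i \<noteq> j}"
    if j: "j \<in> insert t D" "j \<noteq> b" "\<not> (\<exists>i. isucc W i j)" for S j
  proof -
    let ?F = "(\<lambda>i. S \<union> U i) ` U j"
    have ne: "?F \<noteq> {}" using b j by (auto simp: U_def)
    have ch: "X \<subseteq> Y \<or> Y \<subseteq> X" if XY: "X \<in> ?F" "Y \<in> ?F" for X Y
    proof -
      obtain x y where xy: "x \<in> U j" "X = S \<union> U x" "y \<in> U j" "Y = S \<union> U y" using XY by blast
      then have "x \<in> insert t D" "y \<in> insert t D" using UD by blast+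
      then have "(x, y) \<in> W \<or> (y, x) \<in> W" using Wl[of x y] Wr[of x] by (cases "x = y") auto
      then show ?thesis using Um[of x y] Um[of y x] xy by blast
    qed
    have "\<Union>?F = S \<union> U j" using Ul[OF j(3)] ne by auto
    then have "T (S \<union> U j) = Union_str ((\<lambda>S. mimg f (cstr n S c)) ` ?F)"
      unfolding T_def using Union_str_chain[OF n0 ne ch] by metis
    also have "(\<lambda>S. mimg f (cstr n S c)) ` ?F = {T (S \<union> U i) | i. (i, j) \<in> W \<and> i \<noteq> j}"
      by (auto simp: T_def U_def)
    finally show ?thesis .
  qed
  have cF: "card_le_aleph k (Field W)"
  proof -
    have "insert t D \<subseteq> dom M3" using t I srt_dom[OF KN(2)] by (auto simp: D_def)
    then show ?thesis unfolding card_le_aleph_def FW using K(4) card_of_mono1 unfolding Kl_def by blast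
  qed
  \<comment> \<open>The labels are the indices, so the step from \<open>i\<close> to its successor
    adds exactly the index \<open>i\<close> to both chains and \<open>d\<close> can be the identity.
    The lower step is a one-index extension, hence a uniqueness triple, and non-forking only says
    that \<open>i\<close> is new to the upper model.\<close>
  have succ: "i \<in> dom (T (?I0 \<union> U j)) - dom (T (?I0 \<union> U i)) \<and> uq_triple n k i (T (?I0 \<union> U i)) (T (?I0 \<union> U j)) \<and>
       nonfork n k (T (?I0 \<union> U i)) (T (?I2 \<union> U i)) i (T (?I2 \<union> U j))" if ij: "isucc W i j" for i j
  proof -
    have Uj: "U j = insert i (U i)" using Us[OF ij] .
    have i: "i \<in> D" using Uj UD[of j] by blast
    have ni: "i \<notin> U i" "i \<notin> ?I0" "i \<notin> ?I2" using i I by (auto simp: U_def D_def)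
    have le0: "?I0 \<union> U i \<subseteq> ?I0 \<union> U j" "?I2 \<union> U i \<subseteq> ?I2 \<union> U j" using Uj by auto
    have uq: "uq_triple n k i (T (?I0 \<union> U i)) (T (?I0 \<union> U j))"
    proof (rule onepoint_uq[OF n ws TK[OF Un_upper1 A(1)] TK[OF Un_upper1 A(1)] Tm[OF le0(1) A(1)]])
      show "srt (T (?I0 \<union> U j)) SI = insert i (srt (T (?I0 \<union> U i)) SI)" unfolding TI[OF A(1)] using Uj by blast
      show "i \<notin> srt (T (?I0 \<union> U i)) SI" unfolding TI[OF A(1)] using ni by blast
    qed
    moreover have "nonfork n k (T (?I0 \<union> U i)) (T (?I2 \<union> U i)) i (T (?I2 \<union> U j))"
      unfolding nonfork_def
    proof (intro conjI)
      show "i \<in> srt (T (?I2 \<union> U j)) SI - srt (T (?I2 \<union> U i)) SI"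
        unfolding TI[OF A(2)] using ni Uj by blast
    qed (intro TK Tle Un_upper1 A B le0)+
    ultimately show ?thesis using uq unfolding uq_triple_def by blast
  qed
  \<comment> \<open>Both chains add the same indices, and the upper one has to run from
    \<open>M2\<close> to \<open>M3\<close>. The lower chain may therefore overshoot
    \<open>M1\<close>, which \<open>NF\<close> permits because it only asks for a model above
    \<open>M1\<close>.\<close>
  define N1 where "N1 = T (?I0 \<union> D)"
  have DI: "?I0 \<union> D \<subseteq> ?I3" "?I2 \<union> D = ?I3" "?I1 \<subseteq> ?I0 \<union> D" using I I12 by (auto simp: D_def)
  have le': "leK n M1 N1" "leK n M0 N1" "leK n N1 M3" "leK n M0 M3" "leK n M2 M2" "leK n M3 M3"
    using Tle[OF I(1) DI(3,1)] Tle[OF _ _ DI(1), of ?I0] Tle[OF _ DI(1)] Tle[of ?I0 ?I3] Tle[of ?I2 ?I2] Tle[of ?I3 ?I3] I T0 T123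
    by (auto simp: N1_def)
  have KN1: "Kl n k N1" using TK DI(1) by (simp add: N1_def)
  have "NFstar n k M0 N1 M2 M3" unfolding NFstar_def
  proof (intro conjI)
    show "\<exists>(W::'u rel) bot top C1 C2 d.
        Well_order W \<and> card_le_aleph k (Field W) \<and>
        bot \<in> Field W \<and> top \<in> Field W \<and> (\<forall>i\<in>Field W. (bot, i) \<in> W \<and> (i, top) \<in> W) \<and>
        (\<forall>i\<in>Field W. Kl n k (C1 i) \<and> Kl n k (C2 i) \<and> leK n (C1 i) (C2 i)) \<and>
        (\<forall>i j. (i, j) \<in> W \<longrightarrow> leK n (C1 i) (C1 j) \<and> leK n (C2 i) (C2 j)) \<and>
        (\<forall>j\<in>Field W. j \<noteq> bot \<and> \<not> (\<exists>i. isucc W i j) \<longrightarrow>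
            C1 j = Union_str {C1 i | i. (i, j) \<in> W \<and> i \<noteq> j} \<and>
            C2 j = Union_str {C2 i | i. (i, j) \<in> W \<and> i \<noteq> j}) \<and>
        C1 bot = M0 \<and> C1 top = N1 \<and> C2 bot = M2 \<and> C2 top = M3 \<and>
        (\<forall>i j. isucc W i j \<longrightarrow>
            d i \<in> dom (C1 j) - dom (C1 i) \<and> uq_triple n k (d i) (C1 i) (C1 j) \<and>
            nonfork n k (C1 i) (C2 i) (d i) (C2 j))"
    proof (rule exI[of _ W], rule exI[of _ b], rule exI[of _ t], rule exI[of _ "\<lambda>j. T (?I0 \<union> U j)"],
        rule exI[of _ "\<lambda>j. T (?I2 \<union> U j)"], rule exI[of _ "\<lambda>i. i"], intro conjI)
      show "\<forall>i\<in>Field W. Kl n k (T (?I0 \<union> U i)) \<and> Kl n k (T (?I2 \<union> U i)) \<and> leK n (T (?I0 \<union> U i)) (T (?I2 \<union> U i))"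
        by (intro ballI conjI TK Tle Un_upper1 A B)
      show "\<forall>i j. (i, j) \<in> W \<longrightarrow> leK n (T (?I0 \<union> U i)) (T (?I0 \<union> U j)) \<and> leK n (T (?I2 \<union> U i)) (T (?I2 \<union> U j))"
        by (intro allI impI conjI Tle Un_upper1 A B Un_mono order_refl Um)
      show "\<forall>j\<in>Field W. j \<noteq> b \<and> \<not> (\<exists>i. isucc W i j) \<longrightarrow>
            T (?I0 \<union> U j) = Union_str {T (?I0 \<union> U i) | i. (i, j) \<in> W \<and> i \<noteq> j} \<and>
            T (?I2 \<union> U j) = Union_str {T (?I2 \<union> U i) | i. (i, j) \<in> W \<and> i \<noteq> j}"
        using lim unfolding FW by blast
      show "\<forall>i j. isucc W i j \<longrightarrow> i \<in> dom (T (?I0 \<union> U j)) - dom (T (?I0 \<union> U i)) \<and>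
         uq_triple n k i (T (?I0 \<union> U i)) (T (?I0 \<union> U j)) \<and>
         nonfork n k (T (?I0 \<union> U i)) (T (?I2 \<union> U i)) i (T (?I2 \<union> U j))"
        using succ by blast
    qed (use WW cF FW b top Ub Ut T0 T123 DI N1_def in auto)
  qed (use K KN1 le le' in auto)
  then show ?thesis unfolding NF_def using K KN1 le' by blast
qed

theorem theorem7p2:
  fixes n k :: nat and M0 M1 M2 M3 :: "'u str"
  assumes "3 \<le> n" and "k \<le> n - 3"
    and "Kl n k M0" and "Kl n k M1" and "Kl n k M2" and "Kl n k M3"
    and "leK n M0 M1" and "leK n M1 M3" and "leK n M0 M2" and "leK n M2 M3"
    and "weakly_successful n k TYPE('u)"
  shows "NF n k M0 M1 M2 M3 \<longleftrightarrow> dom M1 \<inter> dom M2 = dom M0"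
proof
  have n: "2 \<le> n" using assms(1) by simp
  assume "NF n k M0 M1 M2 M3"
  then obtain N1 N2 N3 where N: "leK n M1 N1" "leK n M2 N2" "NFstar n k M0 N1 N2 N3"
    unfolding NF_def by blast
  have "dom N1 \<inter> dom N2 = dom M0" using NFstar_disjoint[OF n N(3)] .
  then show "dom M1 \<inter> dom M2 = dom M0"
    using csub_dom[OF leK_csub[OF N(1)]] csub_dom[OF leK_csub[OF N(2)]]
      csub_dom[OF leK_csub[OF assms(7)]] csub_dom[OF leK_csub[OF assms(9)]] by blast
next
  have n: "2 \<le> n" using assms(1) by simp
  assume "dom M1 \<inter> dom M2 = dom M0"
  then show "NF n k M0 M1 M2 M3" using NF_of_disjoint[OF n assms(3-11)] by blast
qed

end
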